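(* Let $k\in\mathbb{N}$, $k\ge1$. The map \[\Psi\colon\mathcal{L}(F^2_{(k)})\to L^\infty(\mathbb{C}),\qquad A\mapsto (k_{0,(k)}\otimes k_{0,(k)})\ast A\] is injective if and only if $k=1$. For $k>1$, the kernel of $\Psi$ is exactly the weak$^\ast$ closure (with respect to the predual $\mathcal{T}^1(F^2_{(k)})$) of the linear span of all Weyl operators $W_\xi$ (acting on $F^2_{(k)}$) with $\xi\in\Sigma_k:=\{\xi\in\mathbb{C}:L^0_{k-1}(|\xi|^2)=0\}$.
   Context: Let $\mathrm{d}\mu(z)=\frac1\pi e^{-|z|^2}\,\mathrm{d}z$ on $\mathbb{C}\cong\mathbb{R}^2$. For $n\ge1$, $F_n^2$ is the closed subspace of $L^2(\mathbb{C},\mu)$ of smooth functions $f$ with $\partial^n f/\partial\overline z^n=0$; the true polyanalytic Fock spaces are $F^2_{(1)}:=F^2_1$ and $F^2_{(k)}:=F^2_k\ominus F^2_{k-1}$ for $k\ge2$. $\mathcal{L}(H)$ and $\mathcal{T}^1(H)$ denote the bounded and the trace class operators on a Hilbert space $H$. The Weyl operators $W_z f(w)=e^{w\overline z-|z|^2/2}f(w-z)$ are unitary on $L^2(\mathbb{C},\mu)$ and leave each $F^2_{(k)}$ invariant. $L_m^\alpha(x)=\sum_{j=0}^m(-1)^j\binom{m+\alpha}{m-j}\frac{x^j}{j!}$ are the generalized Laguerre polynomials. The normalized reproducing kernels of $F^2_{(k)}$ are $k_{z,(k)}(w)=L^0_{k-1}(|w-z|^2)e^{w\overline z-|z|^2/2}$.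 $(g\otimes h)(\varphi)=\langle\varphi,h\rangle g$ (inner product linear in the first entry). The parity operator is $Uf(z)=f(-z)$. For $A\in\mathcal{T}^1(F^2_{(k)})$, $B\in\mathcal{L}(F^2_{(k)})$ the convolution is the function $A\ast B(z)=\operatorname{tr}(A\,W_zU\,B\,UW_{-z})$ on $\mathbb{C}$. In particular $\Psi(A)(z)=\langle Ak_{z,(k)},k_{z,(k)}\rangle$, i.e. $\Psi(A)$ is the Berezin transform $\widetilde A$ of $A$. *)

theory Defs
  imports "HOL-Analysis.Analysis"
begin

section \<open>The Gaussian space $L^2(\mathbb{C},\mu)$\<close>

definition gauss :: "complex measure" where
  "gauss = density lborel (\<lambda>z. ennreal (exp (- (cmod z)\<^sup>2) / pi))"

definition L2_gauss :: "(complex \<Rightarrow> complex) set" where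
  "L2_gauss = {f \<in> borel_measurable gauss. integrable gauss (\<lambda>z. (cmod (f z))\<^sup>2)}"

definition ip :: "(complex \<Rightarrow> complex) \<Rightarrow> (complex \<Rightarrow> complex) \<Rightarrow> complex" where
  "ip f g = (\<integral>z. f z * cnj (g z) \<partial>gauss)"

definition nrm :: "(complex \<Rightarrow> complex) \<Rightarrow> real" where
  "nrm f = sqrt (\<integral>z. (cmod (f z))\<^sup>2 \<partial>gauss)"


section \<open>Polyanalytic Fock spaces\<close>

definition dx :: "(complex \<Rightarrow> complex) \<Rightarrow> complex \<Rightarrow> complex" where
  "dx f z = frechet_derivative f (at z) 1"

definition dy :: "(complex \<Rightarrow> complex) \<Rightarrow> complex \<Rightarrow> complex" where
  "dy f z = frechet_derivative f (at z) \<i>"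

text \<open>Differentiability is over the reals, so \<open>C_real n\<close> is the class $C^n(\mathbb{R}^2)$.\<close>

fun C_real :: "nat \<Rightarrow> (complex \<Rightarrow> complex) \<Rightarrow> bool" where
  "C_real 0 f \<longleftrightarrow> continuous_on UNIV f"
| "C_real (Suc n) f \<longleftrightarrow> (\<forall>z. f differentiable (at z)) \<and> C_real n (dx f) \<and> C_real n (dy f)"

definition smooth :: "(complex \<Rightarrow> complex) \<Rightarrow> bool" where
  "smooth f \<longleftrightarrow> (\<forall>n. C_real n f)"

definition dbar :: "(complex \<Rightarrow> complex) \<Rightarrow> complex \<Rightarrow> complex" where
  "dbar f z = (dx f z + \<i> * dy f z) / 2"

text \<open>An element of $F^2_n$, which is an almost-everywhere class, is represented by its unique
  smooth member; on these representatives \<open>ip\<close> is positive definite, and equality of elements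
  is equality of functions.\<close>

definition fock :: "nat \<Rightarrow> (complex \<Rightarrow> complex) set" where
  "fock n = {f \<in> L2_gauss. smooth f \<and> (dbar ^^ n) f = (\<lambda>_. 0)}"

definition true_fock :: "nat \<Rightarrow> (complex \<Rightarrow> complex) set" where
  "true_fock k = (if k = 1 then fock 1 else {f \<in> fock k. \<forall>g \<in> fock (k - 1). ip f g = 0})"


section \<open>Bounded and trace class operators on a closed subspace \<open>H\<close>\<close>

text \<open>Operators on \<open>H\<close> are extensional functions, so that equality of operators is equality
  on \<open>H\<close>.\<close>

definition bounded_ops ::
  "(complex \<Rightarrow> complex) set \<Rightarrow> ((complex \<Rightarrow> complex) \<Rightarrow> (complex \<Rightarrow> complex)) set" where
  "bounded_ops H = {A \<in> H \<rightarrow>\<^sub>E H.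
     (\<forall>f\<in>H. \<forall>g\<in>H. A (\<lambda>z. f z + g z) = (\<lambda>z. A f z + A g z)) \<and>
     (\<forall>c. \<forall>f\<in>H. A (\<lambda>z. c * f z) = (\<lambda>z. c * A f z)) \<and>
     (\<exists>C. \<forall>f\<in>H. nrm (A f) \<le> C * nrm f)}"

definition is_onb :: "(complex \<Rightarrow> complex) set \<Rightarrow> (complex \<Rightarrow> complex) set \<Rightarrow> bool" where
  "is_onb H E \<longleftrightarrow> E \<subseteq> H \<and>
     (\<forall>e\<in>E. \<forall>e'\<in>E. ip e e' = (if e = e' then 1 else 0)) \<and>
     (\<forall>f\<in>H. (\<forall>e\<in>E. ip f e = 0) \<longrightarrow> f = (\<lambda>_. 0))"

text \<open>\<open>P\<close> is the absolute value $|A| = (A^*A)^{1/2}$: it is positive and $P^2 = A^*A$, the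
  latter written in weak form, with the adjoint moved to the other side of the inner product.\<close>

definition is_abs_op ::
  "(complex \<Rightarrow> complex) set \<Rightarrow> ((complex \<Rightarrow> complex) \<Rightarrow> (complex \<Rightarrow> complex))
    \<Rightarrow> ((complex \<Rightarrow> complex) \<Rightarrow> (complex \<Rightarrow> complex)) \<Rightarrow> bool" where
  "is_abs_op H A P \<longleftrightarrow> P \<in> bounded_ops H \<and>
     (\<forall>f\<in>H. ip (P f) f \<in> \<real> \<and> 0 \<le> Re (ip (P f) f)) \<and>
     (\<forall>f\<in>H. \<forall>g\<in>H. ip (P (P f)) g = ip (A f) (A g))"

definition trace_class ::
  "(complex \<Rightarrow> complex) set \<Rightarrow> ((complex \<Rightarrow> complex) \<Rightarrow> (complex \<Rightarrow> complex)) set" where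
  "trace_class H = {A \<in> bounded_ops H.
     \<exists>P E. is_abs_op H A P \<and> is_onb H E \<and> (\<lambda>e. ip (P e) e) summable_on E}"

text \<open>For trace class \<open>A\<close> the value does not depend on the basis that is chosen.\<close>

definition op_trace ::
  "(complex \<Rightarrow> complex) set \<Rightarrow> ((complex \<Rightarrow> complex) \<Rightarrow> (complex \<Rightarrow> complex)) \<Rightarrow> complex" where
  "op_trace H A = (\<Sum>\<^sub>\<infinity>e\<in>(SOME E. is_onb H E). ip (A e) e)"

definition op_span ::
  "(complex \<Rightarrow> complex) set \<Rightarrow> ((complex \<Rightarrow> complex) \<Rightarrow> (complex \<Rightarrow> complex)) set
    \<Rightarrow> ((complex \<Rightarrow> complex) \<Rightarrow> (complex \<Rightarrow> complex)) set" where
  "op_span H X = {\<lambda>f\<in>H. \<lambda>w. (\<Sum>B\<in>S. c B * B f w) | S c. finite S \<and> S \<subseteq> X}"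

text \<open>The coarsest topology on the bounded operators that makes all functionals
  $A \mapsto \mathrm{tr}(AT)$ with $T$ of trace class continuous.\<close>

definition weak_star ::
  "(complex \<Rightarrow> complex) set \<Rightarrow> ((complex \<Rightarrow> complex) \<Rightarrow> (complex \<Rightarrow> complex)) topology" where
  "weak_star H = pullback_topology (bounded_ops H)
     (\<lambda>A. \<lambda>T\<in>trace_class H. op_trace H (A \<circ> T))
     (product_topology (\<lambda>_. euclidean) (trace_class H))"


section \<open>Weyl operators, convolution and the map $\Psi$\<close>

definition weyl :: "complex \<Rightarrow> (complex \<Rightarrow> complex) \<Rightarrow> complex \<Rightarrow> complex" where
  "weyl z f w = exp (w * cnj z - complex_of_real ((cmod z)\<^sup>2) / 2) * f (w - z)"

definition parity :: "(complex \<Rightarrow> complex) \<Rightarrow> complex \<Rightarrow> complex" where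
  "parity f z = f (- z)"

definition rank_one ::
  "(complex \<Rightarrow> complex) set \<Rightarrow> (complex \<Rightarrow> complex) \<Rightarrow> (complex \<Rightarrow> complex)
    \<Rightarrow> (complex \<Rightarrow> complex) \<Rightarrow> (complex \<Rightarrow> complex)" where
  "rank_one H g h = (\<lambda>\<phi>\<in>H. \<lambda>w. ip \<phi> h * g w)"

definition convol ::
  "(complex \<Rightarrow> complex) set \<Rightarrow> ((complex \<Rightarrow> complex) \<Rightarrow> (complex \<Rightarrow> complex))
    \<Rightarrow> ((complex \<Rightarrow> complex) \<Rightarrow> (complex \<Rightarrow> complex)) \<Rightarrow> complex \<Rightarrow> complex" where
  "convol H A B z = op_trace H (A \<circ> weyl z \<circ> parity \<circ> B \<circ> parity \<circ> weyl (- z))"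

definition laguerre :: "nat \<Rightarrow> real \<Rightarrow> real \<Rightarrow> real" where
  "laguerre m \<alpha> x =
     (\<Sum>j\<le>m. (- 1) ^ j * ((real m + \<alpha>) gchoose (m - j)) * (x ^ j / fact j))"

definition nkernel :: "nat \<Rightarrow> complex \<Rightarrow> complex \<Rightarrow> complex" where
  "nkernel k z w = complex_of_real (laguerre (k - 1) 0 ((cmod (w - z))\<^sup>2))
     * exp (w * cnj z - complex_of_real ((cmod z)\<^sup>2) / 2)"

definition Sigma_set :: "nat \<Rightarrow> complex set" where
  "Sigma_set k = {\<xi>. laguerre (k - 1) 0 ((cmod \<xi>)\<^sup>2) = 0}"

text \<open>$L^\infty(\mathbb{C})$ consists of classes of functions modulo equality almost everywhere.\<close>

definition ae_class :: "(complex \<Rightarrow> complex) \<Rightarrow> (complex \<Rightarrow> complex) set" where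
  "ae_class f = {g \<in> borel_measurable lborel. AE z in lborel. g z = f z}"

definition Linfty :: "(complex \<Rightarrow> complex) set set" where
  "Linfty = {ae_class f | f. f \<in> borel_measurable lborel \<and>
     (\<exists>C. AE z in lborel. cmod (f z) \<le> C)}"

definition Psi ::
  "nat \<Rightarrow> ((complex \<Rightarrow> complex) \<Rightarrow> (complex \<Rightarrow> complex)) \<Rightarrow> (complex \<Rightarrow> complex) set" where
  "Psi k A = ae_class
     (convol (true_fock k) (rank_one (true_fock k) (nkernel k 0) (nkernel k 0)) A)"

end

theory Submission
  imports Defs "HOL-Complex_Analysis.Complex_Analysis" "HOL-Probability.Distributions"
begin

text \<open>Write \<open>N = k - 1\<close>. The normalized complex Hermite functions \<open>ebas N m\<close> form an orthonormal
  basis of the true polyanalytic Fock space, and everything is read off from matrix entries.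

  Suppose that the Berezin transform of \<open>A\<close> vanishes. Averaging over rotations shows that this
  happens for each diagonal of \<open>A\<close> separately, and the lowest power of the radius then shows that
  a diagonal with vanishing transform is determined by its first \<open>N\<close> entries. For \<open>N = 0\<close> this is
  injectivity. In general the Laguerre polynomial has \<open>N\<close> distinct positive zeros, and by a
  Vandermonde determinant the first \<open>N\<close> entries of any diagonal are those of a combination of the
  \<open>N\<close> Weyl operators at the positive points of the zero circles, whose own transforms vanish; so the
  whole diagonal is the corresponding diagonal of this combination. The diagonals of a Weyl
  operator \<open>W\<^sub>r\<close> are limits of averages of \<open>W\<^bsub>ru\<^esub>\<close> over roots of unity \<open>u\<close>, and \<open>A\<close> is the
  weak-star limit of the Fejer means of its diagonals.

  Conversely, the reproducing property makes the transform of \<open>W\<^bsub>\<xi>\<^esub>\<close> at \<open>z\<close> a multiple of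
  the Laguerre polynomial at the square of the modulus of \<open>\<xi>\<close>, and vanishing of the transform is a weak-star
  closed condition.\<close>

section \<open>Integrals against the Gaussian measure\<close>

text \<open>The number \<open>N\<close> enters twice. Near the origin the product of
  \<open>ebas N p\<close> and \<open>ebas N (p + d)\<close> vanishes to an order that grows with
  \<open>p\<close> only from \<open>p = N\<close> on; below that the orders do not increase, so
  comparing lowest powers says nothing about the first \<open>N\<close> entries of a diagonal. The
  zeros of the Laguerre polynomial provide \<open>N\<close> radii, hence enough Weyl operators to
  match those entries, with the same radii on every diagonal. The analytic obstacle is that matrix
  entries control a weak-star limit only under a uniform norm bound. Fejer means never exceed the
  norm of \<open>A\<close>, which plain sums of diagonals do not guarantee. The bound for the Weyl
  averages may grow with the Fejer mean they approximate, so two limits are taken one after the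
  other. That matrix entries then suffice rests on a nuclear representation of trace class
  operators, which also makes the trace independent of the basis.\<close>

lemma sets_gauss [measurable_cong, simp]: "sets gauss = sets borel"
  by (simp add: gauss_def)

lemma space_gauss [simp]: "space gauss = UNIV"
  by (simp add: gauss_def)

lemma borel_measurable_cnj [measurable (raw)]:
  "f \<in> borel_measurable M \<Longrightarrow> (\<lambda>x. cnj (f x)) \<in> borel_measurable M"
  by (rule borel_measurable_continuous_on[OF continuous_on_cnj[OF continuous_on_id]])

lemma nn_integral_gauss:
  assumes [measurable]: "f \<in> borel_measurable borel"
  shows "(\<integral>\<^sup>+z. f z \<partial>gauss) = (\<integral>\<^sup>+z. ennreal (exp (- (cmod z)\<^sup>2) / pi) * f z \<partial>lborel)"
  unfolding gauss_def by (subst nn_integral_density) auto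

lemma AE_gauss_iff: "(AE z in gauss. P z) \<longleftrightarrow> (AE z in lborel. P z)"
  unfolding gauss_def by (subst AE_density) auto

text \<open>A disc of radius sqrt a has area pi a, so area is carried to pi times length on the half
  line. The identity is checked on the intersection-stable sets {..a} and stands in for polar
  coordinates.\<close>

lemma distr_cmod_square:
  "distr lborel borel (\<lambda>z::complex. (cmod z)\<^sup>2) = density lborel (\<lambda>t. ennreal pi * indicator {0..} t)"
proof (rule measure_eqI_generator_eq[where E = "range atMost" and A = "\<lambda>i. {..real i}" and \<Omega> = UNIV])
  show "Int_stable (range (atMost :: real \<Rightarrow> _))"
    by (auto simp: Int_stable_def)
  show "(\<Union>i. {..real i}) = UNIV"
    using real_arch_simple by auto
  have pre: "(\<lambda>z. (cmod z)\<^sup>2) -` {..a} = (if a < 0 then {} else cball 0 (sqrt a))" for a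
  proof (cases "a < 0")
    case True
    then show ?thesis using zero_le_power2[of "cmod _"] by (fastforce simp: not_le dest: le_less_trans)
  next
    case False
    then have "(cmod z)\<^sup>2 \<le> a \<longleftrightarrow> cmod z \<le> sqrt a" for z
      using power_mono_iff[of "cmod z" "sqrt a" 2] by simp
    with False show ?thesis by auto
  qed
  have e1: "emeasure (distr lborel borel (\<lambda>z::complex. (cmod z)\<^sup>2)) {..a} = (if a < 0 then 0 else ennreal (pi * a))" for a
    by (subst emeasure_distr) (auto simp: pre emeasure_cball unit_ball_vol_2 mult.commute)
  have "emeasure (density lborel (\<lambda>t. ennreal pi * indicator {0..} t)) {..a} = (\<integral>\<^sup>+t. ennreal pi * indicator {0..a} t \<partial>lborel)" for a :: real
    by (subst emeasure_density) (auto intro!: nn_integral_cong simp: indicator_def)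
  also have "\<dots>a = (if a < 0 then 0 else ennreal (pi * a))" for a
    by (subst nn_integral_cmult_indicator) (auto simp: ennreal_mult)
  finally have e2: "emeasure (density lborel (\<lambda>t. ennreal pi * indicator {0..} t)) {..a} = (if a < 0 then 0 else ennreal (pi * a))" for a :: real .
  show "emeasure (distr lborel borel (\<lambda>z::complex. (cmod z)\<^sup>2)) X = emeasure (density lborel (\<lambda>t. ennreal pi * indicator {0..} t)) X"
    if "X \<in> range atMost" for X
    using that by (auto simp: e1 e2)
  show "emeasure (distr lborel borel (\<lambda>z::complex. (cmod z)\<^sup>2)) {..real i} \<noteq> \<infinity>" for i
    by (simp add: e1)
qed (auto simp: borel_eq_atMost)

text \<open>In the variable t = |z|^2 the moment is the Gamma integral of t^p exp(-t); the pi of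
  \<open>distr_cmod_square\<close> cancels the 1/pi of the density.\<close>

lemma nn_integral_gauss_cmod_power:
  "(\<integral>\<^sup>+z. ennreal (cmod z ^ (2 * p)) \<partial>gauss) = ennreal (fact p)"
proof -
  have "(\<integral>\<^sup>+z. ennreal (cmod z ^ (2 * p)) \<partial>gauss)
      = (\<integral>\<^sup>+z. (\<lambda>t. ennreal (t ^ p * exp (- t) / pi)) ((cmod z)\<^sup>2) \<partial>lborel)"
    by (subst nn_integral_gauss)
       (auto intro!: nn_integral_cong simp: ennreal_mult[symmetric] power_mult[symmetric] mult.commute)
  also have "\<dots> = (\<integral>\<^sup>+t. ennreal (t ^ p * exp (- t) / pi) \<partial>distr lborel borel (\<lambda>z::complex. (cmod z)\<^sup>2))"
    by (subst nn_integral_distr) auto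
  also have "\<dots> = (\<integral>\<^sup>+t. ennreal (t ^ p * exp (- t)) * indicator {0..} t \<partial>lborel)"
    unfolding distr_cmod_square
    by (subst nn_integral_density)
       (auto intro!: nn_integral_cong simp: indicator_def ennreal_mult[symmetric])
  also have "\<dots> = ennreal (fact p)"
    by (subst nn_intergal_power_times_exp_Ici) auto
  finally show ?thesis .
qed

lemma integral_gauss_cmod_power:
  "integrable gauss (\<lambda>z. cmod z ^ (2 * p))" "(\<integral>z. cmod z ^ (2 * p) \<partial>gauss) = fact p"
  using nn_integral_eq_integrable[of "\<lambda>z. cmod z ^ (2 * p)" gauss "fact p"] nn_integral_gauss_cmod_power[of p]
  by auto

lemma finite_measure_gauss: "finite_measure gauss"
proof
  have "emeasure gauss (space gauss) = (\<integral>\<^sup>+z. ennreal (cmod z ^ (2 * 0)) \<partial>gauss)"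
    by simp
  then show "emeasure gauss (space gauss) \<noteq> \<infinity>"
    by (metis nn_integral_gauss_cmod_power ennreal_neq_top infinity_ennreal_def)
qed

lemma measurable_gauss_iff: "borel_measurable gauss = borel_measurable borel"
  by (rule measurable_cong_sets) auto

section \<open>Invariance of the Gaussian integral under rotation and translation\<close>

definition real2_complex :: "real ^ 2 \<Rightarrow> complex" where
  "real2_complex x = Complex (x $ 1) (x $ 2)"

lemma real2_complex_measurable [measurable]: "real2_complex \<in> borel_measurable borel"
  unfolding real2_complex_def Complex_eq by measurable

lemma lborel_complex_eq_distr: "(lborel :: complex measure) = distr lborel borel real2_complex"
proof (rule lborel_eqI)
  fix l u :: complex
  assume le: "\<And>b. b \<in> Basis \<Longrightarrow> l \<bullet> b \<le> u \<bullet> b"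
  then have le': "Re l \<le> Re u" "Im l \<le> Im u"
    using le[of 1] le[of \<i>] by (auto simp: Basis_complex_def)
  define L :: "real^2" where "L = (\<chi> i. if i = 1 then Re l else Im l)"
  define U :: "real^2" where "U = (\<chi> i. if i = 1 then Re u else Im u)"
  have "real2_complex -` box l u = box L U"
    by (auto simp: real2_complex_def box_def Basis_complex_def L_def U_def mem_box_cart forall_2 Basis_vec_def inner_axis)
  then have "emeasure (distr lborel borel real2_complex) (box l u) = emeasure lborel (box L U)"
    by (subst emeasure_distr) auto
  also have "\<dots> = (\<Prod>b\<in>Basis. (U - L) \<bullet> b)"
    using le' by (intro emeasure_lborel_box) (auto simp: Basis_vec_def inner_axis L_def U_def)
  also have "(Basis :: (real^2) set) = {axis 1 1, axis 2 1}"
    by (auto simp: Basis_vec_def UNIV_2)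
  also have "(\<Prod>b\<in>{axis 1 1, axis 2 1}. (U - L) \<bullet> b) = (Re u - Re l) * (Im u - Im l)"
    by (subst prod.insert) (auto simp: axis_eq_axis inner_axis U_def L_def)
  also have "\<dots> = (\<Prod>b\<in>Basis. (u - l) \<bullet> b)"
    by (simp add: Basis_complex_def)
  finally show "emeasure (distr lborel borel real2_complex) (box l u) = ennreal (\<Prod>b\<in>Basis. (u - l) \<bullet> b)" .
qed auto

text \<open>Transported to \<open>real ^ 2\<close>, where \<open>measure_orthogonal_image\<close>
  applies: in these coordinates the preimage of a box is the image of a measurable set under an
  orthogonal map.\<close>

lemma lborel_distr_rotation:
  assumes u: "cmod u = 1"
  shows "distr lborel borel (\<lambda>z. u * z) = lborel"
proof (rule lborel_eqI[symmetric])
  fix l r :: complex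
  assume le: "\<And>b. b \<in> Basis \<Longrightarrow> l \<bullet> b \<le> r \<bullet> b"
  \<comment> \<open>\<open>R\<close> is multiplication by cnj u, the inverse of the rotation, in
    real coordinates.\<close>
  define R where "R x = (vector [Re u * x$1 + Im u * x$2, Re u * x$2 - Im u * x$1] :: real^2)" for x :: "real^2"
  have sq: "(Re u)\<^sup>2 + (Im u)\<^sup>2 = 1"
    using u by (simp add: cmod_def)
  have T: "real2_complex (R x) = cnj u * real2_complex x" for x
    by (simp add: real2_complex_def R_def complex_eq_iff)
  have inv: "u * cnj u = 1"
    using u by (simp add: complex_eq_iff power2_eq_square[symmetric] cmod_def)
  have "linear R"
    by (rule linearI) (simp_all add: R_def vec_eq_iff forall_2 algebra_simps)
  moreover have "R v \<bullet> R w = v \<bullet> w" for v w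
  proof -
    have "R v \<bullet> R w = ((Re u)\<^sup>2 + (Im u)\<^sup>2) * (v \<bullet> w)"
      by (simp add: R_def inner_vec_def sum_2 power2_eq_square algebra_simps)
    then show ?thesis by (simp add: sq)
  qed
  ultimately have orth: "orthogonal_transformation R"
    by (simp add: orthogonal_transformation_def)
  define S where "S = real2_complex -` box l r"
  have "real2_complex x = real2_complex y \<longleftrightarrow> x = y" for x y
    by (auto simp: real2_complex_def vec_eq_iff forall_2)
  have surjR: "\<exists>y. x = R y" for x
    using orthogonal_transformation_surj[OF orth] by (metis surjE)
  have pre: "real2_complex -` ((\<lambda>z. u * z) -` box l r) = R ` S"
  proof (intro set_eqI iffI)
    fix x assume x: "x \<in> real2_complex -` ((\<lambda>z. u * z) -` box l r)"
    obtain y where y: "x = R y" using surjR by blast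
    have "u * real2_complex x = real2_complex y"
      unfolding y T mult.assoc[symmetric] inv by simp
    with x have "y \<in> S" by (simp add: S_def)
    then show "x \<in> R ` S" using y by blast
  next
    fix x assume "x \<in> R ` S"
    then obtain y where y: "x = R y" "y \<in> S" by blast
    have "u * real2_complex x = real2_complex y"
      unfolding y T mult.assoc[symmetric] inv by simp
    with y show "x \<in> real2_complex -` ((\<lambda>z. u * z) -` box l r)" by (simp add: S_def)
  qed
  have Sb: "S \<in> sets borel"
    using measurable_sets_borel[OF real2_complex_measurable, of "box l r"] by (simp add: S_def)
  have eS: "emeasure lborel S = emeasure lborel (box l r)"
    using emeasure_distr[of real2_complex lborel borel "box l r"]
    by (simp add: lborel_complex_eq_distr[symmetric] S_def)
  then have "emeasure lborel S < \<infinity>" by (simp add: emeasure_lborel_box_eq)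
  then have Sm: "S \<in> lmeasurable"
    using Sb by (auto simp: fmeasurable_def)
  have RSb: "R ` S \<in> sets borel"
    unfolding pre[symmetric]
    by (intro measurable_sets_borel[OF real2_complex_measurable] measurable_sets_borel[where M = borel]) auto
  have "emeasure (distr lborel borel (\<lambda>z. u * z)) (box l r) = emeasure lborel ((\<lambda>z. u * z) -` box l r)"
    by (subst emeasure_distr) auto
  also have "\<dots> = emeasure lborel (R ` S)"
    using emeasure_distr[of real2_complex lborel borel "(\<lambda>z. u * z) -` box l r"]
      measurable_sets_borel[of "\<lambda>z. u * z" borel "box l r"]
    by (simp add: lborel_complex_eq_distr[symmetric] pre)
  also have "\<dots> = emeasure lebesgue (R ` S)" using RSb by simp
  also have "\<dots> = ennreal (measure lebesgue (R ` S))"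
    using measurable_orthogonal_image[OF orth Sm] by (simp add: emeasure_eq_measure2)
  also have "\<dots> = ennreal (measure lebesgue S)"
    using measure_orthogonal_image[OF orth Sm] by simp
  also have "\<dots> = emeasure lborel S"
    using Sm Sb emeasure_eq_measure2[of S lebesgue] by simp
  also have "\<dots> = (\<Prod>b\<in>Basis. (r - l) \<bullet> b)"
    unfolding eS using le by (simp add: emeasure_lborel_box)
  finally show "emeasure (distr lborel borel (\<lambda>z. u * z)) (box l r) = ennreal (\<Prod>b\<in>Basis. (r - l) \<bullet> b)" .
qed auto


lemma integral_gauss:
  fixes f :: "complex \<Rightarrow> 'a::{banach, second_countable_topology}"
  assumes [measurable]: "f \<in> borel_measurable borel"
  shows "(\<integral>z. f z \<partial>gauss) = (\<integral>z. (exp (- (cmod z)\<^sup>2) / pi) *\<^sub>R f z \<partial>lborel)"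
  unfolding gauss_def by (subst integral_density) auto

lemma integrable_gauss:
  fixes f :: "complex \<Rightarrow> 'a::{banach, second_countable_topology}"
  assumes [measurable]: "f \<in> borel_measurable borel"
  shows "integrable gauss f \<longleftrightarrow> integrable lborel (\<lambda>z. (exp (- (cmod z)\<^sup>2) / pi) *\<^sub>R f z)"
  unfolding gauss_def by (subst integrable_density) auto

lemma integral_gauss_rotation:
  fixes f :: "complex \<Rightarrow> 'a::{banach, second_countable_topology}"
  assumes u: "cmod u = 1" and [measurable]: "f \<in> borel_measurable borel"
  shows "(\<integral>z. f (u * z) \<partial>gauss) = (\<integral>z. f z \<partial>gauss)"
proof -
  have "(\<integral>z. f z \<partial>gauss) = (\<integral>z. (exp (- (cmod z)\<^sup>2) / pi) *\<^sub>R f z \<partial>lborel)"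
    by (rule integral_gauss) simp
  also have "\<dots> = (\<integral>z. (exp (- (cmod z)\<^sup>2) / pi) *\<^sub>R f z \<partial>distr lborel borel (\<lambda>z. u * z))"
    by (simp add: lborel_distr_rotation[OF u])
  also have "\<dots> = (\<integral>z. (exp (- (cmod (u * z))\<^sup>2) / pi) *\<^sub>R f (u * z) \<partial>lborel)"
    by (subst integral_distr) auto
  also have "\<dots> = (\<integral>z. f (u * z) \<partial>gauss)"
    using u by (subst integral_gauss) (auto simp: norm_mult)
  finally show ?thesis by simp
qed

text \<open>Completing the square gives |w - z|^2 = |w|^2 - 2 Re (w cnj z) + |z|^2, so the
  exponential is the ratio of the Gaussian density at w - z to that at w. It is also the squared
  modulus of the factor in \<open>weyl\<close>.\<close>

lemma gauss_translation:
  fixes f :: "complex \<Rightarrow> 'a::{banach, second_countable_topology}"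
  assumes [measurable]: "f \<in> borel_measurable borel"
  shows "(\<integral>w. (exp (2 * Re (w * cnj z) - (cmod z)\<^sup>2)) *\<^sub>R f (w - z) \<partial>gauss) = (\<integral>w. f w \<partial>gauss)"
    and "integrable gauss (\<lambda>w. (exp (2 * Re (w * cnj z) - (cmod z)\<^sup>2)) *\<^sub>R f (w - z)) \<longleftrightarrow> integrable gauss f"
proof -
  define E where "E w = exp (2 * Re (w * cnj z) - (cmod z)\<^sup>2)" for w
  have [measurable]: "E \<in> borel_measurable borel"
    unfolding E_def by (intro borel_measurable_continuous_onI continuous_intros)
  have e: "exp (- (cmod (w - z))\<^sup>2) = exp (- (cmod w)\<^sup>2) * E w" for w
    unfolding E_def exp_add[symmetric] cmod_power2 by (simp add: power2_eq_square algebra_simps)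
  have t: "lborel = distr lborel borel (\<lambda>w. w - z)"
  proof -
    have "(+) (- z) = (\<lambda>w. w - z)" by auto
    then show ?thesis using lborel_distr_plus[of "- z"] by simp
  qed
  define G where "G w = (exp (- (cmod w)\<^sup>2) / pi) *\<^sub>R f w" for w
  have [measurable]: "G \<in> borel_measurable borel" unfolding G_def by measurable
  have G: "G (w - z) = (exp (- (cmod w)\<^sup>2) / pi) *\<^sub>R E w *\<^sub>R f (w - z)" for w
    unfolding G_def e by (simp add: mult_ac)
  have "(\<integral>w. G w \<partial>distr lborel borel (\<lambda>w. w - z)) = (\<integral>w. G (w - z) \<partial>lborel)"
    by (rule integral_distr) auto
  then show "(\<integral>w. (exp (2 * Re (w * cnj z) - (cmod z)\<^sup>2)) *\<^sub>R f (w - z) \<partial>gauss) = (\<integral>w. f w \<partial>gauss)"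
    unfolding E_def[symmetric] by (simp add: t[symmetric] integral_gauss G[symmetric] G_def[symmetric] del: scaleR_scaleR)
  have "integrable (distr lborel borel (\<lambda>w. w - z)) G \<longleftrightarrow> integrable lborel (\<lambda>w. G (w - z))"
    by (rule integrable_distr_eq) auto
  then show "integrable gauss (\<lambda>w. (exp (2 * Re (w * cnj z) - (cmod z)\<^sup>2)) *\<^sub>R f (w - z)) \<longleftrightarrow> integrable gauss f"
    unfolding E_def[symmetric] by (simp add: t[symmetric] integrable_gauss G[symmetric] G_def[symmetric] del: scaleR_scaleR)
qed

lemma integrable_gauss_monomial: "integrable gauss (\<lambda>z. z ^ p * cnj z ^ q)"
proof (rule Bochner_Integration.integrable_bound)
  show "integrable gauss (\<lambda>z. cmod z ^ (2 * p) + cmod z ^ (2 * q))"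
    using integral_gauss_cmod_power(1) by auto
  have "x * y \<le> x\<^sup>2 + y\<^sup>2" if "0 \<le> x" "0 \<le> y" for x y :: real
    using sum_squares_bound[of x y] mult_nonneg_nonneg[OF that] by linarith
  from this[of "cmod _ ^ p" "cmod _ ^ q", OF zero_le_power zero_le_power, OF norm_ge_zero norm_ge_zero]
  show "AE z in gauss. norm (z ^ p * cnj z ^ q) \<le> norm (cmod z ^ (2 * p) + cmod z ^ (2 * q))"
    by (auto simp: norm_mult norm_power power_mult[symmetric] mult.commute intro!: AE_I2 order_trans[OF _ abs_ge_self])
qed (unfold measurable_gauss_iff, measurable)

text \<open>The cut to a disc is there for the sake of power series, which can be integrated term by
  term on discs but not a priori on the plane.\<close>

lemma integral_cball_monomial_eq_0:
  assumes "p \<noteq> q"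
  shows "(\<integral>z. indicator (cball 0 R) z *\<^sub>R (z ^ p * cnj z ^ q) \<partial>gauss) = 0"
proof -
  define I where "I = (\<integral>z. indicator (cball 0 R) z *\<^sub>R (z ^ p * cnj z ^ q) \<partial>gauss)"
  \<comment> \<open>The angle is chosen so that the rotation multiplies the integrand by -1.\<close>
  define u where "u = cis (pi / (real p - real q))"
  have u: "cmod u = 1" by (simp add: u_def)
  have "u ^ p * cnj u ^ q = cis ((real p - real q) * (pi / (real p - real q)))"
    by (simp add: u_def Complex.DeMoivre cis_cnj cis_mult left_diff_distrib diff_divide_distrib)
  also have "\<dots> = -1" using assms by simp
  finally have *: "u ^ p * cnj u ^ q = -1" .
  have "I = (\<integral>z. indicator (cball 0 R) (u * z) *\<^sub>R ((u * z) ^ p * cnj (u * z) ^ q) \<partial>gauss)"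
    unfolding I_def
    by (rule integral_gauss_rotation[OF u, symmetric])
       (intro borel_measurable_scaleR borel_measurable_indicator borel_measurable_continuous_onI
          continuous_intros; simp)
  also have "\<dots> = (\<integral>z. (u ^ p * cnj u ^ q) * (indicator (cball 0 R) z *\<^sub>R (z ^ p * cnj z ^ q)) \<partial>gauss)"
    by (intro Bochner_Integration.integral_cong) (auto simp: indicator_def norm_mult u power_mult_distrib)
  also have "\<dots> = - I" unfolding * I_def by simp
  finally show ?thesis unfolding I_def[symmetric] by simp
qed

lemma cball_tendsto_integral_gauss:
  fixes f :: "complex \<Rightarrow> complex"
  assumes "integrable gauss f"
  shows "(\<lambda>n. \<integral>z. indicator (cball 0 (real n)) z *\<^sub>R f z \<partial>gauss) \<longlonglongrightarrow> (\<integral>z. f z \<partial>gauss)"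
proof (rule integral_dominated_convergence)
  show "f \<in> borel_measurable gauss" using assms by simp
  then show "(\<lambda>z. indicator (cball 0 (real n)) z *\<^sub>R f z) \<in> borel_measurable gauss" for n
    by (auto simp: measurable_gauss_iff intro!: borel_measurable_scaleR borel_measurable_indicator)
  show "integrable gauss (\<lambda>z. norm (f z))" using assms by simp
  show "AE z in gauss. (\<lambda>n. indicator (cball 0 (real n)) z *\<^sub>R f z) \<longlonglongrightarrow> f z"
  proof (rule AE_I2)
    fix z :: complex
    obtain N where "cmod z \<le> real N" using real_arch_simple by blast
    then have "eventually (\<lambda>n. indicator (cball 0 (real n)) z *\<^sub>R f z = f z) sequentially"
      by (auto simp: eventually_sequentially indicator_def intro!: exI[of _ N])
    then show "(\<lambda>n. indicator (cball 0 (real n)) z *\<^sub>R f z) \<longlonglongrightarrow> f z"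
      by (rule tendsto_eventually)
  qed
  show "AE z in gauss. norm (indicator (cball 0 (real n)) z *\<^sub>R f z) \<le> norm (f z)" for n
    by (auto simp: indicator_def)
qed

lemma integral_gauss_monomial:
  "(\<integral>z. z ^ p * cnj z ^ q \<partial>gauss) = (if p = q then fact p else 0)"
proof (cases "p = q")
  case True
  have "(\<integral>z. z ^ p * cnj z ^ p \<partial>gauss) = (\<integral>z. complex_of_real (cmod z ^ (2 * p)) \<partial>gauss)"
    by (intro Bochner_Integration.integral_cong refl)
       (simp only: power_mult_distrib[symmetric] complex_norm_square[symmetric] power_mult of_real_power)
  also have "\<dots> = fact p"
    by (simp only: integral_complex_of_real integral_gauss_cmod_power) simp
  finally show ?thesis using True by simp
next
  case False
  then show ?thesis
    using cball_tendsto_integral_gauss[OF integrable_gauss_monomial[of p q]]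
    by (simp add: integral_cball_monomial_eq_0 LIMSEQ_const_iff)
qed

section \<open>The inner product on square integrable functions\<close>

lemma L2_gaussD:
  assumes "f \<in> L2_gauss"
  shows "f \<in> borel_measurable borel" "integrable gauss (\<lambda>z. (cmod (f z))\<^sup>2)"
  using assms by (auto simp: L2_gauss_def measurable_gauss_iff)

lemma L2_gaussI:
  assumes "f \<in> borel_measurable borel" "integrable gauss (\<lambda>z. (cmod (f z))\<^sup>2)"
  shows "f \<in> L2_gauss"
  using assms by (auto simp: L2_gauss_def measurable_gauss_iff)

lemma integrable_ip:
  assumes "f \<in> L2_gauss" "g \<in> L2_gauss"
  shows "integrable gauss (\<lambda>z. f z * cnj (g z))"
proof (rule Bochner_Integration.integrable_bound)
  show "integrable gauss (\<lambda>z. (cmod (f z))\<^sup>2 + (cmod (g z))\<^sup>2)"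
    using assms L2_gaussD by auto
  have [measurable]: "f \<in> borel_measurable borel" "g \<in> borel_measurable borel"
    using assms L2_gaussD by auto
  show "(\<lambda>z. f z * cnj (g z)) \<in> borel_measurable gauss"
    unfolding measurable_gauss_iff by measurable
  have "x * y \<le> x\<^sup>2 + y\<^sup>2" if "0 \<le> x" "0 \<le> y" for x y :: real
    using sum_squares_bound[of x y] mult_nonneg_nonneg[OF that] by linarith
  then show "AE z in gauss. norm (f z * cnj (g z)) \<le> norm ((cmod (f z))\<^sup>2 + (cmod (g z))\<^sup>2)"
    by (simp add: norm_mult)
qed

lemma L2_gauss_add:
  assumes "f \<in> L2_gauss" "g \<in> L2_gauss"
  shows "(\<lambda>z. f z + g z) \<in> L2_gauss"
proof (rule L2_gaussI)
  have [measurable]: "f \<in> borel_measurable borel" "g \<in> borel_measurable borel"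
    using assms L2_gaussD by auto
  show "(\<lambda>z. f z + g z) \<in> borel_measurable borel" by simp
  show "integrable gauss (\<lambda>z. (cmod (f z + g z))\<^sup>2)"
  proof (rule Bochner_Integration.integrable_bound)
    show "integrable gauss (\<lambda>z. 2 * (cmod (f z))\<^sup>2 + 2 * (cmod (g z))\<^sup>2)"
      using assms L2_gaussD by auto
    have "(cmod (a + b))\<^sup>2 \<le> 2 * (cmod a)\<^sup>2 + 2 * (cmod b)\<^sup>2" for a b
    proof -
      have "(cmod (a + b))\<^sup>2 \<le> (cmod a + cmod b)\<^sup>2"
        by (intro power_mono norm_triangle_ineq) auto
      also have "\<dots> \<le> 2 * (cmod a)\<^sup>2 + 2 * (cmod b)\<^sup>2"
        using sum_squares_bound[of "cmod a" "cmod b"] by (simp add: power2_sum)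
      finally show ?thesis .
    qed
    then show "AE z in gauss. norm ((cmod (f z + g z))\<^sup>2) \<le> norm (2 * (cmod (f z))\<^sup>2 + 2 * (cmod (g z))\<^sup>2)"
      by simp
  qed (simp add: measurable_gauss_iff)
qed

lemma L2_gauss_scale:
  assumes "f \<in> L2_gauss"
  shows "(\<lambda>z. c * f z) \<in> L2_gauss"
  using assms by (auto simp: L2_gauss_def norm_mult power_mult_distrib)

lemma L2_gauss_zero: "(\<lambda>z. 0) \<in> L2_gauss"
  by (simp add: L2_gauss_def)

lemma ip_add_left:
  assumes "f \<in> L2_gauss" "g \<in> L2_gauss" "h \<in> L2_gauss"
  shows "ip (\<lambda>z. f z + g z) h = ip f h + ip g h"
  unfolding ip_def by (simp add: distrib_right Bochner_Integration.integral_add integrable_ip assms)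

lemma ip_scale_left: "ip (\<lambda>z. c * f z) h = c * ip f h"
  unfolding ip_def by (simp add: mult.assoc)

lemma ip_cnj: "ip f g = cnj (ip g f)"
proof -
  have "cnj (\<integral>z. g z * cnj (f z) \<partial>gauss) = (\<integral>z. cnj (g z * cnj (f z)) \<partial>gauss)"
    by (rule Bochner_Integration.integral_cnj[symmetric])
  then show ?thesis
    unfolding ip_def by (simp add: mult.commute)
qed

lemma ip_add_right:
  assumes "f \<in> L2_gauss" "g \<in> L2_gauss" "h \<in> L2_gauss"
  shows "ip h (\<lambda>z. f z + g z) = ip h f + ip h g"
  by (subst (1 2 3) ip_cnj) (simp add: ip_add_left assms)

lemma ip_scale_right: "ip h (\<lambda>z. c * f z) = cnj c * ip h f"
  by (subst (1 2) ip_cnj) (simp add: ip_scale_left)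

lemma nrm_nonneg [simp]: "nrm f \<ge> 0"
  by (simp add: nrm_def)

lemma nrm_square: "(nrm f)\<^sup>2 = (\<integral>z. (cmod (f z))\<^sup>2 \<partial>gauss)"
  by (simp add: nrm_def)

lemma ip_self: "ip f f = complex_of_real ((nrm f)\<^sup>2)"
  unfolding ip_def nrm_square integral_complex_of_real[symmetric]
  by (intro Bochner_Integration.integral_cong refl) (simp only: complex_norm_square)

lemma nrm_scale: "nrm (\<lambda>z. c * f z) = cmod c * nrm f"
  by (simp add: nrm_def norm_mult power_mult_distrib real_sqrt_mult)

text \<open>A quadratic in t that stays nonnegative is evaluated at t = 1/s; if s = 0 it is linear
  in t, and nonnegativity forces c = 0. With c the squared modulus of a form value this is
  Cauchy-Schwarz, for \<open>ip\<close> and later for semidefinite forms.\<close>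

lemma discriminant_bound:
  fixes X c s :: real
  assumes ex: "\<And>t. 0 \<le> X - 2 * t * c + t\<^sup>2 * c * s" and s: "0 \<le> s" "0 \<le> c"
  shows "c \<le> X * s"
proof (cases "s = 0")
  case False
  with s have pos: "0 < s" by simp
  have "(1 / s)\<^sup>2 * c * s = c / s"
    using pos by (simp add: power2_eq_square)
  then have "c / s \<le> X" using ex[of "1 / s"] by simp
  then show ?thesis using pos by (simp add: pos_divide_le_eq)
next
  case True
  have "c = 0"
  proof (rule ccontr)
    assume "c \<noteq> 0"
    then have "2 * ((X + 1) / c) * c = 2 * (X + 1)" by simp
    moreover have "0 \<le> X" using ex[of 0] by simp
    ultimately show False using ex[of "(X + 1) / c"] True by simp
  qed
  then show ?thesis using True by simp
qed
lemma Cauchy_Schwarz_ip: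
  assumes f: "f \<in> L2_gauss" and g: "g \<in> L2_gauss"
  shows "cmod (ip f g) \<le> nrm f * nrm g"
proof -
  have pos: "0 \<le> Re (ip h h)" for h by (simp add: ip_self)
  have ex: "0 \<le> (nrm f)\<^sup>2 - 2 * t * (cmod (ip f g))\<^sup>2 + t\<^sup>2 * (cmod (ip f g))\<^sup>2 * (nrm g)\<^sup>2" for t :: real
  proof -
    \<comment> \<open>Carrying the phase of \<open>ip f g\<close>, this multiple makes both cross
      terms equal to -t |ip f g|^2.\<close>
    define c where "c = - (of_real t * ip f g)"
    have cg: "(\<lambda>z. c * g z) \<in> L2_gauss" by (rule L2_gauss_scale[OF g])
    have *: "ip (\<lambda>z. f z + c * g z) (\<lambda>z. f z + c * g z)
        = ip f f + cnj c * ip f g + c * cnj (ip f g) + c * cnj c * ip g g"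
      using f g cg by (simp add: ip_add_left ip_add_right L2_gauss_add ip_scale_left ip_scale_right
          ip_cnj[of g f] algebra_simps)
    have "Re (ip f f + cnj c * ip f g + c * cnj (ip f g) + c * cnj c * ip g g) = (nrm f)\<^sup>2 - 2 * t * (cmod (ip f g))\<^sup>2 + t\<^sup>2 * (cmod (ip f g))\<^sup>2 * (nrm g)\<^sup>2"
      unfolding ip_self c_def cmod_power2 by (simp add: power2_eq_square algebra_simps)
    then show ?thesis using pos[of "\<lambda>z. f z + c * g z"] unfolding * by metis
  qed
  have "(cmod (ip f g))\<^sup>2 \<le> (nrm f)\<^sup>2 * (nrm g)\<^sup>2"
    by (rule discriminant_bound[OF ex]) simp_all
  then have "(cmod (ip f g))\<^sup>2 \<le> (nrm f * nrm g)\<^sup>2"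
    by (simp add: power_mult_distrib)
  then show ?thesis by (rule power2_le_imp_le) simp
qed

lemma nrm_triangle:
  assumes f: "f \<in> L2_gauss" and g: "g \<in> L2_gauss"
  shows "nrm (\<lambda>z. f z + g z) \<le> nrm f + nrm g"
proof (rule power2_le_imp_le)
  have "complex_of_real ((nrm (\<lambda>z. f z + g z))\<^sup>2) = ip f f + ip g g + (ip f g + cnj (ip f g))"
    using f g by (simp only: ip_self[symmetric])
      (simp add: ip_add_left ip_add_right L2_gauss_add ip_cnj[of g f] algebra_simps)
  then have "(nrm (\<lambda>z. f z + g z))\<^sup>2 = Re (ip f f + ip g g + (ip f g + cnj (ip f g)))"
    by (metis Re_complex_of_real)
  also have "\<dots> = (nrm f)\<^sup>2 + (nrm g)\<^sup>2 + 2 * Re (ip f g)"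
    by (simp add: ip_self)
  also have "\<dots> \<le> (nrm f)\<^sup>2 + (nrm g)\<^sup>2 + 2 * (nrm f * nrm g)"
    using Cauchy_Schwarz_ip[OF f g] complex_Re_le_cmod[of "ip f g"] by linarith
  finally show "(nrm (\<lambda>z. f z + g z))\<^sup>2 \<le> (nrm f + nrm g)\<^sup>2"
    by (simp add: power2_sum)
qed simp

lemma ip_sum_left:
  assumes "finite I" "\<And>i. i \<in> I \<Longrightarrow> f i \<in> L2_gauss" "h \<in> L2_gauss"
  shows "(\<lambda>z. \<Sum>i\<in>I. f i z) \<in> L2_gauss \<and> ip (\<lambda>z. \<Sum>i\<in>I. f i z) h = (\<Sum>i\<in>I. ip (f i) h)"
  using assms(1,2)
proof (induction I rule: finite_induct)
  case empty
  then show ?case by (simp add: L2_gauss_zero ip_def)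
next
  case (insert i I)
  then show ?case using assms(3) by (simp add: L2_gauss_add ip_add_left)
qed

text \<open>The open set where f is nonzero has measure zero and is therefore empty. This turns norm
  identities into equalities of functions.\<close>

lemma nrm_eq_0_continuous:
  assumes f: "f \<in> L2_gauss" and c: "continuous_on UNIV f" and 0: "nrm f = 0"
  shows "f = (\<lambda>z. 0)"
proof -
  have "(\<integral>z. (cmod (f z))\<^sup>2 \<partial>gauss) = 0" using 0 nrm_square[of f] by simp
  then have "AE z in gauss. (cmod (f z))\<^sup>2 = 0"
    by (subst (asm) integral_nonneg_eq_0_iff_AE) (auto simp: L2_gaussD(2)[OF f])
  then have "AE z in lborel. f z = 0" by (simp add: AE_gauss_iff)
  then have "AE z in lebesgue. f z = 0" by (simp add: AE_completion)
  then have "negligible {z. f z \<noteq> 0}"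
    by (simp add: eventually_ae_filter_negligible) (meson Collect_mono negligible_subset subsetI mem_Collect_eq)
  moreover have "open {z. f z \<noteq> 0}"
    using c by (simp add: open_Collect_neq continuous_on_const)
  ultimately have "{z. f z \<noteq> 0} = {}"
    using open_not_negligible by blast
  then show ?thesis by auto
qed

section \<open>Polyanalytic functions\<close>

text \<open>The solutions of dbar^n f = 0 as polynomials in cnj z of degree below n with entire
  coefficients; \<open>dbar_funpow_polyan\<close> and \<open>polyan_if_dbar_funpow_0\<close> give
  the equivalence for smooth functions.\<close>

definition polyan :: "nat \<Rightarrow> (complex \<Rightarrow> complex) \<Rightarrow> bool" where
  "polyan n f \<longleftrightarrow> (\<exists>h. (\<forall>j. h j holomorphic_on UNIV) \<and> f = (\<lambda>z. \<Sum>j<n. cnj z ^ j * h j z))"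

lemma wirtinger_derivatives:
  assumes "(f has_derivative (\<lambda>v. a * v + b * cnj v)) (at z)"
  shows "dx f z = a + b" "dy f z = \<i> * (a - b)" "dbar f z = b"
proof -
  have "frechet_derivative f (at z) = (\<lambda>v. a * v + b * cnj v)"
    using frechet_derivative_at[OF assms] by simp
  then show 1: "dx f z = a + b" "dy f z = \<i> * (a - b)"
    by (simp_all add: dx_def dy_def algebra_simps)
  show "dbar f z = b"
    unfolding dbar_def 1 by (simp add: mult.assoc[symmetric])
qed

lemma has_derivative_cnj_power_mult:
  assumes "h holomorphic_on UNIV"
  shows "((\<lambda>z. cnj z ^ j * h z) has_derivative
    (\<lambda>v. (cnj z ^ j * deriv h z) * v + (of_nat j * cnj z ^ (j - 1) * h z) * cnj v)) (at z)"
proof -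
  have "(h has_field_derivative deriv h z) (at z)"
    using assms by (simp add: holomorphic_derivI)
  then have h: "(h has_derivative (\<lambda>v. deriv h z * v)) (at z)"
    by (simp add: has_field_derivative_def)
  have "(cnj has_derivative cnj) (at z)"
    by (rule bounded_linear_imp_has_derivative[OF bounded_linear_cnj])
  then have "((\<lambda>z. cnj z ^ j) has_derivative (\<lambda>v. of_nat j * cnj v * cnj z ^ (j - 1))) (at z)"
    by (rule has_derivative_power)
  from has_derivative_mult[OF this h] show ?thesis
    by (rule has_derivative_eq_rhs) (auto simp: algebra_simps)
qed

lemma has_derivative_polyan_sum:
  assumes "\<And>j. h j holomorphic_on UNIV"
  shows "((\<lambda>z. \<Sum>j<n. cnj z ^ j * h j z) has_derivative
    (\<lambda>v. (\<Sum>j<n. cnj z ^ j * deriv (h j) z) * v + (\<Sum>j<n. of_nat j * cnj z ^ (j - 1) * h j z) * cnj v)) (at z)"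
proof -
  have "((\<lambda>z. \<Sum>j<n. cnj z ^ j * h j z) has_derivative
    (\<lambda>v. \<Sum>j<n. (cnj z ^ j * deriv (h j) z) * v + (of_nat j * cnj z ^ (j - 1) * h j z) * cnj v)) (at z)"
    by (intro has_derivative_sum has_derivative_cnj_power_mult assms)
  then show ?thesis
    by (simp add: sum.distrib sum_distrib_right)
qed

lemma polyan_derivative:
  assumes "polyan n f"
  shows "\<exists>a b. \<forall>z. (f has_derivative (\<lambda>v. a z * v + b z * cnj v)) (at z)"
proof -
  obtain h where h: "\<And>j. h j holomorphic_on UNIV" and f: "f = (\<lambda>z. \<Sum>j<n. cnj z ^ j * h j z)"
    using assms by (auto simp: polyan_def)
  show ?thesis
    unfolding f
    by (intro exI[of _ "\<lambda>z. \<Sum>j<n. cnj z ^ j * deriv (h j) z"]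
        exI[of _ "\<lambda>z. \<Sum>j<n. of_nat j * cnj z ^ (j - 1) * h j z"] allI has_derivative_polyan_sum h)
qed

lemma polyan_differentiable: "polyan n f \<Longrightarrow> f differentiable (at z)"
  using polyan_derivative unfolding differentiable_def by blast

lemma polyan_continuous: "polyan n f \<Longrightarrow> continuous_on UNIV f"
  by (simp add: continuous_at_imp_continuous_on differentiable_imp_continuous_within polyan_differentiable)

lemma polyan_0: "polyan 0 f \<longleftrightarrow> f = (\<lambda>z. 0)"
  unfolding polyan_def by (auto intro!: exI[of _ "\<lambda>_ _. 0"])

lemma polyan_zero: "polyan n (\<lambda>z. 0)"
  unfolding polyan_def by (auto intro!: exI[of _ "\<lambda>_ _. 0"])

lemma polyan_add:
  assumes "polyan n f" "polyan n g"
  shows "polyan n (\<lambda>z. f z + g z)"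
proof -
  from assms obtain h k where "\<And>j. h j holomorphic_on UNIV" "f = (\<lambda>z. \<Sum>j<n. cnj z ^ j * h j z)"
    "\<And>j. k j holomorphic_on UNIV" "g = (\<lambda>z. \<Sum>j<n. cnj z ^ j * k j z)"
    unfolding polyan_def by blast
  then show ?thesis unfolding polyan_def
    by (intro exI[of _ "\<lambda>j z. h j z + k j z"])
      (auto simp: sum.distrib[symmetric] distrib_left intro!: holomorphic_intros)
qed

lemma polyan_mult:
  assumes "polyan n f" "g holomorphic_on UNIV"
  shows "polyan n (\<lambda>z. g z * f z)"
proof -
  from assms obtain h where "\<And>j. h j holomorphic_on UNIV" "f = (\<lambda>z. \<Sum>j<n. cnj z ^ j * h j z)"
    unfolding polyan_def by blast
  then show ?thesis unfolding polyan_def using assms(2)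
    by (intro exI[of _ "\<lambda>j z. g z * h j z"])
      (auto simp: sum_distrib_left mult_ac intro!: holomorphic_intros)
qed

lemma polyan_sum:
  assumes "\<And>i. i \<in> I \<Longrightarrow> polyan n (f i)"
  shows "polyan n (\<lambda>z. \<Sum>i\<in>I. f i z)"
  using assms
  by (induction I rule: infinite_finite_induct) (auto simp: polyan_zero intro!: polyan_add)

lemma polyan_scale: "polyan n f \<Longrightarrow> polyan n (\<lambda>z. c * f z)"
  using polyan_mult[of n f "\<lambda>_. c"] by simp

lemma polyan_mono:
  assumes "polyan n f" "n \<le> m"
  shows "polyan m f"
proof -
  from assms obtain h where h: "\<And>j. h j holomorphic_on UNIV" "f = (\<lambda>z. \<Sum>j<n. cnj z ^ j * h j z)"
    unfolding polyan_def by blast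
  have "(\<Sum>j<m. cnj z ^ j * (if j < n then h j z else 0)) = (\<Sum>j<n. cnj z ^ j * h j z)" for z
    using assms(2) by (intro sum.mono_neutral_cong_right) auto
  with h show ?thesis unfolding polyan_def
    by (intro exI[of _ "\<lambda>j. if j < n then h j else (\<lambda>z. 0)"]) (auto intro!: ext simp: if_distrib[of "\<lambda>f. f _"] cong: if_cong)
qed

lemma polyan_holomorphic: "h holomorphic_on UNIV \<Longrightarrow> polyan (Suc 0) h"
  unfolding polyan_def by (intro exI[of _ "\<lambda>_. h"]) auto

lemma polyan_cnj_mult:
  assumes "polyan n f"
  shows "polyan (Suc n) (\<lambda>z. cnj z * f z)"
proof -
  from assms obtain h where h: "\<And>j. h j holomorphic_on UNIV" "f = (\<lambda>z. \<Sum>j<n. cnj z ^ j * h j z)"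
    unfolding polyan_def by blast
  define k where "k j = (case j of 0 \<Rightarrow> (\<lambda>z. 0) | Suc i \<Rightarrow> h i)" for j
  have "(\<Sum>j<Suc n. cnj z ^ j * k j z) = cnj z * (\<Sum>j<n. cnj z ^ j * h j z)" for z
    by (subst sum.lessThan_Suc_shift) (simp add: k_def sum_distrib_left mult_ac)
  moreover have "k j holomorphic_on UNIV" for j
    using h(1) by (cases j) (auto simp: k_def)
  ultimately show ?thesis unfolding polyan_def h(2)
    by (intro exI[of _ k]) auto
qed

lemma polyan_cnj_power_mult:
  "h holomorphic_on UNIV \<Longrightarrow> polyan (Suc j) (\<lambda>z. (cnj z - c) ^ j * h z)"
proof (induction j)
  case 0
  then show ?case by (simp add: polyan_holomorphic)
next
  case (Suc j)
  then have IH: "polyan (Suc j) (\<lambda>z. (cnj z - c) ^ j * h z)" by simp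
  from polyan_add[OF polyan_cnj_mult[OF IH] polyan_scale[OF polyan_mono[OF IH, of "Suc (Suc j)"], of "- c"]]
  show ?case by (simp add: algebra_simps)
qed

lemma holomorphic_shift: "h holomorphic_on UNIV \<Longrightarrow> (\<lambda>w. h (w - z)) holomorphic_on UNIV"
proof -
  assume h: "h holomorphic_on UNIV"
  have "(\<lambda>w. w - z) holomorphic_on UNIV" by (intro holomorphic_intros)
  from holomorphic_on_compose_gen[OF this h] show ?thesis by (simp add: o_def)
qed

lemma polyan_weyl:
  assumes "polyan n f"
  shows "polyan n (weyl z f)"
proof -
  from assms obtain h where h: "\<And>j. h j holomorphic_on UNIV" "f = (\<lambda>z. \<Sum>j<n. cnj z ^ j * h j z)"
    unfolding polyan_def by blast
  have "polyan n (\<lambda>w. exp (w * cnj z - complex_of_real ((cmod z)\<^sup>2) / 2) *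
      (\<Sum>j<n. (cnj w - cnj z) ^ j * h j (w - z)))"
  proof (rule polyan_mult, rule polyan_sum)
    show "polyan n (\<lambda>w. (cnj w - cnj z) ^ j * h j (w - z))" if "j \<in> {..<n}" for j
      using that by (intro polyan_mono[OF polyan_cnj_power_mult, of _ j] holomorphic_shift h) auto
  qed (intro holomorphic_intros)
  moreover have "weyl z f = (\<lambda>w. exp (w * cnj z - complex_of_real ((cmod z)\<^sup>2) / 2) *
      (\<Sum>j<n. (cnj w - cnj z) ^ j * h j (w - z)))"
    by (auto simp: weyl_def h(2) fun_eq_iff)
  ultimately show ?thesis by simp
qed

lemma smooth_polyan:
  assumes "polyan n f"
  shows "smooth f"
proof -
  have "C_real m f" for m
    using assms
  proof (induction m arbitrary: f)
    case 0
    then show ?case by (simp add: polyan_continuous)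
  next
    case (Suc m)
    from Suc.prems obtain h where h: "\<And>j. h j holomorphic_on UNIV" "f = (\<lambda>z. \<Sum>j<n. cnj z ^ j * h j z)"
      unfolding polyan_def by blast
    have p1: "polyan n (\<lambda>z. \<Sum>j<n. cnj z ^ j * deriv (h j) z)"
      unfolding polyan_def using h(1) by (intro exI[of _ "\<lambda>j. deriv (h j)"]) (auto intro!: holomorphic_deriv)
    have p2: "polyan n (\<lambda>z. \<Sum>j<n. of_nat j * cnj z ^ (j - 1) * h j z)"
    proof (rule polyan_sum)
      fix j assume j: "j \<in> {..<n}"
      have "polyan (Suc (j - 1)) (\<lambda>z. of_nat j * ((cnj z - 0) ^ (j - 1) * h j z))"
        by (intro polyan_scale polyan_cnj_power_mult h)
      moreover have "Suc (j - 1) \<le> n" using j by auto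
      ultimately show "polyan n (\<lambda>z. of_nat j * cnj z ^ (j - 1) * h j z)"
        using polyan_mono by (fastforce simp: mult.assoc)
    qed
    note d = wirtinger_derivatives[OF has_derivative_polyan_sum[of h, OF h(1)]]
    have "dx f = (\<lambda>z. (\<Sum>j<n. cnj z ^ j * deriv (h j) z) + (\<Sum>j<n. of_nat j * cnj z ^ (j - 1) * h j z))"
      unfolding h(2) using d(1) by blast
    then have "polyan n (dx f)" using polyan_add[OF p1 p2] by simp
    moreover have "dy f = (\<lambda>z. \<i> * (\<Sum>j<n. cnj z ^ j * deriv (h j) z) + (- \<i>) * (\<Sum>j<n. of_nat j * cnj z ^ (j - 1) * h j z))"
      unfolding h(2) using d(2) by (auto simp: algebra_simps)
    then have "polyan n (dy f)" using polyan_add[OF polyan_scale[OF p1, of \<i>] polyan_scale[OF p2, of "- \<i>"]] by (simp only:)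
    ultimately show ?case using Suc.IH polyan_differentiable[OF Suc.prems] by auto
  qed
  then show ?thesis by (simp add: smooth_def)
qed

lemma dbar_sum:
  assumes "\<And>j. h j holomorphic_on UNIV"
  shows "dbar (\<lambda>z. \<Sum>j<n. cnj z ^ j * h j z) = (\<lambda>z. \<Sum>j<n - 1. cnj z ^ j * (of_nat (Suc j) * h (Suc j) z))"
proof
  fix z
  have "dbar (\<lambda>z. \<Sum>j<n. cnj z ^ j * h j z) z = (\<Sum>j<n. of_nat j * cnj z ^ (j - 1) * h j z)"
    by (rule wirtinger_derivatives[OF has_derivative_polyan_sum[OF assms]])
  also have "\<dots> = (\<Sum>j<n - 1. cnj z ^ j * (of_nat (Suc j) * h (Suc j) z))"
    by (cases n) (simp_all add: sum.lessThan_Suc_shift mult_ac del: sum.lessThan_Suc)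
  finally show "dbar (\<lambda>z. \<Sum>j<n. cnj z ^ j * h j z) z = \<dots>" .
qed

lemma dbar_polyan:
  assumes "polyan n f"
  shows "polyan (n - 1) (dbar f)"
proof -
  from assms obtain h where h: "\<And>j. h j holomorphic_on UNIV" "f = (\<lambda>z. \<Sum>j<n. cnj z ^ j * h j z)"
    unfolding polyan_def by blast
  show ?thesis unfolding polyan_def h(2) dbar_sum[of h, OF h(1)]
    by (intro exI[of _ "\<lambda>j z. of_nat (Suc j) * h (Suc j) z"]) (auto intro!: holomorphic_intros h)
qed

text \<open>With n = m + 1 only fact m times the top coefficient \<open>h m\<close> is left, the
  device by which top coefficients are extracted later.\<close>

lemma dbar_funpow_sum:
  assumes "\<And>j. h j holomorphic_on UNIV"
  shows "(dbar ^^ m) (\<lambda>z. \<Sum>j<n. cnj z ^ j * h j z)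
    = (\<lambda>z. \<Sum>j<n - m. cnj z ^ j * (fact (j + m) / fact j * h (j + m) z))"
proof (induction m)
  case 0
  then show ?case by simp
next
  case (Suc m)
  have "(dbar ^^ Suc m) (\<lambda>z. \<Sum>j<n. cnj z ^ j * h j z)
      = dbar (\<lambda>z. \<Sum>j<n - m. cnj z ^ j * (fact (j + m) / fact j * h (j + m) z))"
    using Suc by simp
  also have "\<dots> = (\<lambda>z. \<Sum>j<n - m - 1. cnj z ^ j * (of_nat (Suc j) * (fact (Suc j + m) / fact (Suc j) * h (Suc j + m) z)))"
    by (rule dbar_sum) (auto intro!: holomorphic_intros assms)
  also have "\<dots> = (\<lambda>z. \<Sum>j<n - Suc m. cnj z ^ j * (fact (j + Suc m) / fact j * h (j + Suc m) z))"
  proof (intro ext sum.cong)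
    fix z j
    have "of_nat (Suc j) * (fact (Suc j + m) / fact (Suc j) * x) = fact (Suc j + m) / fact j * x" for x :: complex
      unfolding fact_Suc[of j] by (simp del: of_nat_Suc fact_Suc)
    then show "cnj z ^ j * (of_nat (Suc j) * (fact (Suc j + m) / fact (Suc j) * h (Suc j + m) z)) =
        cnj z ^ j * (fact (j + Suc m) / fact j * h (j + Suc m) z)"
      by (simp del: of_nat_Suc fact_Suc)
  qed auto
  finally show ?case .
qed

lemma dbar_funpow_polyan:
  assumes "polyan n f"
  shows "(dbar ^^ n) f = (\<lambda>z. 0)"
  using assms by (auto simp: polyan_def dbar_funpow_sum)

text \<open>The exponential factor is holomorphic in w, and translation commutes with dbar.\<close>

lemma dbar_weyl:
  assumes "polyan n f"
  shows "dbar (weyl z f) = weyl z (dbar f)"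
proof
  fix w
  obtain a b where ab: "\<And>z. (f has_derivative (\<lambda>v. a z * v + b z * cnj v)) (at z)"
    using polyan_derivative[OF assms] by blast
  define E where "E w = exp (w * cnj z - complex_of_real ((cmod z)\<^sup>2) / 2)" for w
  have "(E has_field_derivative (E w * cnj z)) (at w)"
    unfolding E_def by (auto intro!: derivative_eq_intros)
  then have E: "(E has_derivative (\<lambda>v. E w * cnj z * v)) (at w)"
    by (simp add: has_field_derivative_def)
  have "((\<lambda>w. w - z) has_derivative (\<lambda>v. v)) (at w)"
    by (auto intro!: derivative_eq_intros)
  from has_derivative_compose[OF this ab[of "w - z"]]
  have "((\<lambda>w. f (w - z)) has_derivative (\<lambda>v. a (w - z) * v + b (w - z) * cnj v)) (at w)" .
  from has_derivative_mult[OF E this]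
  have "(weyl z f has_derivative (\<lambda>v. (E w * a (w - z) + E w * cnj z * f (w - z)) * v + (E w * b (w - z)) * cnj v)) (at w)"
    unfolding weyl_def E_def[symmetric] by (rule has_derivative_eq_rhs) (auto simp: algebra_simps)
  then have "dbar (weyl z f) w = E w * b (w - z)" by (rule wirtinger_derivatives)
  also have "b (w - z) = dbar f (w - z)" using wirtinger_derivatives(3)[OF ab] by simp
  finally show "dbar (weyl z f) w = weyl z (dbar f) w" unfolding weyl_def[of z "dbar f"] E_def .
qed

lemma dbar_funpow_weyl:
  assumes "polyan n f"
  shows "(dbar ^^ m) (weyl z f) = weyl z ((dbar ^^ m) f)"
proof -
  have "polyan n ((dbar ^^ m) f)" for m
    using assms by (induction m) (auto intro: polyan_mono[OF dbar_polyan])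
  note p = this
  show ?thesis
    by (induction m) (simp_all add: dbar_weyl[OF p])
qed

section \<open>From the dbar equation to the polyanalytic form\<close>

lemma C_real_add: "C_real n f \<Longrightarrow> C_real n g \<Longrightarrow> C_real n (\<lambda>z. f z + g z)"
proof (induction n arbitrary: f g)
  case 0
  then show ?case by (auto intro: continuous_intros)
next
  case (Suc n)
  have "frechet_derivative (\<lambda>z. f z + g z) (at z)
      = (\<lambda>v. frechet_derivative f (at z) v + frechet_derivative g (at z) v)" for z
  proof -
    have "(f has_derivative frechet_derivative f (at z)) (at z)"
      "(g has_derivative frechet_derivative g (at z)) (at z)"
      using Suc.prems frechet_derivative_works by auto
    from frechet_derivative_at[OF has_derivative_add[OF this]] show ?thesis by simp
  qed
  then have "dx (\<lambda>z. f z + g z) = (\<lambda>z. dx f z + dx g z)" "dy (\<lambda>z. f z + g z) = (\<lambda>z. dy f z + dy g z)"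
    by (auto simp: dx_def dy_def)
  with Suc show ?case by auto
qed

lemma C_real_scale: "C_real n f \<Longrightarrow> C_real n (\<lambda>z. c * f z)"
proof (induction n arbitrary: f)
  case 0
  then show ?case by (auto intro: continuous_intros)
next
  case (Suc n)
  have "frechet_derivative (\<lambda>z. c * f z) (at z) = (\<lambda>v. c * frechet_derivative f (at z) v)" for z
  proof -
    have "(f has_derivative frechet_derivative f (at z)) (at z)"
      using Suc.prems frechet_derivative_works by auto
    from frechet_derivative_at[OF has_derivative_mult_right[OF this]] show ?thesis by simp
  qed
  then have "dx (\<lambda>z. c * f z) = (\<lambda>z. c * dx f z)" "dy (\<lambda>z. c * f z) = (\<lambda>z. c * dy f z)"
    by (auto simp: dx_def dy_def)
  with Suc show ?case by auto
qed

lemma smooth_dbar: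
  assumes "smooth f"
  shows "smooth (dbar f)"
proof -
  have "C_real n (dbar f)" for n
  proof -
    have "C_real (Suc n) f" using assms by (simp add: smooth_def)
    then have "C_real n (\<lambda>z. (1/2) * dx f z + (\<i>/2) * dy f z)"
      by (intro C_real_add C_real_scale) auto
    moreover have "dbar f = (\<lambda>z. (1/2) * dx f z + (\<i>/2) * dy f z)"
      by (auto simp: dbar_def fun_eq_iff algebra_simps)
    ultimately show ?thesis by simp
  qed
  then show ?thesis by (simp add: smooth_def)
qed

lemma real_linear_decompose:
  fixes D :: "complex \<Rightarrow> complex"
  assumes "linear D"
  shows "D v = (D 1 - \<i> * D \<i>) / 2 * v + (D 1 + \<i> * D \<i>) / 2 * cnj v"
proof -
  have "v = Re v *\<^sub>R 1 + Im v *\<^sub>R \<i>" by (simp add: complex_eq_iff)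
  then have "D v = Re v *\<^sub>R D 1 + Im v *\<^sub>R D \<i>"
    by (metis linear_add[OF assms] linear_scale[OF assms])
  then show ?thesis
    by (simp add: scaleR_conv_of_real complex_eq_iff field_simps)
qed

text \<open>Equal dbar derivatives are the Cauchy-Riemann equations for the difference: its
  real-linear derivative has no cnj part in \<open>real_linear_decompose\<close>.\<close>

lemma dbar_diff_eq_0_imp_holomorphic:
  assumes "\<And>z. f differentiable (at z)" "\<And>z. g differentiable (at z)" "dbar f = dbar g"
  shows "(\<lambda>z. f z - g z) holomorphic_on UNIV"
proof -
  have "(\<lambda>z. f z - g z) field_differentiable (at z)" for z
  proof -
    define D where "D v = frechet_derivative f (at z) v - frechet_derivative g (at z) v" for v
    have D: "((\<lambda>z. f z - g z) has_derivative D) (at z)"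
      unfolding D_def using assms(1,2) frechet_derivative_works by (auto intro!: has_derivative_diff)
    have "dbar f z = dbar g z" using assms(3) by simp
    then have "dx f z + \<i> * dy f z = dx g z + \<i> * dy g z"
      by (simp only: dbar_def divide_cancel_right) simp
    moreover have "D 1 + \<i> * D \<i> = (dx f z + \<i> * dy f z) - (dx g z + \<i> * dy g z)"
      by (simp add: D_def dx_def dy_def algebra_simps)
    ultimately have "D 1 + \<i> * D \<i> = 0" by simp
    then have "D v = (D 1 - \<i> * D \<i>) / 2 * v" for v
      using real_linear_decompose[OF has_derivative_linear[OF D], of v] by simp
    then have "D = (\<lambda>v. (D 1 - \<i> * D \<i>) / 2 * v)" by (rule ext)
    with D show ?thesis
      unfolding field_differentiable_def has_field_derivative_def by metis
  qed
  then show ?thesis by (simp add: holomorphic_on_def)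
qed

text \<open>Integrating \<open>dbar f\<close> term by term in cnj z gives a polyanalytic g with the
  same dbar derivative, and f - g is entire.\<close>

lemma polyan_if_dbar_funpow_0:
  assumes "smooth f" "(dbar ^^ n) f = (\<lambda>z. 0)"
  shows "polyan n f"
  using assms
proof (induction n arbitrary: f)
  case 0
  then show ?case by (simp add: polyan_0)
next
  case (Suc n)
  have "polyan n (dbar f)"
    using Suc.prems by (intro Suc.IH) (auto simp: smooth_dbar funpow_swap1)
  then obtain h where h: "\<And>j. h j holomorphic_on UNIV" "dbar f = (\<lambda>z. \<Sum>j<n. cnj z ^ j * h j z)"
    unfolding polyan_def by blast
  \<comment> \<open>Division by zero yields 0, so \<open>k 0\<close> vanishes, as it must for an
    antiderivative that starts with the first power of cnj z.\<close>
  define k where "k j = (\<lambda>z. h (j - 1) z / of_nat j)" for j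
  have k: "k j holomorphic_on UNIV" for j
    unfolding k_def by (cases "j = 0") (auto intro!: holomorphic_intros h)
  define g where "g = (\<lambda>z. \<Sum>j<Suc n. cnj z ^ j * k j z)"
  have g: "polyan (Suc n) g" using k by (auto simp: polyan_def g_def)
  have "dbar g = dbar f"
    unfolding g_def dbar_sum[OF k] h(2) by (simp add: k_def del: of_nat_Suc)
  moreover have "f differentiable (at z)" for z
  proof -
    have "C_real (Suc 0) f" using Suc.prems(1) unfolding smooth_def by blast
    then show ?thesis by simp
  qed
  ultimately have "(\<lambda>z. f z - g z) holomorphic_on UNIV"
    using polyan_differentiable[OF g] by (intro dbar_diff_eq_0_imp_holomorphic) auto
  from polyan_add[OF polyan_mono[OF polyan_holomorphic[OF this]] g]
  show ?case by simp
qed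

lemma fock_iff: "f \<in> fock n \<longleftrightarrow> f \<in> L2_gauss \<and> polyan n f"
  unfolding fock_def using polyan_if_dbar_funpow_0 smooth_polyan dbar_funpow_polyan by blast

section \<open>Complex Hermite polynomials\<close>

definition zmon :: "nat \<Rightarrow> nat \<Rightarrow> complex \<Rightarrow> complex" where
  "zmon a b z = z ^ a * cnj z ^ b"

text \<open>Coefficients of the complex Hermite polynomials of Ito. They vanish for i > m, so the
  truncated exponent m - i in \<open>herm\<close> does no harm.\<close>

definition herm_coeff :: "nat \<Rightarrow> nat \<Rightarrow> nat \<Rightarrow> complex" where
  "herm_coeff N m i = (- 1) ^ i * fact i * of_nat (m choose i) * of_nat (N choose i)"

definition herm :: "nat \<Rightarrow> nat \<Rightarrow> complex \<Rightarrow> complex" where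
  "herm N m z = (\<Sum>i\<le>N. herm_coeff N m i * zmon (m - i) (N - i) z)"

definition ebas :: "nat \<Rightarrow> nat \<Rightarrow> complex \<Rightarrow> complex" where
  "ebas N m z = complex_of_real (1 / sqrt (fact m * fact N)) * herm N m z"

text \<open>Pascal's rule trades one order of the alternating sum for one finite difference of
  f.\<close>

lemma alternating_binomial_Suc:
  fixes f :: "nat \<Rightarrow> complex"
  shows "(\<Sum>i\<le>Suc N. (- 1) ^ i * of_nat (Suc N choose i) * f i)
    = (\<Sum>i\<le>N. (- 1) ^ i * of_nat (N choose i) * (f i - f (Suc i)))"
proof -
  have "(\<Sum>i\<le>Suc N. (- 1) ^ i * of_nat (Suc N choose i) * f i)
      = f 0 + (\<Sum>i\<le>N. (- 1) ^ Suc i * of_nat (Suc N choose Suc i) * f (Suc i))"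
    by (subst sum.atMost_Suc_shift) simp
  also have "(\<Sum>i\<le>N. (- 1) ^ Suc i * of_nat (Suc N choose Suc i) * f (Suc i))
      = (\<Sum>i\<le>N. (- 1) ^ Suc i * of_nat (N choose Suc i) * f (Suc i))
      - (\<Sum>i\<le>N. (- 1) ^ i * of_nat (N choose i) * f (Suc i))"
    unfolding sum_subtractf[symmetric] by (intro sum.cong) (simp_all add: algebra_simps)
  also have "f 0 + (\<dots>) = (\<Sum>i\<le>Suc N. (- 1) ^ i * of_nat (N choose i) * f i)
      - (\<Sum>i\<le>N. (- 1) ^ i * of_nat (N choose i) * f (Suc i))"
    by (subst sum.atMost_Suc_shift) simp
  also have "\<dots> = (\<Sum>i\<le>N. (- 1) ^ i * of_nat (N choose i) * (f i - f (Suc i)))"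
    by (simp add: right_diff_distrib sum_subtractf)
  finally show ?thesis .
qed

text \<open>An N-th finite difference annihilates polynomials of degree below N and sends a monic
  one of degree N to N!. The rising factorial is monic of degree j in the variable x - i, which
  decreases with i, so the difference f(i) - f(i + 1) gives the sign plus.\<close>

lemma alternating_binomial_pochhammer:
  fixes x :: complex
  assumes "j \<le> N"
  shows "(\<Sum>i\<le>N. (- 1) ^ i * of_nat (N choose i) * pochhammer (x - of_nat i) j) = (if j = N then fact N else 0)"
  using assms
proof (induction N arbitrary: j)
  case 0
  then show ?case by simp
next
  case (Suc N)
  show ?case
  proof (cases j)
    case 0
    then show ?thesis by (subst alternating_binomial_Suc) simp
  next
    case (Suc l)
    \<comment> \<open>The difference of a rising factorial is a shorter rising factorial, as for
      derivatives of powers.\<close>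
    have "pochhammer y (Suc l) - pochhammer (y - 1) (Suc l) = of_nat (Suc l) * pochhammer y l" for y :: complex
      by (simp add: pochhammer_rec[of "y - 1"] pochhammer_rec'[of y] algebra_simps)
    from this[of "x - of_nat _"]
    have *: "pochhammer (x - of_nat i) (Suc l) - pochhammer (x - of_nat (Suc i)) (Suc l)
        = of_nat (Suc l) * pochhammer (x - of_nat i) l" for i
      by (simp add: algebra_simps)
    have "(\<Sum>i\<le>Suc N. (- 1) ^ i * of_nat (Suc N choose i) * pochhammer (x - of_nat i) j)
        = (\<Sum>i\<le>N. (- 1) ^ i * of_nat (N choose i) * (of_nat (Suc l) * pochhammer (x - of_nat i) l))"
      unfolding Suc alternating_binomial_Suc * ..
    also have "\<dots> = of_nat (Suc l) * (\<Sum>i\<le>N. (- 1) ^ i * of_nat (N choose i) * pochhammer (x - of_nat i) l)"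
      by (simp add: sum_distrib_left mult_ac)
    also have "\<dots> = (if j = Suc N then fact (Suc N) else 0)"
      using Suc.prems Suc Suc.IH[of l] by simp
    finally show ?thesis .
  qed
qed

text \<open>After \<open>fact m\<close> is pulled out, term i is an alternating binomial coefficient
  times a rising factorial of length b in Suc m - i, so the sum is an N-th difference of a
  polynomial of degree b \<le> N.\<close>

lemma herm_coeff_sum_fact:
  assumes "b \<le> N" "N \<le> b + m"
  shows "(\<Sum>i\<le>N. herm_coeff N m i * fact (b + m - i)) = (if b = N then fact m * fact N else 0)"
proof -
  have "herm_coeff N m i * fact (b + m - i)
      = fact m * ((- 1) ^ i * of_nat (N choose i) * pochhammer (of_nat (Suc m) - of_nat i) b)" if "i \<le> N" for i
  proof (cases "i \<le> m")
    case True
    have "pochhammer (1::complex) (m - i + b) = pochhammer 1 (m - i) * pochhammer (1 + of_nat (m - i)) b"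
      by (rule pochhammer_product')
    moreover have "1 + of_nat (m - i) = (of_nat (Suc m) - of_nat i :: complex)"
      using True by (simp add: of_nat_diff)
    moreover have "b + m - i = m - i + b" using True by simp
    ultimately have 1: "fact (b + m - i) = fact (m - i) * pochhammer (of_nat (Suc m) - of_nat i :: complex) b"
      by (simp add: pochhammer_fact)
    have "fact i * fact (m - i) * of_nat (m choose i) = (fact m :: complex)"
      using binomial_fact_lemma[OF True] by (metis of_nat_fact of_nat_mult)
    then have 2: "fact m = fact i * of_nat (m choose i) * (fact (m - i) :: complex)" by (simp add: mult_ac)
    show ?thesis unfolding herm_coeff_def 1 2 by (simp add: mult_ac)
  next
    case False
    \<comment> \<open>For m < i \<le> N \<le> b + m the b factors starting at the integer Suc m - i
      \<le> 0 reach 0, in step with m choose i = 0.\<close>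
    then have "pochhammer (of_nat (Suc m) - of_nat i :: complex) b = 0"
      using that assms unfolding pochhammer_eq_0_iff
      by (intro exI[of _ "i - Suc m"]) (auto simp: of_nat_diff)
    with False show ?thesis by (simp add: herm_coeff_def)
  qed
  then have "(\<Sum>i\<le>N. herm_coeff N m i * fact (b + m - i))
      = fact m * (\<Sum>i\<le>N. (- 1) ^ i * of_nat (N choose i) * pochhammer (of_nat (Suc m) - of_nat i) b)"
    by (subst sum_distrib_left) (rule sum.cong, auto)
  then show ?thesis using alternating_binomial_pochhammer[OF assms(1)] by simp
qed

lemma zmon_L2: "zmon a b \<in> L2_gauss"
proof (rule L2_gaussI)
  show "zmon a b \<in> borel_measurable borel"
    unfolding zmon_def[abs_def] by (intro borel_measurable_continuous_onI continuous_intros)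
  have "(\<lambda>z. (cmod (zmon a b z))\<^sup>2) = (\<lambda>z. cmod z ^ (2 * (a + b)))"
    by (auto simp: zmon_def norm_mult norm_power power_add[symmetric] power_mult[symmetric] mult.commute)
  then show "integrable gauss (\<lambda>z. (cmod (zmon a b z))\<^sup>2)"
    using integral_gauss_cmod_power(1)[of "a + b"] by simp
qed

lemma polyan_zmon:
  assumes "b < n"
  shows "polyan n (zmon a b)"
proof -
  have "(\<lambda>z. z ^ a :: complex) holomorphic_on UNIV" by (intro holomorphic_intros)
  from polyan_mono[OF polyan_cnj_power_mult[OF this, of b 0], of n] assms show ?thesis
    by (simp add: zmon_def[abs_def] mult.commute)
qed

lemma ip_zmon_zmon: "ip (zmon a b) (zmon c d) = (if a + d = b + c then fact (a + d) else 0)"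
proof -
  have "ip (zmon a b) (zmon c d) = (\<integral>z. z ^ (a + d) * cnj z ^ (b + c) \<partial>gauss)"
    unfolding ip_def zmon_def by (simp add: power_add mult_ac)
  then show ?thesis by (simp add: integral_gauss_monomial)
qed

lemma herm_L2: "herm N m \<in> L2_gauss"
  and ip_herm_left: "g \<in> L2_gauss \<Longrightarrow> ip (herm N m) g = (\<Sum>i\<le>N. herm_coeff N m i * ip (zmon (m - i) (N - i)) g)"
proof -
  have "herm N m = (\<lambda>z. \<Sum>i\<le>N. herm_coeff N m i * zmon (m - i) (N - i) z)"
    by (auto simp: herm_def)
  with ip_sum_left[of "{..N}" "\<lambda>i z. herm_coeff N m i * zmon (m - i) (N - i) z"]
  show "herm N m \<in> L2_gauss" and "g \<in> L2_gauss \<Longrightarrow> ip (herm N m) g = (\<Sum>i\<le>N. herm_coeff N m i * ip (zmon (m - i) (N - i)) g)"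
    using zmon_L2 by (auto simp: L2_gauss_scale ip_scale_left)
qed

lemma cnj_herm_coeff [simp]: "cnj (herm_coeff N m i) = herm_coeff N m i"
  by (simp add: herm_coeff_def)

lemma ip_herm_right: "g \<in> L2_gauss \<Longrightarrow> ip g (herm N m) = (\<Sum>i\<le>N. herm_coeff N m i * ip g (zmon (m - i) (N - i)))"
  by (subst ip_cnj, subst (2) ip_cnj) (simp add: ip_herm_left)

lemma herm_coeff_eq_0: "m < i \<Longrightarrow> herm_coeff N m i = 0"
  by (simp add: herm_coeff_def)

text \<open>Different rotation weights are orthogonal, which leaves a + N = b + m; there the inner
  product is the sum of \<open>herm_coeff_sum_fact\<close>, zero unless b = N. So
  \<open>herm N m\<close> is orthogonal to all monomials of lower degree in cnj z.\<close>

lemma ip_zmon_herm: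
  assumes "b \<le> N"
  shows "ip (zmon a b) (herm N m) = (if b = N \<and> a = m then fact m * fact N else 0)"
proof (cases "a + N = b + m")
  case True
  have "ip (zmon a b) (herm N m) = (\<Sum>i\<le>N. herm_coeff N m i * fact (b + m - i))"
    unfolding ip_herm_right[OF zmon_L2] ip_zmon_zmon
  proof (intro sum.cong refl)
    fix i assume i: "i \<in> {..N}"
    show "herm_coeff N m i * (if a + (N - i) = b + (m - i) then fact (a + (N - i)) else 0)
        = herm_coeff N m i * fact (b + m - i)"
      using True i by (cases "i \<le> m") (auto simp: herm_coeff_eq_0)
  qed
  then show ?thesis using herm_coeff_sum_fact[OF assms, of m] True by auto
next
  case False
  have "ip (zmon a b) (herm N m) = 0"
    unfolding ip_herm_right[OF zmon_L2] ip_zmon_zmon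
  proof (intro sum.neutral ballI)
    fix i assume i: "i \<in> {..N}"
    show "herm_coeff N m i * (if a + (N - i) = b + (m - i) then fact (a + (N - i)) else 0) = 0"
      using False i by (cases "i \<le> m") (auto simp: herm_coeff_eq_0)
  qed
  then show ?thesis using False by auto
qed

lemma ip_herm_herm: "ip (herm N m) (herm N n) = (if m = n then fact m * fact N else 0)"
proof -
  have "ip (herm N m) (herm N n) = (\<Sum>i\<le>N. herm_coeff N m i * (if N - i = N \<and> m - i = n then fact n * fact N else 0))"
    by (simp add: ip_herm_left[OF herm_L2] ip_zmon_herm)
  also have "\<dots> = (\<Sum>i\<in>{0}. herm_coeff N m i * (if N - i = N \<and> m - i = n then fact n * fact N else 0))"
    by (rule sum.mono_neutral_right) auto
  finally show ?thesis by (simp add: herm_coeff_def)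
qed

lemma ebas_L2: "ebas N m \<in> L2_gauss"
  unfolding ebas_def[abs_def] by (rule L2_gauss_scale[OF herm_L2])

lemma ip_ebas: "ip (ebas N m) (ebas N n) = (if m = n then 1 else 0)"
proof -
  have "ip (ebas N m) (ebas N n) = complex_of_real (1 / sqrt (fact m * fact N)) * complex_of_real (1 / sqrt (fact n * fact N))
      * (if m = n then fact m * fact N else 0)"
    unfolding ebas_def[abs_def] ip_scale_left ip_scale_right ip_herm_herm by simp
  moreover have "complex_of_real (1 / sqrt (fact m * fact N)) * complex_of_real (1 / sqrt (fact m * fact N)) * (fact m * fact N) = 1"
  proof -
    have "(1 / sqrt (fact m * fact N)) * (1 / sqrt (fact m * fact N)) * (fact m * fact N) = (1::real)"
      by (simp add: field_simps)
    then have "complex_of_real ((1 / sqrt (fact m * fact N)) * (1 / sqrt (fact m * fact N)) * (fact m * fact N)) = 1"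
      by (simp only: of_real_1)
    then show ?thesis by (simp only: of_real_mult of_real_fact)
  qed
  ultimately show ?thesis by auto
qed

text \<open>Each entire coefficient is expanded into its Taylor series, and rotation leaves one term
  per j. This is done on discs because a single product cnj z^j h_j need not be integrable over the
  plane; only their sum f is known to be square integrable, so the radius tends to infinity after
  the sum over j is formed.\<close>

lemma ip_polyan_zmon:
  assumes h: "\<And>j. h j holomorphic_on UNIV" and f: "f = (\<lambda>z. \<Sum>j<n. cnj z ^ j * h j z)" and L2: "f \<in> L2_gauss"
  shows "ip f (zmon a b) = (\<Sum>j<n. if b \<le> j + a then (deriv ^^ (j + a - b)) (h j) 0 / fact (j + a - b) * fact (j + a) else 0)"
proof -
  define c where "c j m = (deriv ^^ m) (h j) 0 / fact m" for j m
  have sums: "(\<lambda>m. c j m * z ^ m) sums h j z" for j z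
    using holomorphic_power_series[OF holomorphic_on_subset[OF h[of j]], of 0 "cmod z + 1" z]
    by (simp add: c_def)
  \<comment> \<open>Convergence at the larger radius R + 1 gives absolute convergence at R.\<close>
  have summ: "summable (\<lambda>m. cmod (c j m) * R ^ m)" if "0 \<le> R" for j and R :: real
  proof -
    have "summable (\<lambda>m. norm (c j m * complex_of_real R ^ m))"
      by (rule powser_insidea[OF sums_summable[OF sums[of j "of_real (R + 1)"]]]) (use that in auto)
    then show ?thesis using that by (simp add: norm_mult norm_power)
  qed
  define I where "I R g = (\<integral>z. indicator (cball 0 R) z *\<^sub>R g z \<partial>gauss)" for R and g :: "complex \<Rightarrow> complex"
  have meas: "(\<lambda>z. indicator (cball 0 R) z *\<^sub>R g z) \<in> borel_measurable gauss"
    if "continuous_on UNIV g" for R and g :: "complex \<Rightarrow> complex"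
    unfolding measurable_gauss_iff
    by (intro borel_measurable_scaleR borel_measurable_indicator borel_measurable_continuous_onI that) simp
  have int: "integrable gauss (\<lambda>z. indicator (cball 0 R) z *\<^sub>R g z)"
    if g: "continuous_on UNIV g" for R and g :: "complex \<Rightarrow> complex"
  proof -
    have "compact (g ` cball 0 R)"
      by (intro compact_continuous_image continuous_on_subset[OF g]) auto
    then obtain B where B: "\<And>z. z \<in> cball 0 R \<Longrightarrow> cmod (g z) \<le> B"
      by (meson bounded_iff compact_imp_bounded image_eqI)
    interpret finite_measure gauss by (rule finite_measure_gauss)
    show ?thesis
      by (rule integrable_const_bound[where B = "max B 0", OF _ meas[OF g]])
         (auto simp: indicator_def max.coboundedI1 B)
  qed
  have disc: "I R (\<lambda>z. cnj z ^ j * h j z * cnj (zmon a b z))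
      = (if b \<le> j + a then c j (j + a - b) * I R (\<lambda>z. z ^ (j + a) * cnj z ^ (j + a)) else 0)" if "0 \<le> R" for R j
  proof -
    define t where "t m z = indicator (cball 0 R) z *\<^sub>R (c j m * (z ^ (m + b) * cnj z ^ (j + a)))" for m and z :: complex
    have tsums: "(\<lambda>m. t m z) sums (indicator (cball 0 R) z *\<^sub>R (cnj z ^ j * h j z * cnj (zmon a b z)))" for z
    proof -
      have "(\<lambda>m. indicator (cball 0 R) z *\<^sub>R ((c j m * z ^ m) * (z ^ b * cnj z ^ (j + a)))) sums
         (indicator (cball 0 R) z *\<^sub>R (h j z * (z ^ b * cnj z ^ (j + a))))"
        by (intro sums_scaleR_right sums_mult2 sums)
      then show ?thesis by (simp add: t_def zmon_def power_add mult_ac)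
    qed
    have tint: "integrable gauss (t m)" for m
      unfolding t_def[abs_def] by (intro int continuous_intros)
    have tbd: "norm (t m z) \<le> cmod (c j m) * R ^ m * (R ^ b * R ^ (j + a))" for m z
    proof (cases "z \<in> cball 0 R")
      case True
      then have "cmod z \<le> R" by simp
      then have "cmod z ^ m * (cmod z ^ b * cmod z ^ (j + a)) \<le> R ^ m * (R ^ b * R ^ (j + a))"
        using that by (intro mult_mono power_mono mult_nonneg_nonneg zero_le_power) auto
      from mult_left_mono[OF this norm_ge_zero[of "c j m"]] show ?thesis
        using True by (simp add: t_def norm_mult norm_power power_add mult_ac)
    qed (use that in \<open>auto simp: t_def\<close>)
    interpret finite_measure gauss by (rule finite_measure_gauss)
    have "(\<lambda>m. integral\<^sup>L gauss (t m)) sums (\<integral>z. (\<Sum>m. t m z) \<partial>gauss)"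
    proof (rule sums_integral[OF tint])
      show "AE z in gauss. summable (\<lambda>m. norm (t m z))"
      proof (rule AE_I2)
        fix z
        show "summable (\<lambda>m. norm (t m z))"
          by (rule summable_comparison_test'[OF summable_mult2[OF summ[OF that, of j], of "R ^ b * R ^ (j + a)"],
                where N = 0]) (use tbd in simp)
      qed
      show "summable (\<lambda>m. \<integral>z. norm (t m z) \<partial>gauss)"
      proof (rule summable_comparison_test'[where N = 0])
        show "summable (\<lambda>m. cmod (c j m) * R ^ m * (R ^ b * R ^ (j + a)) * measure gauss UNIV)"
          by (intro summable_mult2 summ that)
        show "norm (\<integral>z. norm (t m z) \<partial>gauss) \<le> cmod (c j m) * R ^ m * (R ^ b * R ^ (j + a)) * measure gauss UNIV" for m
        proof -
          have "(\<integral>z. norm (t m z) \<partial>gauss) \<le> (\<integral>z. cmod (c j m) * R ^ m * (R ^ b * R ^ (j + a)) \<partial>gauss)"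
            by (intro integral_mono integrable_norm tint integrable_const tbd)
          then show ?thesis by (simp add: mult_ac)
        qed
      qed
    qed
    also have "(\<integral>z. (\<Sum>m. t m z) \<partial>gauss) = I R (\<lambda>z. cnj z ^ j * h j z * cnj (zmon a b z))"
      unfolding I_def
      by (intro Bochner_Integration.integral_cong refl) (rule sums_unique[OF tsums, symmetric])
    finally have "(\<lambda>m. integral\<^sup>L gauss (t m)) sums I R (\<lambda>z. cnj z ^ j * h j z * cnj (zmon a b z))" .
    moreover have tI: "integral\<^sup>L gauss (t m) = (if m + b = j + a then c j m * I R (\<lambda>z. z ^ (j + a) * cnj z ^ (j + a)) else 0)" for m
    proof -
      have "integral\<^sup>L gauss (t m) = (\<integral>z. c j m * (indicator (cball 0 R) z *\<^sub>R (z ^ (m + b) * cnj z ^ (j + a))) \<partial>gauss)"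
        unfolding t_def by (simp only: mult_scaleR_right)
      also have "\<dots> = c j m * I R (\<lambda>z. z ^ (m + b) * cnj z ^ (j + a))"
        unfolding I_def by (rule integral_mult_right_zero)
      finally show ?thesis using integral_cball_monomial_eq_0[of "m + b" "j + a" R] by (auto simp: I_def)
    qed
    moreover have "(\<lambda>m. integral\<^sup>L gauss (t m)) sums
        (if b \<le> j + a then c j (j + a - b) * I R (\<lambda>z. z ^ (j + a) * cnj z ^ (j + a)) else 0)"
    proof (cases "b \<le> j + a")
      case True
      then have "m + b = j + a \<longleftrightarrow> m = j + a - b" for m by auto
      then have "(\<lambda>m. integral\<^sup>L gauss (t m)) = (\<lambda>m. if m = j + a - b then c j m * I R (\<lambda>z. z ^ (j + a) * cnj z ^ (j + a)) else 0)"
        unfolding tI by simp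
      then show ?thesis using sums_single[of "j + a - b" "\<lambda>m. c j m * I R (\<lambda>z. z ^ (j + a) * cnj z ^ (j + a))"] True by simp
    next
      case False
      then have "(\<lambda>m. integral\<^sup>L gauss (t m)) = (\<lambda>m. 0)"
        unfolding tI by (intro ext) auto
      then show ?thesis using False by simp
    qed
    ultimately show ?thesis using sums_unique2 by blast
  qed
  have lim: "(\<lambda>R. I (real R) g) \<longlonglongrightarrow> (\<integral>z. g z \<partial>gauss)" if "integrable gauss g" for g
    unfolding I_def by (rule cball_tendsto_integral_gauss[OF that])
  have "(\<lambda>R. I (real R) (\<lambda>z. f z * cnj (zmon a b z))) \<longlonglongrightarrow> ip f (zmon a b)"
    unfolding ip_def by (intro lim integrable_ip L2 zmon_L2)
  moreover have "I (real R) (\<lambda>z. f z * cnj (zmon a b z))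
      = (\<Sum>j<n. if b \<le> j + a then c j (j + a - b) * I (real R) (\<lambda>z. z ^ (j + a) * cnj z ^ (j + a)) else 0)" for R
  proof -
    have cont: "continuous_on UNIV (\<lambda>z. cnj z ^ j * h j z * cnj (zmon a b z))" for j
      unfolding zmon_def by (intro continuous_intros holomorphic_on_imp_continuous_on h)
    have "I (real R) (\<lambda>z. f z * cnj (zmon a b z)) = (\<Sum>j<n. I (real R) (\<lambda>z. cnj z ^ j * h j z * cnj (zmon a b z)))"
      unfolding I_def f
      by (subst Bochner_Integration.integral_sum[symmetric]) (auto simp: sum_distrib_right scaleR_sum_right intro!: int cont)
    then show ?thesis by (simp add: disc)
  qed
  ultimately have "(\<lambda>R. \<Sum>j<n. if b \<le> j + a then c j (j + a - b) * I (real R) (\<lambda>z. z ^ (j + a) * cnj z ^ (j + a)) else 0)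
    \<longlonglongrightarrow> ip f (zmon a b)" by simp
  moreover have "(\<lambda>R. \<Sum>j<n. if b \<le> j + a then c j (j + a - b) * I (real R) (\<lambda>z. z ^ (j + a) * cnj z ^ (j + a)) else 0)
    \<longlonglongrightarrow> (\<Sum>j<n. if b \<le> j + a then c j (j + a - b) * fact (j + a) else 0)"
  proof (rule tendsto_sum)
    fix j assume "j \<in> {..<n}"
    have "(\<lambda>R. I (real R) (\<lambda>z. z ^ (j + a) * cnj z ^ (j + a))) \<longlonglongrightarrow> fact (j + a)"
      using lim[OF integrable_gauss_monomial[of "j + a" "j + a"]] integral_gauss_monomial[of "j + a" "j + a"] by simp
    then show "(\<lambda>R. if b \<le> j + a then c j (j + a - b) * I (real R) (\<lambda>z. z ^ (j + a) * cnj z ^ (j + a)) else 0)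
      \<longlonglongrightarrow> (if b \<le> j + a then c j (j + a - b) * fact (j + a) else 0)"
      by (cases "b \<le> j + a") (simp_all add: tendsto_mult_left)
  qed
  ultimately show ?thesis unfolding c_def using LIMSEQ_unique by blast
qed

section \<open>The Hermite functions as an orthonormal basis of the true polyanalytic Fock space\<close>

text \<open>The n-th power of dbar isolates the top coefficient; once it is zero, a shorter sum is
  left.\<close>

lemma polyan_unique:
  assumes "\<And>j. h j holomorphic_on UNIV" "(\<lambda>z. \<Sum>j<n. cnj z ^ j * h j z) = (\<lambda>z. 0)" "j < n"
  shows "h j z = 0"
  using assms(2,3)
proof (induction n)
  case 0
  then show ?case by simp
next
  case (Suc n)
  have "(dbar ^^ n) (\<lambda>z. 0) = (\<lambda>z. 0)"
    using dbar_funpow_polyan[OF polyan_zero] .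
  then have "(\<lambda>z. fact n * h n z) = (\<lambda>z. 0)"
    using dbar_funpow_sum[of h n "Suc n", OF assms(1)] Suc.prems(1) by (simp add: Suc_diff_le)
  then have n: "h n z = 0" for z by (simp add: fun_eq_iff)
  then have "(\<lambda>z. \<Sum>j<n. cnj z ^ j * h j z) = (\<lambda>z. 0)"
    using Suc.prems(1) by simp
  with Suc.IH n Suc.prems(2) show ?case by (cases "j = n") auto
qed

text \<open>For one pair (j0, m0) all Taylor terms of f with the same rotation weight form a
  polynomial p. By \<open>ip_polyan_zmon\<close>, f and p have equal products with the monomials of
  that weight, so p is orthogonal to itself and vanishes.\<close>

lemma fock_zero_if_orthogonal:
  assumes f: "f \<in> fock n" and orth: "\<And>a b. b < n \<Longrightarrow> ip f (zmon a b) = 0"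
  shows "f = (\<lambda>z. 0)"
proof -
  from f obtain h where h: "\<And>j. h j holomorphic_on UNIV" and fh: "f = (\<lambda>z. \<Sum>j<n. cnj z ^ j * h j z)"
    by (auto simp: fock_iff polyan_def)
  have L2: "f \<in> L2_gauss" using f by (simp add: fock_iff)
  define c where "c j m = (deriv ^^ m) (h j) 0 / fact m" for j m
  have "c j0 m0 = 0" if "j0 < n" for j0 m0
  proof -
    \<comment> \<open>The weight m - j = m0 - j0 is fixed, so there is at most one monomial for each
      j < n, and the sum is finite.\<close>
    define k where "k j = (if j0 \<le> j + m0 then (\<lambda>z. c j (j + m0 - j0) * z ^ (j + m0 - j0)) else (\<lambda>z. 0))" for j
    define p where "p = (\<lambda>z. \<Sum>j<n. cnj z ^ j * k j z)"
    have k: "k j holomorphic_on UNIV" for j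
      unfolding k_def by (auto intro!: holomorphic_intros)
    have pz: "p = (\<lambda>z. \<Sum>j<n. (if j0 \<le> j + m0 then c j (j + m0 - j0) else 0) * zmon (j + m0 - j0) j z)"
      unfolding p_def k_def zmon_def by (auto intro!: sum.cong ext)
    have pL2: "p \<in> L2_gauss"
      unfolding pz using ip_sum_left[of "{..<n}" "\<lambda>j z. (if j0 \<le> j + m0 then c j (j + m0 - j0) else 0) * zmon (j + m0 - j0) j z" "zmon 0 0"]
      by (simp add: L2_gauss_scale zmon_L2)
    have ip_p: "ip p g = (\<Sum>j<n. (if j0 \<le> j + m0 then c j (j + m0 - j0) else 0) * ip (zmon (j + m0 - j0) j) g)"
      if "g \<in> L2_gauss" for g
      unfolding pz using ip_sum_left[of "{..<n}" "\<lambda>j z. (if j0 \<le> j + m0 then c j (j + m0 - j0) else 0) * zmon (j + m0 - j0) j z" g] that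
      by (simp add: L2_gauss_scale zmon_L2 ip_scale_left del: mult_eq_0_iff)
    have same: "ip p (zmon (j1 + m0 - j0) j1) = 0" if "j1 < n" "j0 \<le> j1 + m0" for j1
    proof -
      have "ip p (zmon (j1 + m0 - j0) j1)
          = (\<Sum>j<n. if j1 \<le> j + (j1 + m0 - j0) then c j (j + (j1 + m0 - j0) - j1) * fact (j + (j1 + m0 - j0)) else 0)"
        unfolding ip_p[OF zmon_L2] ip_zmon_zmon using that
        by (intro sum.cong) (auto simp: algebra_simps intro!: arg_cong[where f = fact])
      also have "\<dots> = ip f (zmon (j1 + m0 - j0) j1)"
        unfolding ip_polyan_zmon[OF h fh L2] c_def ..
      finally show ?thesis using orth that by simp
    qed
    have "ip p p = (\<Sum>j<n. (if j0 \<le> j + m0 then c j (j + m0 - j0) else 0) * cnj (ip p (zmon (j + m0 - j0) j)))"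
      by (subst ip_p[OF pL2]) (simp add: ip_cnj[of "zmon _ _" p])
    also have "\<dots> = 0" using same by (intro sum.neutral) auto
    finally have "nrm p = 0" by (simp add: ip_self)
    moreover have "polyan n p" using k by (auto simp: polyan_def p_def)
    ultimately have "p = (\<lambda>z. 0)"
      using nrm_eq_0_continuous[OF pL2 polyan_continuous] by blast
    then have "k j0 1 = 0"
      using polyan_unique[of k n j0 1, OF k] that by (simp add: p_def)
    then show ?thesis by (simp add: k_def)
  qed
  note c0 = this
  have hs: "(\<lambda>m. c j m * z ^ m) sums h j z" for j z
    using holomorphic_power_series[OF holomorphic_on_subset[OF h[of j]], of 0 "cmod z + 1" z]
    by (simp add: c_def)
  have "h j z = 0" if "j < n" for j z
  proof -
    have "(\<lambda>m. 0) sums h j z" using hs[of j z] c0[OF that] by simp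
    then show ?thesis using sums_0 sums_unique2 by blast
  qed
  then show ?thesis unfolding fh by simp
qed

text \<open>\<open>fock 0\<close> contains only the zero function, so the orthogonality condition
  also describes the case k = 1 of \<open>true_fock\<close>.\<close>

lemma true_fock_Suc: "f \<in> true_fock (Suc N) \<longleftrightarrow> f \<in> fock (Suc N) \<and> (\<forall>g\<in>fock N. ip f g = 0)"
proof (cases "N = 0")
  case True
  have "fock 0 \<subseteq> {\<lambda>z. 0}" by (auto simp: fock_iff polyan_0)
  then show ?thesis using True by (auto simp: true_fock_def ip_def)
qed (simp add: true_fock_def)

lemma true_fock_L2: "f \<in> true_fock (Suc N) \<Longrightarrow> f \<in> L2_gauss"
  and true_fock_polyan: "f \<in> true_fock (Suc N) \<Longrightarrow> polyan (Suc N) f"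
  by (simp_all add: true_fock_Suc fock_iff)

lemma true_fock_add: "f \<in> true_fock (Suc N) \<Longrightarrow> g \<in> true_fock (Suc N) \<Longrightarrow> (\<lambda>z. f z + g z) \<in> true_fock (Suc N)"
  by (auto simp: true_fock_Suc fock_iff L2_gauss_add polyan_add ip_add_left)

lemma true_fock_scale: "f \<in> true_fock (Suc N) \<Longrightarrow> (\<lambda>z. c * f z) \<in> true_fock (Suc N)"
  by (auto simp: true_fock_Suc fock_iff L2_gauss_scale polyan_scale ip_scale_left)

lemma polyan_herm: "polyan (Suc N) (herm N m)"
proof -
  have "polyan (Suc N) (\<lambda>z. \<Sum>i\<le>N. herm_coeff N m i * zmon (m - i) (N - i) z)"
    by (intro polyan_sum polyan_scale polyan_zmon) auto
  then show ?thesis by (simp add: herm_def[abs_def])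
qed

text \<open>With the sums interchanged, each Taylor coefficient of g multiplies the sum of
  \<open>herm_coeff_sum_fact\<close> for a degree j < N, which is 0.\<close>

lemma ip_fock_herm:
  assumes "g \<in> fock N"
  shows "ip g (herm N m) = 0"
proof -
  from assms obtain h where h: "\<And>j. h j holomorphic_on UNIV" and gh: "g = (\<lambda>z. \<Sum>j<N. cnj z ^ j * h j z)"
    by (auto simp: fock_iff polyan_def)
  have L2: "g \<in> L2_gauss" using assms by (simp add: fock_iff)
  define c where "c j m = (deriv ^^ m) (h j) 0 / fact m" for j m
  have "ip g (herm N m) = (\<Sum>i\<le>N. herm_coeff N m i *
      (\<Sum>j<N. if N - i \<le> j + (m - i) then c j (j + (m - i) - (N - i)) * fact (j + (m - i)) else 0))"
    unfolding ip_herm_right[OF L2] ip_polyan_zmon[OF h gh L2] c_def ..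
  also have "\<dots> = (\<Sum>i\<le>N. \<Sum>j<N. if N \<le> j + m then c j (j + m - N) * (herm_coeff N m i * fact (j + m - i)) else 0)"
  proof (rule sum.cong)
    fix i assume i: "i \<in> {..N}"
    show "herm_coeff N m i * (\<Sum>j<N. if N - i \<le> j + (m - i) then c j (j + (m - i) - (N - i)) * fact (j + (m - i)) else 0)
        = (\<Sum>j<N. if N \<le> j + m then c j (j + m - N) * (herm_coeff N m i * fact (j + m - i)) else 0)"
    proof (cases "i \<le> m")
      case True
      then have "N - i \<le> j + (m - i) \<longleftrightarrow> N \<le> j + m" "j + (m - i) - (N - i) = j + m - N"
        "j + (m - i) = j + m - i" for j
        using i by auto
      then show ?thesis unfolding sum_distrib_left by (intro sum.cong) auto
    qed (simp add: herm_coeff_eq_0 cong: if_cong)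
  qed simp
  also have "\<dots> = (\<Sum>j<N. if N \<le> j + m then c j (j + m - N) * (\<Sum>i\<le>N. herm_coeff N m i * fact (j + m - i)) else 0)"
    by (subst sum.swap) (auto simp: sum_distrib_left intro!: sum.cong)
  also have "\<dots> = 0"
    by (intro sum.neutral ballI) (simp add: herm_coeff_sum_fact)
  finally show ?thesis .
qed

lemma ebas_true_fock: "ebas N m \<in> true_fock (Suc N)"
proof -
  have "herm N m \<in> true_fock (Suc N)"
    using ip_fock_herm ip_cnj[of "herm N m"]
    by (auto simp: true_fock_Suc fock_iff herm_L2 polyan_herm)
  then show ?thesis unfolding ebas_def[abs_def] by (rule true_fock_scale)
qed

text \<open>\<open>herm N a\<close> differs from \<open>zmon a N\<close> by monomials of lower
  degree in cnj z, to which f is orthogonal already; hence f is orthogonal to all monomials with b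
  \<le> N.\<close>

lemma true_fock_zero_if_orthogonal:
  assumes f: "f \<in> true_fock (Suc N)" and orth: "\<And>m. ip f (ebas N m) = 0"
  shows "f = (\<lambda>z. 0)"
proof (rule fock_zero_if_orthogonal[of f "Suc N"])
  show "f \<in> fock (Suc N)" using f by (simp add: true_fock_Suc)
  have L2: "f \<in> L2_gauss" using f by (rule true_fock_L2)
  have herm0: "ip f (herm N m) = 0" for m
    using orth[of m] unfolding ebas_def[abs_def] ip_scale_right by simp
  have low: "ip f (zmon a b) = 0" if "b < N" for a b
    using f that by (auto simp: true_fock_Suc fock_iff zmon_L2 polyan_zmon)
  fix a b assume "b < Suc N"
  moreover have "ip f (zmon a N) = 0"
  proof -
    have "{..N} = insert 0 {1..N}" by auto
    then have "ip f (herm N a) = ip f (zmon a N) + (\<Sum>i\<in>{1..N}. herm_coeff N a i * ip f (zmon (a - i) (N - i)))"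
      unfolding ip_herm_right[OF L2] by (simp add: herm_coeff_def)
    moreover have "(\<Sum>i\<in>{1..N}. herm_coeff N a i * ip f (zmon (a - i) (N - i))) = 0"
      using low by (intro sum.neutral) auto
    ultimately show ?thesis using herm0 by simp
  qed
  ultimately show "ip f (zmon a b) = 0"
    using low by (cases "b = N") auto
qed

section \<open>Series in the Hermite functions\<close>

lemma summable_power_div_sqrt_fact:
  fixes c :: "nat \<Rightarrow> complex"
  assumes C: "\<And>m. cmod (c m) \<le> C"
  shows "summable (\<lambda>m. norm (c m / of_real (sqrt (fact m)) * z ^ m))"
proof -
  \<comment> \<open>The factor 4 leaves (1/2)^m after the square root, which makes the bound
    summable.\<close>
  define q where "q = 4 * (cmod z)\<^sup>2"
  have "(\<lambda>m. inverse (fact m) * q ^ m) \<longlonglongrightarrow> 0"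
    using summable_LIMSEQ_zero[OF summable_exp[of q]] .
  then have "Bseq (\<lambda>m. inverse (fact m) * q ^ m)"
    using convergentI convergent_imp_Bseq by blast
  then obtain B where B: "\<And>m. norm (inverse (fact m) * q ^ m) \<le> B" "0 < B"
    by (auto simp: Bseq_def)
  have bound: "norm (c m / of_real (sqrt (fact m)) * z ^ m) \<le> C * sqrt B * (1 / 2) ^ m" for m
  proof -
    have "(cmod z ^ m / sqrt (fact m))\<^sup>2 = (1 / 4) ^ m * (inverse (fact m) * q ^ m)"
      by (simp add: q_def power_mult_distrib power_divide power_mult[symmetric] mult.commute field_simps)
    also have "\<dots> \<le> (1 / 4) ^ m * B"
      using B(1)[of m] by (intro mult_left_mono) auto
    also have "\<dots> = (sqrt B * (1 / 2) ^ m)\<^sup>2"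
      using B(2) by (simp add: power_mult_distrib power_mult[symmetric] mult.commute power_even_eq[of "1/2"] power2_eq_square[of "1/2::real"] flip: power_mult)
        (simp add: power_mult power2_eq_square mult.commute[of m 2])
    finally have "cmod z ^ m / sqrt (fact m) \<le> sqrt B * (1 / 2) ^ m"
      by (rule power2_le_imp_le) (use B(2) in simp)
    moreover have "0 \<le> C" using C[of 0] norm_ge_zero order_trans by blast
    ultimately have "cmod (c m) * (cmod z ^ m / sqrt (fact m)) \<le> C * (sqrt B * (1 / 2) ^ m)"
      using C by (intro mult_mono) auto
    then show ?thesis by (simp add: norm_mult norm_divide norm_power mult_ac)
  qed
  show ?thesis
  proof (rule summable_comparison_test'[where N = 0])
    show "summable (\<lambda>m. C * sqrt B * (1 / 2) ^ m)"
      by (intro summable_mult summable_geometric) simp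
    show "norm (norm (c m / of_real (sqrt (fact m)) * z ^ m)) \<le> C * sqrt B * (1 / 2) ^ m" for m
      unfolding real_norm_def abs_norm_cancel by (rule bound)
  qed
qed

lemma diffs_funpow: "(diffs ^^ i) c n = fact (n + i) / fact n * (c (n + i) :: 'a :: field_char_0)"
proof (induction i arbitrary: n)
  case 0
  then show ?case by simp
next
  case (Suc i)
  have "(diffs ^^ Suc i) c n = of_nat (Suc n) * (diffs ^^ i) c (Suc n)"
    by (simp add: diffs_def)
  also have "\<dots> = of_nat (Suc n) * (fact (Suc n + i) / fact (Suc n) * c (Suc n + i))"
    unfolding Suc ..
  also have "\<dots> = fact (n + Suc i) / fact n * c (n + Suc i)"
    unfolding fact_Suc[of n] by (simp del: of_nat_Suc fact_Suc)
  finally show ?case .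
qed

lemma summable_diffs_funpow:
  fixes c :: "nat \<Rightarrow> complex"
  assumes "\<And>z. summable (\<lambda>n. c n * z ^ n)"
  shows "summable (\<lambda>n. (diffs ^^ i) c n * z ^ n)"
proof -
  have "\<forall>z. summable (\<lambda>n. (diffs ^^ i) c n * z ^ n)"
    by (induction i) (auto intro: assms termdiff_converges_all)
  then show ?thesis ..
qed

text \<open>The factor i! (m choose i) z^(m - i) is the i-th derivative of z^m, so a Hermite series
  is a combination of derivatives of one power series, with powers of cnj z as coefficients.\<close>

lemma ebas_as_sum:
  "ebas N m z = (\<Sum>i\<le>N. (- 1) ^ i * of_nat (N choose i) / of_real (sqrt (fact N)) * cnj z ^ (N - i) *
      (fact i * of_nat (m choose i) / of_real (sqrt (fact m)) * z ^ (m - i)))"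
  unfolding ebas_def herm_def herm_coeff_def zmon_def sum_distrib_left
  by (intro sum.cong refl)
    (simp only: real_sqrt_mult of_real_divide of_real_mult of_real_1 of_real_inverse divide_inverse inverse_mult_distrib
      mult_1_left mult_ac)

text \<open>This is the i-th derivative of the power series of a, taken through
  \<open>diffs\<close>; the terms with m < i vanish, which accounts for the shift of the
  index.\<close>

lemma binomial_power_sums:
  fixes c :: "nat \<Rightarrow> complex"
  assumes C: "\<And>m. cmod (c m) \<le> C"
  defines "a \<equiv> \<lambda>m. c m / of_real (sqrt (fact m))"
  shows "(\<lambda>m. c m * (fact i * of_nat (m choose i) / of_real (sqrt (fact m)) * z ^ (m - i))) sums
      (\<Sum>n. (diffs ^^ i) a n * z ^ n)"
proof -
  have suma: "summable (\<lambda>n. a n * z ^ n)" for z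
    unfolding a_def by (rule summable_norm_cancel[OF summable_power_div_sqrt_fact[OF C]])
  define g where "g m = c m * (fact i * of_nat (m choose i) / of_real (sqrt (fact m)) * z ^ (m - i))" for m
  have "g (n + i) = (diffs ^^ i) a n * z ^ n" for n
  proof -
    have "fact i * of_nat ((n + i) choose i) = (fact (n + i) / fact n :: complex)"
      by (simp add: binomial_fact)
    then show ?thesis by (simp add: g_def diffs_funpow a_def)
  qed
  moreover have "(\<lambda>n. (diffs ^^ i) a n * z ^ n) sums (\<Sum>n. (diffs ^^ i) a n * z ^ n)"
    using summable_diffs_funpow[OF suma] by (rule summable_sums)
  ultimately have "(\<lambda>n. g (n + i)) sums (\<Sum>n. (diffs ^^ i) a n * z ^ n)" by simp
  moreover have "(\<Sum>m<i. g m) = 0" by (intro sum.neutral) (auto simp: g_def)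
  ultimately have "g sums (\<Sum>n. (diffs ^^ i) a n * z ^ n)"
    by (simp add: sums_iff_shift)
  then show ?thesis by (simp add: g_def[abs_def])
qed

lemma ebas_sums:
  fixes c :: "nat \<Rightarrow> complex"
  assumes C: "\<And>m. cmod (c m) \<le> C"
  defines "a \<equiv> \<lambda>m. c m / of_real (sqrt (fact m))"
  shows "(\<lambda>m. c m * ebas N m z) sums
    (\<Sum>i\<le>N. (- 1) ^ i * of_nat (N choose i) / of_real (sqrt (fact N)) * cnj z ^ (N - i) * (\<Sum>n. (diffs ^^ i) a n * z ^ n))"
proof -
  have "(\<lambda>m. \<Sum>i\<le>N. (- 1) ^ i * of_nat (N choose i) / of_real (sqrt (fact N)) * cnj z ^ (N - i) *
      (c m * (fact i * of_nat (m choose i) / of_real (sqrt (fact m)) * z ^ (m - i)))) sums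
    (\<Sum>i\<le>N. (- 1) ^ i * of_nat (N choose i) / of_real (sqrt (fact N)) * cnj z ^ (N - i) * (\<Sum>n. (diffs ^^ i) a n * z ^ n))"
    unfolding a_def by (intro sums_sum sums_mult binomial_power_sums[OF C])
  then show ?thesis
    unfolding ebas_as_sum sum_distrib_left by (simp add: mult_ac)
qed

text \<open>The terms bound \<open>ebas N m\<close> on the closed unit disc, also after a power of
  the radius is divided out; they serve as Weierstrass majorant in
  \<open>diagonal_unique\<close>.\<close>

lemma summable_ebas_bound:
  "summable (\<lambda>m. (\<Sum>i\<le>N. cmod (herm_coeff N m i)) / sqrt (fact m * fact N))"
proof -
  have "summable (\<lambda>m. \<Sum>i\<le>N. of_nat (N choose i) / of_real (sqrt (fact N)) *
      (1 * (fact i * of_nat (m choose i) / of_real (sqrt (fact m)) * 1 ^ (m - i))) :: complex)"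
    by (intro summable_sum summable_mult sums_summable[OF binomial_power_sums[where C = 1]]) auto
  moreover have "(\<Sum>i\<le>N. of_nat (N choose i) / of_real (sqrt (fact N)) *
      (1 * (fact i * of_nat (m choose i) / of_real (sqrt (fact m)) * 1 ^ (m - i))))
      = complex_of_real ((\<Sum>i\<le>N. cmod (herm_coeff N m i)) / sqrt (fact m * fact N))" for m
    unfolding sum_divide_distrib of_real_sum
    by (intro sum.cong refl) (simp add: herm_coeff_def norm_mult norm_power real_sqrt_mult mult_ac)
  ultimately have "summable (\<lambda>m. complex_of_real ((\<Sum>i\<le>N. cmod (herm_coeff N m i)) / sqrt (fact m * fact N)))"
    by (simp only:)
  then show ?thesis by (simp only: summable_of_real_iff)
qed

lemma nrm_sq_sum_ebas:
  "(nrm (\<lambda>z. \<Sum>m<M. c m * ebas N m z))\<^sup>2 = (\<Sum>m<M. (cmod (c m))\<^sup>2)"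
proof -
  let ?S = "\<lambda>z. \<Sum>m<M. c m * ebas N m z"
  have S: "?S \<in> L2_gauss" "\<And>g. g \<in> L2_gauss \<Longrightarrow> ip ?S g = (\<Sum>m<M. c m * ip (ebas N m) g)"
    using ip_sum_left[of "{..<M}" "\<lambda>m z. c m * ebas N m z"] ebas_L2 by (auto simp: L2_gauss_scale ip_scale_left)
  have "ip ?S ?S = (\<Sum>m<M. c m * cnj (c m))"
    unfolding S(2)[OF S(1)]
  proof (rule sum.cong)
    fix m assume "m \<in> {..<M}"
    moreover have "ip ?S (ebas N m) = (\<Sum>i<M. if i = m then c m else 0)"
      unfolding S(2)[OF ebas_L2] ip_ebas by (intro sum.cong) auto
    ultimately have "ip ?S (ebas N m) = c m" by simp
    then show "c m * ip (ebas N m) ?S = c m * cnj (c m)"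
      by (subst ip_cnj) simp
  qed simp
  then have "complex_of_real ((nrm ?S)\<^sup>2) = complex_of_real (\<Sum>m<M. (cmod (c m))\<^sup>2)"
    by (simp only: ip_self complex_norm_square of_real_sum)
  then show ?thesis by (simp only: of_real_eq_iff)
qed

text \<open>Fatou's lemma for the pointwise limit of the partial sums, whose norms are bounded
  through the coefficients.\<close>

lemma ebas_series_L2:
  fixes c :: "nat \<Rightarrow> complex"
  assumes sq: "summable (\<lambda>m. (cmod (c m))\<^sup>2)" and F: "\<And>z. (\<lambda>m. c m * ebas N m z) sums F z"
  shows "F \<in> L2_gauss" "(nrm F)\<^sup>2 \<le> (\<Sum>m. (cmod (c m))\<^sup>2)"
proof -
  let ?S = "\<lambda>M z. \<Sum>m<M. c m * ebas N m z"
  have [measurable]: "ebas N m \<in> borel_measurable borel" for m using L2_gaussD[OF ebas_L2] by simp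
  have lim: "(\<lambda>M. ?S M z) \<longlonglongrightarrow> F z" for z using F[of z] by (simp add: sums_def)
  have Fm [measurable]: "F \<in> borel_measurable borel"
    by (rule borel_measurable_LIMSEQ_metric[OF _ lim]) measurable
  have "(\<integral>\<^sup>+z. ennreal ((cmod (F z))\<^sup>2) \<partial>gauss) = (\<integral>\<^sup>+z. liminf (\<lambda>M. ennreal ((cmod (?S M z))\<^sup>2)) \<partial>gauss)"
  proof (rule nn_integral_cong)
    fix z
    have "(\<lambda>M. ennreal ((cmod (?S M z))\<^sup>2)) \<longlonglongrightarrow> ennreal ((cmod (F z))\<^sup>2)"
      by (intro tendsto_ennrealI tendsto_power tendsto_norm lim)
    then show "ennreal ((cmod (F z))\<^sup>2) = liminf (\<lambda>M. ennreal ((cmod (?S M z))\<^sup>2))"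
      by (rule lim_imp_Liminf[OF trivial_limit_sequentially, symmetric])
  qed
  also have "\<dots> \<le> liminf (\<lambda>M. \<integral>\<^sup>+z. ennreal ((cmod (?S M z))\<^sup>2) \<partial>gauss)"
    by (rule nn_integral_liminf) (simp add: measurable_gauss_iff)
  also have "(\<lambda>M. \<integral>\<^sup>+z. ennreal ((cmod (?S M z))\<^sup>2) \<partial>gauss) = (\<lambda>M. ennreal (\<Sum>m<M. (cmod (c m))\<^sup>2))"
  proof
    fix M
    have "?S M \<in> L2_gauss" using ip_sum_left[of "{..<M}" "\<lambda>m z. c m * ebas N m z" "ebas N 0"] ebas_L2 by (auto simp: L2_gauss_scale)
    then have "(\<integral>\<^sup>+z. ennreal ((cmod (?S M z))\<^sup>2) \<partial>gauss) = ennreal (\<integral>z. (cmod (?S M z))\<^sup>2 \<partial>gauss)"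
      by (intro nn_integral_eq_integral L2_gaussD) auto
    then show "(\<integral>\<^sup>+z. ennreal ((cmod (?S M z))\<^sup>2) \<partial>gauss) = ennreal (\<Sum>m<M. (cmod (c m))\<^sup>2)"
      by (simp only: nrm_square[symmetric] nrm_sq_sum_ebas)
  qed
  also have "liminf (\<lambda>M. ennreal (\<Sum>m<M. (cmod (c m))\<^sup>2)) \<le> ennreal (\<Sum>m. (cmod (c m))\<^sup>2)"
    by (intro Liminf_le always_eventually allI ennreal_leI sum_le_suminf sq) auto
  finally have le: "(\<integral>\<^sup>+z. ennreal ((cmod (F z))\<^sup>2) \<partial>gauss) \<le> ennreal (\<Sum>m. (cmod (c m))\<^sup>2)" .
  have int: "integrable gauss (\<lambda>z. (cmod (F z))\<^sup>2)"
    by (rule integrableI_bounded) (use le in \<open>auto simp: measurable_gauss_iff intro: le_less_trans\<close>)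
  then show "F \<in> L2_gauss" by (intro L2_gaussI Fm)
  have "ennreal ((nrm F)\<^sup>2) \<le> ennreal (\<Sum>m. (cmod (c m))\<^sup>2)"
    using le nn_integral_eq_integral[OF int] by (simp add: nrm_square)
  then show "(nrm F)\<^sup>2 \<le> (\<Sum>m. (cmod (c m))\<^sup>2)"
    by (subst (asm) ennreal_le_iff) (auto intro: suminf_nonneg sq)
qed

text \<open>Riesz-Fischer with genuine functions: F is a pointwise sum, polyanalytic because it is
  built from derivatives of a power series, and the norm estimate for tails gives convergence in
  norm. The last conjunct reflects that dbar^N carries \<open>ebas N m\<close> to a multiple of z^m
  / sqrt (m!), which identifies every level with the classical Fock space.\<close>

lemma ebas_synthesis:
  fixes c :: "nat \<Rightarrow> complex"
  assumes sq: "summable (\<lambda>m. (cmod (c m))\<^sup>2)"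
  shows "\<exists>F\<in>true_fock (Suc N). (\<forall>m. ip F (ebas N m) = c m) \<and> (\<forall>z. (\<lambda>m. c m * ebas N m z) sums F z) \<and>
    (\<lambda>m. (cmod (c m))\<^sup>2) sums (nrm F)\<^sup>2 \<and>
    (\<forall>z. (\<lambda>m. c m / of_real (sqrt (fact m)) * z ^ m) sums ((dbar ^^ N) F z / of_real (sqrt (fact N))))"
proof -
  have "cmod (c m) \<le> sqrt (\<Sum>m. (cmod (c m))\<^sup>2)" for m
  proof (rule real_le_rsqrt)
    show "(cmod (c m))\<^sup>2 \<le> (\<Sum>m. (cmod (c m))\<^sup>2)"
      using sum_le_suminf[OF sq, of "{m}"] by simp
  qed
  note C = this
  define a where "a = (\<lambda>m. c m / of_real (sqrt (fact m)))"
  have suma: "summable (\<lambda>n. a n * z ^ n)" for z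
    unfolding a_def by (rule summable_norm_cancel[OF summable_power_div_sqrt_fact[OF C]])
  define D where "D i z = (\<Sum>n. (diffs ^^ i) a n * z ^ n)" for i z
  have D: "D i holomorphic_on UNIV" for i
    unfolding D_def[abs_def] holomorphic_on_def field_differentiable_def
    using termdiffs_strong_converges_everywhere[OF summable_diffs_funpow[OF suma]]
    by (auto intro: has_field_derivative_at_within)
  define F where "F z = (\<Sum>i\<le>N. (- 1) ^ i * of_nat (N choose i) / of_real (sqrt (fact N)) * cnj z ^ (N - i) * D i z)" for z
  have F: "(\<lambda>m. c m * ebas N m z) sums F z" for z
    unfolding F_def D_def a_def by (rule ebas_sums[OF C])
  define h where "h j = (\<lambda>z. (- 1) ^ (N - j) * of_nat (N choose (N - j)) / of_real (sqrt (fact N)) * D (N - j) z)" for j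
  have h: "h j holomorphic_on UNIV" for j
    unfolding h_def by (intro holomorphic_intros D) auto
  have Fh: "F = (\<lambda>z. \<Sum>j<Suc N. cnj z ^ j * h j z)"
  proof
    fix z
    have "F z = (\<Sum>j\<in>{..N}. cnj z ^ j * h j z)"
      unfolding F_def
      by (rule sum.reindex_bij_witness[of _ "\<lambda>j. N - j" "\<lambda>i. N - i"]) (auto simp: h_def)
    then show "F z = (\<Sum>j<Suc N. cnj z ^ j * h j z)" by (simp only: lessThan_Suc_atMost)
  qed
  have pF: "polyan (Suc N) F" using h Fh by (auto simp: polyan_def)
  note L2 = ebas_series_L2[OF sq F]
  have top: "(\<lambda>m. c m / of_real (sqrt (fact m)) * z ^ m) sums ((dbar ^^ N) F z / of_real (sqrt (fact N)))" for z
  proof -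
    have "(dbar ^^ N) F z = fact N * h N z"
      unfolding Fh dbar_funpow_sum[of h, OF h] by (simp add: Suc_diff_le)
    also have "\<dots> = of_real (sqrt (fact N)) * D 0 z"
    proof -
      have "complex_of_real (sqrt (fact N)) * complex_of_real (sqrt (fact N)) = complex_of_real (fact N)"
        by (simp only: of_real_mult[symmetric] real_sqrt_mult_self) simp
      then show ?thesis by (simp add: h_def field_simps)
    qed
    finally show ?thesis using summable_sums[OF suma[of z]] by (simp add: D_def a_def)
  qed
  \<comment> \<open>The tail is itself such a series, with the first M coefficients set to
    0.\<close>
  have tail: "(nrm (\<lambda>z. F z + (- 1) * (\<Sum>m<M. c m * ebas N m z)))\<^sup>2 \<le> (\<Sum>m. (cmod (c (m + M)))\<^sup>2)" for M
  proof -
    define c' where "c' m = (if m < M then 0 else c m)" for m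
    have sq': "summable (\<lambda>m. (cmod (c' m))\<^sup>2)"
      by (rule summable_comparison_test'[OF sq, where N = 0]) (auto simp: c'_def)
    have "(\<lambda>m. c' m * ebas N m z) sums (F z + (- 1) * (\<Sum>m<M. c m * ebas N m z))" for z
    proof -
      have "(\<lambda>m. if m < M then c m * ebas N m z else 0) sums (\<Sum>m<M. c m * ebas N m z)"
        using sums_If_finite_set[of "{..<M}" "\<lambda>m. c m * ebas N m z"] by simp
      from sums_diff[OF F[of z] this] show ?thesis
        by (simp add: c'_def if_distrib[of "\<lambda>x. x * _"] if_distrib[of "\<lambda>x. _ - x"] cong: if_cong)
    qed
    from ebas_series_L2(2)[OF sq' this]
    have "(nrm (\<lambda>z. F z + (- 1) * (\<Sum>m<M. c m * ebas N m z)))\<^sup>2 \<le> (\<Sum>m. (cmod (c' m))\<^sup>2)" .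
    also have "\<dots> = (\<Sum>m. (cmod (c' (m + M)))\<^sup>2) + (\<Sum>m<M. (cmod (c' m))\<^sup>2)"
      by (rule suminf_split_initial_segment[OF sq'])
    also have "\<dots> = (\<Sum>m. (cmod (c (m + M)))\<^sup>2)" by (simp add: c'_def)
    finally show ?thesis .
  qed
  have S: "(\<lambda>z. \<Sum>m<M. c m * ebas N m z) \<in> L2_gauss"
    "g \<in> L2_gauss \<Longrightarrow> ip (\<lambda>z. \<Sum>m<M. c m * ebas N m z) g = (\<Sum>m<M. c m * ip (ebas N m) g)" for M g
    using ip_sum_left[of "{..<M}" "\<lambda>m z. c m * ebas N m z"] ebas_L2[of N 0] ebas_L2 by (auto simp: L2_gauss_scale ip_scale_left)
  have tail0: "(\<lambda>M. nrm (\<lambda>z. F z + (- 1) * (\<Sum>m<M. c m * ebas N m z))) \<longlonglongrightarrow> 0"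
  proof -
    have "(\<lambda>M. \<Sum>m. (cmod (c (m + M)))\<^sup>2) \<longlonglongrightarrow> 0" by (rule suminf_exist_split2[OF sq])
    then have "(\<lambda>M. sqrt (\<Sum>m. (cmod (c (m + M)))\<^sup>2)) \<longlonglongrightarrow> 0"
      using tendsto_real_sqrt[of "\<lambda>M. \<Sum>m. (cmod (c (m + M)))\<^sup>2" 0] by simp
    moreover have "\<forall>\<^sub>F M in sequentially. norm (nrm (\<lambda>z. F z + (- 1) * (\<Sum>m<M. c m * ebas N m z)))
        \<le> sqrt (\<Sum>m. (cmod (c (m + M)))\<^sup>2)"
      using real_le_rsqrt[OF tail] by (intro always_eventually) simp
    ultimately show ?thesis by (rule Lim_null_comparison[rotated])
  qed
  have ipF: "(\<lambda>m. c m * ip (ebas N m) g) sums ip F g" if g: "g \<in> L2_gauss" for g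
  proof -
    have "(\<lambda>M. ip F g - (\<Sum>m<M. c m * ip (ebas N m) g)) \<longlonglongrightarrow> 0"
    proof (rule Lim_null_comparison)
      show "(\<lambda>M. nrm (\<lambda>z. F z + (- 1) * (\<Sum>m<M. c m * ebas N m z)) * nrm g) \<longlonglongrightarrow> 0"
        using tendsto_mult_right[OF tail0, of "nrm g"] by simp
      have eq: "ip (\<lambda>z. F z + (- 1) * (\<Sum>m<M. c m * ebas N m z)) g = ip F g - (\<Sum>m<M. c m * ip (ebas N m) g)" for M
        using ip_add_left[OF L2(1) L2_gauss_scale[OF S(1)] g, of "-1"] unfolding ip_scale_left S(2)[OF g] by simp
      then show "\<forall>\<^sub>F M in sequentially. norm (ip F g - (\<Sum>m<M. c m * ip (ebas N m) g))
          \<le> nrm (\<lambda>z. F z + (- 1) * (\<Sum>m<M. c m * ebas N m z)) * nrm g"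
        unfolding eq[symmetric]
        by (intro always_eventually allI Cauchy_Schwarz_ip[OF L2_gauss_add[OF L2(1) L2_gauss_scale[OF S(1)]] g])
    qed
    from tendsto_diff[OF tendsto_const[of "ip F g"] this]
    show ?thesis by (simp add: sums_def)
  qed
  have ipFc: "ip F (ebas N m) = c m" for m
  proof -
    have "(\<lambda>i. if i = m then c i else 0) sums ip F (ebas N m)"
      using ipF[OF ebas_L2[of N m]] unfolding ip_ebas by (simp add: if_distrib[of "\<lambda>x. _ * x"] cong: if_cong)
    then show ?thesis using sums_single[of m c] sums_unique2 by blast
  qed
  have "F \<in> true_fock (Suc N)"
    unfolding true_fock_Suc fock_iff
  proof (intro conjI ballI L2 pF)
    fix g assume gf: "g \<in> fock N"
    then have g: "g \<in> L2_gauss" by (simp add: fock_iff)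
    from gf have "ip (ebas N m) g = 0" for m
      using ebas_true_fock[of N m] by (auto simp: true_fock_Suc fock_iff)
    with ipF[of g] g have "(\<lambda>m. 0) sums ip F g" by simp
    then show "ip F g = 0" using sums_0 sums_unique2 by blast
  qed
  moreover have "(\<lambda>m. (cmod (c m))\<^sup>2) sums (nrm F)\<^sup>2"
  proof -
    have eq: "ip (ebas N m) F = cnj (c m)" for m unfolding ip_cnj[of "ebas N m" F] ipFc ..
    have "(\<lambda>m. complex_of_real ((cmod (c m))\<^sup>2)) sums complex_of_real ((nrm F)\<^sup>2)"
      using ipF[OF L2(1)] unfolding eq ip_self complex_norm_square .
    then show ?thesis by (simp only: sums_of_real_iff)
  qed
  ultimately show ?thesis using F top ipFc by blast
qed

text \<open>Bessel's inequality makes the coefficients square summable; the function synthesized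
  from them has the same coefficients as f and equals it by totality.\<close>

lemma true_fock_expansion:
  assumes f: "f \<in> true_fock (Suc N)"
  shows "(\<lambda>m. (cmod (ip f (ebas N m)))\<^sup>2) sums (nrm f)\<^sup>2"
    and "(\<lambda>m. ip f (ebas N m) * ebas N m z) sums f z"
    and "(\<lambda>m. ip f (ebas N m) / of_real (sqrt (fact m)) * z ^ m) sums ((dbar ^^ N) f z / of_real (sqrt (fact N)))"
proof -
  define c where "c m = ip f (ebas N m)" for m
  have L2: "f \<in> L2_gauss" by (rule true_fock_L2[OF f])
  have "(\<Sum>m<M. (cmod (c m))\<^sup>2) \<le> (nrm f)\<^sup>2" for M
  proof -
    let ?S = "\<lambda>z. \<Sum>m<M. c m * ebas N m z"
    have S: "?S \<in> L2_gauss" "\<And>g. g \<in> L2_gauss \<Longrightarrow> ip ?S g = (\<Sum>m<M. c m * ip (ebas N m) g)"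
      using ip_sum_left[of "{..<M}" "\<lambda>m z. c m * ebas N m z"] ebas_L2[of N 0] ebas_L2 by (auto simp: L2_gauss_scale ip_scale_left)
    have "ip ?S f = (\<Sum>m<M. c m * cnj (c m))"
      unfolding S(2)[OF L2] by (simp add: c_def ip_cnj[of "ebas N _" f])
    also have "\<dots> = complex_of_real (\<Sum>m<M. (cmod (c m))\<^sup>2)"
      by (simp only: complex_norm_square of_real_sum)
    finally have "(\<Sum>m<M. (cmod (c m))\<^sup>2) = cmod (ip ?S f)"
      by (simp only: norm_of_real) (simp add: sum_nonneg)
    also have "\<dots> \<le> nrm ?S * nrm f" by (rule Cauchy_Schwarz_ip[OF S(1) L2])
    finally have "(nrm ?S)\<^sup>2 \<le> nrm ?S * nrm f" by (simp only: nrm_sq_sum_ebas)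
    then have "nrm ?S \<le> nrm f"
      by (cases "nrm ?S = 0") (auto simp: power2_eq_square mult_le_cancel_left less_le)
    then have "(nrm ?S)\<^sup>2 \<le> (nrm f)\<^sup>2" by (intro power_mono) auto
    then show ?thesis by (simp only: nrm_sq_sum_ebas)
  qed
  then have "summable (\<lambda>m. (cmod (c m))\<^sup>2)"
    by (intro summableI_nonneg_bounded[where x = "(nrm f)\<^sup>2"]) auto
  from ebas_synthesis[OF this, of N] obtain F where F: "F \<in> true_fock (Suc N)" "\<And>m. ip F (ebas N m) = c m"
    "\<And>z. (\<lambda>m. c m * ebas N m z) sums F z" "(\<lambda>m. (cmod (c m))\<^sup>2) sums (nrm F)\<^sup>2"
    "\<And>z. (\<lambda>m. c m / of_real (sqrt (fact m)) * z ^ m) sums ((dbar ^^ N) F z / of_real (sqrt (fact N)))"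
    by blast
  have "(\<lambda>z. f z + (- 1) * F z) = (\<lambda>z. 0)"
  proof (rule true_fock_zero_if_orthogonal)
    show "(\<lambda>z. f z + (- 1) * F z) \<in> true_fock (Suc N)" by (intro true_fock_add true_fock_scale f F)
    show "ip (\<lambda>z. f z + (- 1) * F z) (ebas N m) = 0" for m
      using ip_add_left[OF L2 L2_gauss_scale[OF true_fock_L2[OF F(1)]] ebas_L2, of "-1" N m]
      unfolding ip_scale_left F(2) c_def by simp
  qed
  then have "f = F" by (simp add: fun_eq_iff)
  with F show "(\<lambda>m. (cmod (ip f (ebas N m)))\<^sup>2) sums (nrm f)\<^sup>2"
    "(\<lambda>m. ip f (ebas N m) * ebas N m z) sums f z"
    "(\<lambda>m. ip f (ebas N m) / of_real (sqrt (fact m)) * z ^ m) sums ((dbar ^^ N) f z / of_real (sqrt (fact N)))"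
    unfolding c_def by auto
qed

section \<open>Hilbert spaces of functions with a countable orthonormal basis\<close>

text \<open>Completeness of H is expressed through coefficients, by \<open>synthesis\<close>; the
  locale collects what the functional analysis below uses of the true polyanalytic space.\<close>

locale hilbert_basis =
  fixes H :: "(complex \<Rightarrow> complex) set" and e :: "nat \<Rightarrow> complex \<Rightarrow> complex"
  assumes L2: "f \<in> H \<Longrightarrow> f \<in> L2_gauss"
    and add_mem: "f \<in> H \<Longrightarrow> g \<in> H \<Longrightarrow> (\<lambda>z. f z + g z) \<in> H"
    and scale_mem: "f \<in> H \<Longrightarrow> (\<lambda>z. c * f z) \<in> H"
    and basis_mem: "e n \<in> H"
    and basis_orthonormal: "ip (e m) (e n) = (if m = n then 1 else 0)"
    and basis_total: "f \<in> H \<Longrightarrow> (\<And>n. ip f (e n) = 0) \<Longrightarrow> f = (\<lambda>z. 0)"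
    and parseval: "f \<in> H \<Longrightarrow> (\<lambda>n. (cmod (ip f (e n)))\<^sup>2) sums (nrm f)\<^sup>2"
    and synthesis: "summable (\<lambda>n. (cmod (a n))\<^sup>2) \<Longrightarrow> \<exists>f\<in>H. \<forall>n. ip f (e n) = a n"
begin

lemma zero_mem: "(\<lambda>z. 0) \<in> H"
  using scale_mem[OF basis_mem, of 0] by simp

lemma diff_mem: "f \<in> H \<Longrightarrow> g \<in> H \<Longrightarrow> (\<lambda>z. f z - g z) \<in> H"
  using add_mem[OF _ scale_mem, of f g "-1"] by simp

lemma sum_mem:
  assumes "\<And>i. i \<in> I \<Longrightarrow> f i \<in> H"
  shows "(\<lambda>z. \<Sum>i\<in>I. f i z) \<in> H"
  using assms by (induction I rule: infinite_finite_induct) (auto simp: zero_mem add_mem)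

lemma ip_zero_left [simp]: "ip (\<lambda>z. 0) f = 0" and ip_zero_right [simp]: "ip f (\<lambda>z. 0) = 0"
  by (simp_all add: ip_def)

lemma nrm_zero [simp]: "nrm (\<lambda>z. 0) = 0"
  by (simp add: nrm_def)

lemma ip_add: "f \<in> H \<Longrightarrow> g \<in> H \<Longrightarrow> h \<in> H \<Longrightarrow> ip (\<lambda>z. f z + g z) h = ip f h + ip g h"
  by (simp add: ip_add_left L2)

lemma ip_add': "f \<in> H \<Longrightarrow> g \<in> H \<Longrightarrow> h \<in> H \<Longrightarrow> ip h (\<lambda>z. f z + g z) = ip h f + ip h g"
  by (simp add: ip_add_right L2)

lemma ip_diff: "f \<in> H \<Longrightarrow> g \<in> H \<Longrightarrow> h \<in> H \<Longrightarrow> ip (\<lambda>z. f z - g z) h = ip f h - ip g h"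
  using ip_add[OF _ scale_mem, of f g h "-1"] ip_scale_left[of "-1" g h] by simp

lemma ip_diff': "f \<in> H \<Longrightarrow> g \<in> H \<Longrightarrow> h \<in> H \<Longrightarrow> ip h (\<lambda>z. f z - g z) = ip h f - ip h g"
  by (subst (1 2 3) ip_cnj) (simp add: ip_diff)

lemma ip_lincomb:
  assumes "\<And>i. i \<in> I \<Longrightarrow> f i \<in> H" "h \<in> H"
  shows "ip (\<lambda>z. \<Sum>i\<in>I. c i * f i z) h = (\<Sum>i\<in>I. c i * ip (f i) h)"
  using assms
  by (induction I rule: infinite_finite_induct)
     (auto simp: ip_add sum_mem scale_mem ip_scale_left)

lemma lincomb_mem:
  assumes "\<And>i. i \<in> I \<Longrightarrow> f i \<in> H"
  shows "(\<lambda>z. \<Sum>i\<in>I. c i * f i z) \<in> H"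
  by (intro sum_mem scale_mem assms)

lemma Cauchy_Schwarz: "f \<in> H \<Longrightarrow> g \<in> H \<Longrightarrow> cmod (ip f g) \<le> nrm f * nrm g"
  by (intro Cauchy_Schwarz_ip L2)

lemma nrm_eq_0: "f \<in> H \<Longrightarrow> nrm f = 0 \<Longrightarrow> f = (\<lambda>z. 0)"
  using Cauchy_Schwarz[OF _ basis_mem, of f] by (intro basis_total) auto

lemma nrm_basis: "nrm (e n) = 1"
proof -
  have "complex_of_real ((nrm (e n))\<^sup>2) = 1"
    using basis_orthonormal[of n n] by (simp only: ip_self) simp
  then have "(nrm (e n))\<^sup>2 = 1" by (simp only: of_real_eq_1_iff)
  then show ?thesis using power2_eq_1_iff[of "nrm (e n)"] nrm_nonneg[of "e n"] by linarith
qed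

lemma eqI: 
  assumes "f \<in> H" "g \<in> H" "\<And>n. ip f (e n) = ip g (e n)"
  shows "f = g"
proof -
  have "(\<lambda>z. f z - g z) = (\<lambda>z. 0)"
    using assms by (intro basis_total diff_mem) (auto simp: ip_diff basis_mem)
  then show ?thesis by (simp add: fun_eq_iff)
qed

definition trunc :: "nat \<Rightarrow> (complex \<Rightarrow> complex) \<Rightarrow> complex \<Rightarrow> complex" where
  "trunc K f = (\<lambda>z. \<Sum>n<K. ip f (e n) * e n z)"

lemma trunc_mem: "trunc K f \<in> H"
  unfolding trunc_def by (intro lincomb_mem basis_mem)

lemma ip_lincomb_basis:
  assumes "finite I"
  shows "ip (\<lambda>z. \<Sum>n\<in>I. c n * e n z) (e m) = (if m \<in> I then c m else 0)"
proof -
  have "ip (\<lambda>z. \<Sum>n\<in>I. c n * e n z) (e m) = (\<Sum>n\<in>I. if n = m then c n else 0)"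
    by (subst ip_lincomb) (auto simp: basis_mem basis_orthonormal intro!: sum.cong)
  then show ?thesis using assms by simp
qed

lemma nrm_lincomb_basis:
  assumes "finite I"
  shows "(nrm (\<lambda>z. \<Sum>n\<in>I. c n * e n z))\<^sup>2 = (\<Sum>n\<in>I. (cmod (c n))\<^sup>2)"
proof -
  have "(\<lambda>m. (cmod (if m \<in> I then c m else 0))\<^sup>2) sums (nrm (\<lambda>z. \<Sum>n\<in>I. c n * e n z))\<^sup>2"
    using parseval[OF lincomb_mem[of I e c]] basis_mem by (simp add: ip_lincomb_basis[OF assms])
  moreover have "(\<lambda>m. (cmod (if m \<in> I then c m else 0))\<^sup>2) sums (\<Sum>n\<in>I. (cmod (c n))\<^sup>2)"
    using sums_If_finite_set[OF assms, of "\<lambda>m. (cmod (c m))\<^sup>2"]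
    by (simp add: if_distrib[of "\<lambda>x. (cmod x)\<^sup>2"] cong: if_cong)
  ultimately show ?thesis by (rule sums_unique2)
qed

lemma ip_trunc: "ip (trunc K f) (e n) = (if n < K then ip f (e n) else 0)"
  unfolding trunc_def by (subst ip_lincomb_basis) auto

lemma trunc_tendsto:
  assumes f: "f \<in> H"
  shows "(\<lambda>K. nrm (\<lambda>z. f z - trunc K f z)) \<longlonglongrightarrow> 0"
proof -
  let ?c = "\<lambda>n. (cmod (ip f (e n)))\<^sup>2"
  have sm: "summable ?c" using parseval[OF f] by (rule sums_summable)
  have "(nrm (\<lambda>z. f z - trunc K f z))\<^sup>2 = (\<Sum>n. ?c (n + K))" for K
  proof -
    have "(\<lambda>n. (cmod (ip (\<lambda>z. f z - trunc K f z) (e n)))\<^sup>2) sums (nrm (\<lambda>z. f z - trunc K f z))\<^sup>2"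
      by (intro parseval diff_mem f trunc_mem)
    moreover have "ip (\<lambda>z. f z - trunc K f z) (e n) = (if n < K then 0 else ip f (e n))" for n
      unfolding ip_diff[OF f trunc_mem basis_mem] ip_trunc by simp
    ultimately have *: "(\<lambda>n. if n < K then 0 else ?c n) sums (nrm (\<lambda>z. f z - trunc K f z))\<^sup>2"
      by (simp add: if_distrib[of "\<lambda>x. (cmod x)\<^sup>2"] cong: if_cong)
    have "(nrm (\<lambda>z. f z - trunc K f z))\<^sup>2 = (\<Sum>n. (if n < K then 0 else ?c n))"
      using * by (simp add: sums_iff)
    also have "\<dots> = (\<Sum>n. if n + K < K then 0 else ?c (n + K)) + (\<Sum>n<K. if n < K then 0 else ?c n)"
      by (rule suminf_split_initial_segment[OF sums_summable[OF *]])
    finally show ?thesis by simp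
  qed
  then have eq: "nrm (\<lambda>z. f z - trunc K f z) = sqrt (\<Sum>n. ?c (n + K))" for K
    by (metis nrm_nonneg real_sqrt_unique)
  have "(\<lambda>K. \<Sum>n. ?c (n + K)) \<longlonglongrightarrow> 0" by (rule suminf_exist_split2[OF sm])
  from tendsto_real_sqrt[OF this] show ?thesis unfolding eq by simp
qed

lemma nrm_trunc_le:
  assumes f: "f \<in> H"
  shows "nrm (trunc K f) \<le> nrm f"
proof (rule power2_le_imp_le)
  have "(nrm (trunc K f))\<^sup>2 = (\<Sum>n<K. (cmod (ip f (e n)))\<^sup>2)"
    unfolding trunc_def by (rule nrm_lincomb_basis) simp
  also have "\<dots> \<le> (\<Sum>n. (cmod (ip f (e n)))\<^sup>2)"
    using parseval[OF f] by (intro sum_le_suminf) (auto simp: sums_iff)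
  also have "\<dots> = (nrm f)\<^sup>2" using parseval[OF f] by (simp add: sums_iff)
  finally show "(nrm (trunc K f))\<^sup>2 \<le> (nrm f)\<^sup>2" .
qed simp

section \<open>Bounded functionals and sesquilinear forms\<close>

definition blf :: "real \<Rightarrow> ((complex \<Rightarrow> complex) \<Rightarrow> complex) \<Rightarrow> bool" where
  "blf C L \<longleftrightarrow> (\<forall>f\<in>H. \<forall>g\<in>H. L (\<lambda>z. f z + g z) = L f + L g) \<and>
     (\<forall>c. \<forall>f\<in>H. L (\<lambda>z. c * f z) = c * L f) \<and> (\<forall>f\<in>H. cmod (L f) \<le> C * nrm f)"

lemma blf_lincomb:
  assumes L: "blf C L" and f: "\<And>i. i \<in> I \<Longrightarrow> f i \<in> H"
  shows "L (\<lambda>z. \<Sum>i\<in>I. c i * f i z) = (\<Sum>i\<in>I. c i * L (f i))"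
proof -
  have L0: "L (\<lambda>z. 0) = 0"
  proof -
    have "\<forall>c. \<forall>f\<in>H. L (\<lambda>z. c * f z) = c * L f" using L by (simp add: blf_def)
    from this[rule_format, OF zero_mem, of 0] show ?thesis by simp
  qed
  show ?thesis using f
    by (induction I rule: infinite_finite_induct)
       (use L L0 in \<open>auto simp: blf_def sum_mem scale_mem\<close>)
qed

lemma blf_diff:
  assumes "blf C L" "f \<in> H" "g \<in> H"
  shows "L (\<lambda>z. f z - g z) = L f - L g"
proof -
  have "L (\<lambda>z. f z + (- 1) * g z) = L f + (- 1) * L g"
    using assms scale_mem[of g "- 1"] unfolding blf_def by metis
  then show ?thesis by simp
qed

lemma blf_nonneg: "blf C L \<Longrightarrow> 0 \<le> C"
  unfolding blf_def using basis_mem[of 0] nrm_basis[of 0] norm_ge_zero[of "L (e 0)"]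
  by (metis mult.right_neutral order_trans)

lemma blf_trunc_tendsto:
  assumes L: "blf C L" and f: "f \<in> H"
  shows "(\<lambda>K. L (trunc K f)) \<longlonglongrightarrow> L f"
proof -
  have "(\<lambda>K. L f - L (trunc K f)) \<longlonglongrightarrow> 0"
  proof (rule Lim_null_comparison)
    show "(\<lambda>K. C * nrm (\<lambda>z. f z - trunc K f z)) \<longlonglongrightarrow> 0"
      using tendsto_mult_left[OF trunc_tendsto[OF f], of C] by simp
    show "\<forall>\<^sub>F K in sequentially. norm (L f - L (trunc K f)) \<le> C * nrm (\<lambda>z. f z - trunc K f z)"
      unfolding blf_diff[OF L f trunc_mem, symmetric]
      using L diff_mem[OF f trunc_mem] by (intro always_eventually) (auto simp: blf_def)
  qed
  from tendsto_diff[OF tendsto_const[of "L f"] this] show ?thesis by simp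
qed

lemma blf_ip: "g \<in> H \<Longrightarrow> blf (nrm g) (\<lambda>f. ip f g)"
  using Cauchy_Schwarz unfolding blf_def by (auto simp: ip_add ip_scale_left mult.commute)

text \<open>The representing vector has the coefficients cnj (L (e n)). They are square summable
  since L, applied to a finite part x of that vector, gives the square of \<open>nrm x\<close>,
  which is at most C times \<open>nrm x\<close>.\<close>

lemma riesz:
  assumes L: "blf C L"
  shows "\<exists>g\<in>H. \<forall>f\<in>H. L f = ip f g"
proof -
  define l where "l n = L (e n)" for n
  have "(\<Sum>n<K. (cmod (l n))\<^sup>2) \<le> C\<^sup>2" for K
  proof -
    define x where "x = (\<lambda>z. \<Sum>n<K. cnj (l n) * e n z)"
    have x: "x \<in> H" unfolding x_def by (intro lincomb_mem basis_mem)
    have nx: "(nrm x)\<^sup>2 = (\<Sum>n<K. (cmod (l n))\<^sup>2)"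
      unfolding x_def by (subst nrm_lincomb_basis) auto
    have "L x = (\<Sum>n<K. cnj (l n) * l n)"
      unfolding x_def l_def by (rule blf_lincomb[OF L basis_mem])
    also have "\<dots> = complex_of_real (\<Sum>n<K. (cmod (l n))\<^sup>2)"
      by (simp only: complex_norm_square of_real_sum mult.commute[of "cnj _"])
    finally have "cmod (L x) = (nrm x)\<^sup>2" unfolding nx by (simp only: norm_of_real) (simp add: sum_nonneg)
    moreover have "cmod (L x) \<le> C * nrm x" using L x by (auto simp: blf_def)
    ultimately have "nrm x * nrm x \<le> C * nrm x" by (simp add: power2_eq_square)
    then have "nrm x \<le> C"
      using blf_nonneg[OF L] nrm_nonneg[of x] by (cases "nrm x = 0") (auto simp: mult_le_cancel_right)
    then show ?thesis unfolding nx[symmetric] by (intro power_mono) auto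
  qed
  then have "summable (\<lambda>n. (cmod (cnj (l n)))\<^sup>2)"
    by (intro summableI_nonneg_bounded[where x = "C\<^sup>2"]) auto
  from synthesis[OF this] obtain g where g: "g \<in> H" "\<And>n. ip g (e n) = cnj (l n)" by blast
  have "L f = ip f g" if f: "f \<in> H" for f
  proof (rule LIMSEQ_unique)
    show "(\<lambda>K. L (trunc K f)) \<longlonglongrightarrow> L f" by (rule blf_trunc_tendsto[OF L f])
    have "L (trunc K f) = ip (trunc K f) g" for K
    proof -
      have "ip (e n) g = l n" for n using g(2)[of n] by (subst ip_cnj) simp
      then show ?thesis
        using blf_lincomb[OF L, of "{..<K}" e "\<lambda>n. ip f (e n)", OF basis_mem]
          ip_lincomb[of "{..<K}" e g "\<lambda>n. ip f (e n)", OF basis_mem g(1)]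
        by (simp add: l_def trunc_def)
    qed
    then show "(\<lambda>K. L (trunc K f)) \<longlonglongrightarrow> ip f g"
      using blf_trunc_tendsto[OF blf_ip[OF g(1)] f] by simp
  qed
  with g(1) show ?thesis by blast
qed

text \<open>The common bound C makes the contribution beyond a truncation uniformly small, so
  convergence at the basis vectors suffices.\<close>

lemma blf_limit:
  assumes L: "\<And>M. blf C (L M)" and L': "blf C L'" and lim: "\<And>n. (\<lambda>M. L M (e n)) \<longlonglongrightarrow> L' (e n)" and f: "f \<in> H"
  shows "(\<lambda>M. L M f) \<longlonglongrightarrow> L' f"
proof (rule LIMSEQ_I)
  fix r :: real assume r: "0 < r"
  have C: "0 \<le> C" by (rule blf_nonneg[OF L'])
  have "(\<lambda>K. C * nrm (\<lambda>z. f z - trunc K f z)) \<longlonglongrightarrow> 0"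
    using tendsto_mult_left[OF trunc_tendsto[OF f], of C] by simp
  then have "\<forall>\<^sub>F K in sequentially. C * nrm (\<lambda>z. f z - trunc K f z) < r / 3"
    using r by (intro order_tendstoD) auto
  then obtain K where K: "C * nrm (\<lambda>z. f z - trunc K f z) < r / 3"
    using eventually_happens'[OF sequentially_bot] by blast
  have bd: "cmod (l f - l (trunc K f)) < r / 3" if "blf C l" for l
  proof -
    have "cmod (l f - l (trunc K f)) \<le> C * nrm (\<lambda>z. f z - trunc K f z)"
      unfolding blf_diff[OF that f trunc_mem, symmetric]
      using that diff_mem[OF f trunc_mem] by (auto simp: blf_def)
    then show ?thesis using K by simp
  qed
  have "(\<lambda>M. L M (trunc K f)) \<longlonglongrightarrow> L' (trunc K f)"
    unfolding trunc_def blf_lincomb[OF L basis_mem] blf_lincomb[OF L' basis_mem]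
    by (intro tendsto_sum tendsto_mult_left lim)
  then obtain M0 where M0: "\<And>M. M \<ge> M0 \<Longrightarrow> cmod (L M (trunc K f) - L' (trunc K f)) < r / 3"
    using r LIMSEQ_D[of _ _ "r / 3"] by (metis zero_less_divide_iff zero_less_numeral)
  have "cmod (L M f - L' f) < r" if "M \<ge> M0" for M
  proof -
    have e: "L M f - L' f = (L M f - L M (trunc K f)) + (L M (trunc K f) - L' (trunc K f)) - (L' f - L' (trunc K f))"
      by simp
    have "cmod (L M f - L' f) \<le> cmod (L M f - L M (trunc K f)) + cmod (L M (trunc K f) - L' (trunc K f))
        + cmod (L' f - L' (trunc K f))"
      unfolding e by (rule order_trans[OF norm_triangle_ineq4 add_right_mono[OF norm_triangle_ineq]])
    then show ?thesis using bd[OF L[of M]] bd[OF L'] M0[OF that] by linarith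
  qed
  then show "\<exists>no. \<forall>n\<ge>no. norm (L n f - L' f) < r" by blast
qed

text \<open>Forms rather than operators, so that averages of conjugated operators can be handled
  without an operator attached to them. Conjugation makes the second slot linear.\<close>

definition bform :: "real \<Rightarrow> ((complex \<Rightarrow> complex) \<Rightarrow> (complex \<Rightarrow> complex) \<Rightarrow> complex) \<Rightarrow> bool" where
  "bform C F \<longleftrightarrow> 0 \<le> C \<and> (\<forall>g\<in>H. blf (C * nrm g) (\<lambda>f. F f g)) \<and> (\<forall>f\<in>H. blf (C * nrm f) (\<lambda>g. cnj (F f g)))"

lemma bform_limit:
  assumes F: "\<And>M. bform C (F M)" and F': "bform C F'" and lim: "\<And>m n. (\<lambda>M. F M (e n) (e m)) \<longlonglongrightarrow> F' (e n) (e m)"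
    and f: "f \<in> H" and g: "g \<in> H"
  shows "(\<lambda>M. F M f g) \<longlonglongrightarrow> F' f g"
proof -
  have "(\<lambda>M. F M (e n) g) \<longlonglongrightarrow> F' (e n) g" for n
  proof -
    have "(\<lambda>M. cnj (F M (e n) g)) \<longlonglongrightarrow> cnj (F' (e n) g)"
    proof (rule blf_limit[where C = "C * nrm (e n)" and L = "\<lambda>M g. cnj (F M (e n) g)" and L' = "\<lambda>g. cnj (F' (e n) g)"])
      show "(\<lambda>M. cnj (F M (e n) (e m))) \<longlonglongrightarrow> cnj (F' (e n) (e m))" for m
        using lim by (simp add: lim_cnj)
    qed (use F F' basis_mem g in \<open>auto simp: bform_def\<close>)
    then show ?thesis by (simp add: lim_cnj)
  qed
  then show ?thesis
    by (rule blf_limit[where C = "C * nrm g" and L = "\<lambda>M f. F M f g" and L' = "\<lambda>f. F' f g", rotated 2])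
       (use F F' f g in \<open>auto simp: bform_def\<close>)
qed

lemma bformI:
  assumes "0 \<le> C" "\<And>f g h. f \<in> H \<Longrightarrow> g \<in> H \<Longrightarrow> h \<in> H \<Longrightarrow> F (\<lambda>z. f z + g z) h = F f h + F g h"
    "\<And>f g h. f \<in> H \<Longrightarrow> g \<in> H \<Longrightarrow> h \<in> H \<Longrightarrow> F h (\<lambda>z. f z + g z) = F h f + F h g"
    "\<And>c f h. f \<in> H \<Longrightarrow> h \<in> H \<Longrightarrow> F (\<lambda>z. c * f z) h = c * F f h"
    "\<And>c f h. f \<in> H \<Longrightarrow> h \<in> H \<Longrightarrow> F h (\<lambda>z. c * f z) = cnj c * F h f"
    "\<And>f g. f \<in> H \<Longrightarrow> g \<in> H \<Longrightarrow> cmod (F f g) \<le> C * nrm f * nrm g"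
  shows "bform C F"
proof -
  have "cmod (F f g) \<le> C * nrm g * nrm f" if "f \<in> H" "g \<in> H" for f g
    using assms(6)[OF that] by (simp only: mult_ac)
  then show ?thesis using assms unfolding bform_def blf_def by auto
qed

section \<open>Bounded operators on H\<close>

definition op_bound :: "real \<Rightarrow> ((complex \<Rightarrow> complex) \<Rightarrow> (complex \<Rightarrow> complex)) \<Rightarrow> bool" where
  "op_bound C A \<longleftrightarrow> 0 \<le> C \<and> A \<in> bounded_ops H \<and> (\<forall>f\<in>H. nrm (A f) \<le> C * nrm f)"

lemma bounded_opsD:
  assumes "A \<in> bounded_ops H"
  shows "f \<in> H \<Longrightarrow> A f \<in> H"
    "f \<in> H \<Longrightarrow> g \<in> H \<Longrightarrow> A (\<lambda>z. f z + g z) = (\<lambda>z. A f z + A g z)"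
    "f \<in> H \<Longrightarrow> A (\<lambda>z. c * f z) = (\<lambda>z. c * A f z)"
    "f \<notin> H \<Longrightarrow> A f = undefined"
  using assms by (auto simp: bounded_ops_def PiE_def extensional_def)

lemma bounded_ops_op_bound:
  assumes A: "A \<in> bounded_ops H"
  obtains C where "op_bound C A"
proof -
  obtain C where "\<forall>f\<in>H. nrm (A f) \<le> C * nrm f"
    using A by (auto simp: bounded_ops_def)
  then have "\<forall>f\<in>H. nrm (A f) \<le> max C 0 * nrm f"
    by (metis max.cobounded1 mult_right_mono nrm_nonneg order_trans)
  with A that[of "max C 0"] show ?thesis by (simp add: op_bound_def)
qed

lemma op_bound_bform:
  assumes "op_bound C A"
  shows "bform C (\<lambda>f g. ip (A f) g)"
proof (rule bformI)
  have A: "A \<in> bounded_ops H" using assms by (simp add: op_bound_def)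
  fix f g assume f: "f \<in> H" and g: "g \<in> H"
  have "cmod (ip (A f) g) \<le> nrm (A f) * nrm g"
    by (intro Cauchy_Schwarz bounded_opsD(1)[OF A] f g)
  also have "\<dots> \<le> C * nrm f * nrm g"
    using assms f by (intro mult_right_mono) (auto simp: op_bound_def)
  finally show "cmod (ip (A f) g) \<le> C * nrm f * nrm g" .
qed (use assms in \<open>auto simp: op_bound_def bounded_opsD ip_add ip_add' ip_scale_left ip_scale_right\<close>)

lemma adjoint:
  assumes A: "A \<in> bounded_ops H" and g: "g \<in> H"
  shows "\<exists>g'\<in>H. \<forall>f\<in>H. ip (A f) g = ip f g'"
proof -
  obtain C where "op_bound C A" using bounded_ops_op_bound[OF A] .
  from op_bound_bform[OF this] g have "blf (C * nrm g) (\<lambda>f. ip (A f) g)"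
    by (auto simp: bform_def)
  from riesz[OF this] show ?thesis .
qed

lemma bounded_opsI:
  assumes "\<And>f. f \<in> H \<Longrightarrow> A f \<in> H" "\<And>f. f \<notin> H \<Longrightarrow> A f = undefined"
    "\<And>f g. f \<in> H \<Longrightarrow> g \<in> H \<Longrightarrow> A (\<lambda>z. f z + g z) = (\<lambda>z. A f z + A g z)"
    "\<And>c f. f \<in> H \<Longrightarrow> A (\<lambda>z. c * f z) = (\<lambda>z. c * A f z)"
    "\<And>f. f \<in> H \<Longrightarrow> nrm (A f) \<le> C * nrm f"
  shows "A \<in> bounded_ops H"
  using assms by (auto simp: bounded_ops_def PiE_def extensional_def intro!: exI[of _ C])

lemma nrm_sum_le:
  assumes "\<And>i. i \<in> I \<Longrightarrow> f i \<in> H"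
  shows "nrm (\<lambda>z. \<Sum>i\<in>I. f i z) \<le> (\<Sum>i\<in>I. nrm (f i))"
  using assms
proof (induction I rule: infinite_finite_induct)
  case (insert i I)
  have "nrm (\<lambda>z. f i z + (\<Sum>i\<in>I. f i z)) \<le> nrm (f i) + nrm (\<lambda>z. \<Sum>i\<in>I. f i z)"
    using insert by (intro nrm_triangle L2 sum_mem) auto
  with insert show ?case by simp
qed auto

lemma lincomb_op_bound:
  assumes "\<And>i. i \<in> I \<Longrightarrow> op_bound (C i) (B i)"
  shows "op_bound (\<Sum>i\<in>I. cmod (c i) * C i) (\<lambda>f\<in>H. \<lambda>w. \<Sum>i\<in>I. c i * B i f w)"
proof -
  have B: "B i \<in> bounded_ops H" if "i \<in> I" for i using assms[OF that] by (simp add: op_bound_def)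
  have bd: "nrm (\<lambda>w. \<Sum>i\<in>I. c i * B i f w) \<le> (\<Sum>i\<in>I. cmod (c i) * C i) * nrm f" if f: "f \<in> H" for f
  proof -
    have "nrm (\<lambda>w. \<Sum>i\<in>I. c i * B i f w) \<le> (\<Sum>i\<in>I. nrm (\<lambda>w. c i * B i f w))"
      by (intro nrm_sum_le scale_mem bounded_opsD(1)[OF B] f)
    also have "\<dots> \<le> (\<Sum>i\<in>I. cmod (c i) * (C i * nrm f))"
      unfolding nrm_scale using assms f by (intro sum_mono mult_left_mono) (auto simp: op_bound_def)
    finally show ?thesis by (simp only: sum_distrib_right mult.assoc)
  qed
  have "(\<lambda>f\<in>H. \<lambda>w. \<Sum>i\<in>I. c i * B i f w) \<in> bounded_ops H"
  proof (rule bounded_opsI[where C = "\<Sum>i\<in>I. cmod (c i) * C i"])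
    fix f g assume "f \<in> H" "g \<in> H"
    then show "(\<lambda>f\<in>H. \<lambda>w. \<Sum>i\<in>I. c i * B i f w) (\<lambda>z. f z + g z)
        = (\<lambda>z. (\<lambda>f\<in>H. \<lambda>w. \<Sum>i\<in>I. c i * B i f w) f z + (\<lambda>f\<in>H. \<lambda>w. \<Sum>i\<in>I. c i * B i f w) g z)"
      by (auto simp: add_mem fun_eq_iff sum.distrib[symmetric] distrib_left[symmetric]
          bounded_opsD(2)[OF B] intro!: sum.cong)
  next
    fix a f assume "f \<in> H"
    then show "(\<lambda>f\<in>H. \<lambda>w. \<Sum>i\<in>I. c i * B i f w) (\<lambda>z. a * f z)
        = (\<lambda>z. a * (\<lambda>f\<in>H. \<lambda>w. \<Sum>i\<in>I. c i * B i f w) f z)"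
      by (auto simp: scale_mem fun_eq_iff sum_distrib_left mult_ac bounded_opsD(3)[OF B] intro!: sum.cong)
  qed (use bd in \<open>auto intro!: lincomb_mem bounded_opsD(1)[OF B]\<close>)
  then show ?thesis
    using bd assms by (auto simp: op_bound_def intro!: sum_nonneg mult_nonneg_nonneg)
qed

lemma ip_lincomb_op:
  assumes "\<And>i. i \<in> I \<Longrightarrow> B i \<in> bounded_ops H" "f \<in> H" "g \<in> H"
  shows "ip ((\<lambda>f\<in>H. \<lambda>w. \<Sum>i\<in>I. c i * B i f w) f) g = (\<Sum>i\<in>I. c i * ip (B i f) g)"
  using assms by (simp add: ip_lincomb bounded_opsD)

end

section \<open>Orthonormal bases, trace class operators and the weak-star topology\<close>

lemma nonneg_bounded_infsum:
  fixes f :: "'a \<Rightarrow> real"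
  assumes "\<And>x. x \<in> A \<Longrightarrow> 0 \<le> f x" "\<And>F. finite F \<Longrightarrow> F \<subseteq> A \<Longrightarrow> sum f F \<le> B"
  shows "f summable_on A" "infsum f A \<le> B"
proof -
  show s: "f summable_on A"
    using assms by (intro nonneg_bdd_above_summable_on bdd_aboveI2[where M = B]) auto
  show "infsum f A \<le> B"
    by (rule infsum_le_finite_sums[OF s]) (use assms in auto)
qed

text \<open>Positive semidefinite Hermitian forms; antilinearity in the second slot follows from the
  symmetry.\<close>

definition psd_form ::
  "(complex \<Rightarrow> complex) set \<Rightarrow> ((complex \<Rightarrow> complex) \<Rightarrow> (complex \<Rightarrow> complex) \<Rightarrow> complex) \<Rightarrow> bool" where
  "psd_form H s \<longleftrightarrow> (\<forall>f\<in>H. \<forall>g\<in>H. \<forall>h\<in>H. s (\<lambda>z. f z + g z) h = s f h + s g h) \<and>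
     (\<forall>c. \<forall>f\<in>H. \<forall>h\<in>H. s (\<lambda>z. c * f z) h = c * s f h) \<and>
     (\<forall>f\<in>H. \<forall>h\<in>H. s h f = cnj (s f h)) \<and> (\<forall>f\<in>H. 0 \<le> Re (s f f))"

lemma psd_formD:
  assumes "psd_form H s"
  shows "f \<in> H \<Longrightarrow> g \<in> H \<Longrightarrow> h \<in> H \<Longrightarrow> s (\<lambda>z. f z + g z) h = s f h + s g h"
    "f \<in> H \<Longrightarrow> h \<in> H \<Longrightarrow> s (\<lambda>z. c * f z) h = c * s f h"
    "f \<in> H \<Longrightarrow> h \<in> H \<Longrightarrow> s h f = cnj (s f h)"
    "f \<in> H \<Longrightarrow> 0 \<le> Re (s f f)"
  using assms unfolding psd_form_def by blast+

text \<open>\<open>ip (P (schur_op P u j f)) g\<close> is the form of P after elimination of u 0,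
  ..., u (j - 1), a Schur complement. A zero pivot leaves the vector unchanged, since division by 0
  is 0.\<close>

primrec schur_op ::
  "((complex \<Rightarrow> complex) \<Rightarrow> (complex \<Rightarrow> complex)) \<Rightarrow> (nat \<Rightarrow> complex \<Rightarrow> complex) \<Rightarrow> nat \<Rightarrow>
    (complex \<Rightarrow> complex) \<Rightarrow> complex \<Rightarrow> complex" where
  "schur_op P u 0 f = f"
| "schur_op P u (Suc j) f = (\<lambda>z. schur_op P u j f z -
     ip (P (schur_op P u j f)) (u j) / ip (P (schur_op P u j (u j))) (u j) * schur_op P u j (u j) z)"

context hilbert_basis
begin

lemma psd_form_cong:
  assumes s': "psd_form H s'" and eq: "\<And>f g. f \<in> H \<Longrightarrow> g \<in> H \<Longrightarrow> s f g = s' f g"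
  shows "psd_form H s"
  unfolding psd_form_def
proof (intro conjI ballI allI)
  fix f g h assume H: "f \<in> H" "g \<in> H" "h \<in> H"
  show "s (\<lambda>z. f z + g z) h = s f h + s g h"
    unfolding eq[OF add_mem[OF H(1,2)] H(3)] eq[OF H(1,3)] eq[OF H(2,3)] by (rule psd_formD(1)[OF s' H])
next
  fix c f h assume H: "f \<in> H" "h \<in> H"
  show "s (\<lambda>z. c * f z) h = c * s f h"
    unfolding eq[OF scale_mem[OF H(1)] H(2)] eq[OF H] by (rule psd_formD(2)[OF s' H])
next
  fix f h assume H: "f \<in> H" "h \<in> H"
  show "s h f = cnj (s f h)"
    unfolding eq[OF H] eq[OF H(2,1)] by (rule psd_formD(3)[OF s' H])
next
  fix f assume H: "f \<in> H"
  show "0 \<le> Re (s f f)" unfolding eq[OF H H] by (rule psd_formD(4)[OF s' H])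
qed

lemma psd_form_Cauchy_Schwarz:
  assumes s: "psd_form H s" and f: "f \<in> H" and g: "g \<in> H"
  shows "(cmod (s f g))\<^sup>2 \<le> Re (s f f) * Re (s g g)"
proof (rule discriminant_bound)
  have real: "s g g = complex_of_real (Re (s g g))"
  proof -
    have "s g g = cnj (s g g)" using s g unfolding psd_form_def by blast
    then show ?thesis by (simp add: complex_eq_iff)
  qed
  fix t :: real
  define c where "c = - (of_real t * s f g)"
  have cg: "(\<lambda>z. c * g z) \<in> H" and fcg: "(\<lambda>z. f z + c * g z) \<in> H"
    using f g by (auto intro: add_mem scale_mem)
  have l: "s (\<lambda>z. f z + c * g z) h = s f h + c * s g h" if "h \<in> H" for h
  proof -
    have "s (\<lambda>z. f z + c * g z) h = s f h + s (\<lambda>z. c * g z) h"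
      by (rule psd_formD(1)[OF s f cg that])
    also have "s (\<lambda>z. c * g z) h = c * s g h"
      by (rule psd_formD(2)[OF s g that])
    finally show ?thesis .
  qed
  have herm: "s h k = cnj (s k h)" if "h \<in> H" "k \<in> H" for h k
    using psd_formD[OF s] that by blast
  have eq: "s (\<lambda>z. f z + c * g z) (\<lambda>z. f z + c * g z) = s f f + cnj c * s f g + c * cnj (s f g) + c * cnj c * s g g"
    unfolding l[OF fcg] herm[OF f fcg] herm[OF g fcg] l[OF f] l[OF g]
    by (simp add: herm[OF f f, symmetric] herm[OF g g, symmetric] herm[OF f g, symmetric] algebra_simps)
  have "Re (s f f + cnj c * s f g + c * cnj (s f g) + c * cnj c * s g g)
      = Re (s f f) - 2 * t * (cmod (s f g))\<^sup>2 + t\<^sup>2 * (cmod (s f g))\<^sup>2 * Re (s g g)"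
    by (subst real) (unfold c_def cmod_power2, simp add: power2_eq_square algebra_simps)
  moreover have "0 \<le> Re (s (\<lambda>z. f z + c * g z) (\<lambda>z. f z + c * g z))"
    by (rule psd_formD(4)[OF s fcg])
  ultimately show "0 \<le> Re (s f f) - 2 * t * (cmod (s f g))\<^sup>2 + t\<^sup>2 * (cmod (s f g))\<^sup>2 * Re (s g g)"
    unfolding eq by linarith
qed (use psd_formD(4)[OF s g] in auto)

text \<open>The Schur complement with respect to u stays semidefinite by Cauchy-Schwarz, kills u,
  and keeps what was killed before. If s u u = 0, Cauchy-Schwarz already gives s u g = 0 and the
  quotient is 0.\<close>

lemma psd_form_step:
  assumes s: "psd_form H s" and u: "u \<in> H"
  defines "s' \<equiv> \<lambda>f g. s f g - s f u / s u u * s u g"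
  shows "psd_form H s'" "g \<in> H \<Longrightarrow> s' u g = 0"
    "v \<in> H \<Longrightarrow> (\<And>g. g \<in> H \<Longrightarrow> s v g = 0) \<Longrightarrow> g \<in> H \<Longrightarrow> s' v g = 0"
proof -
  have herm: "s h k = cnj (s k h)" if "h \<in> H" "k \<in> H" for h k
    using psd_formD[OF s] that by blast
  have real: "s f f = complex_of_real (Re (s f f))" if "f \<in> H" for f
    using herm[OF that that] by (simp add: complex_eq_iff)
  have nonneg: "0 \<le> Re (s f f)" if "f \<in> H" for f
    using psd_formD[OF s] that by blast
  show "g \<in> H \<Longrightarrow> s' u g = 0"
  proof -
    assume g: "g \<in> H"
    show "s' u g = 0"
    proof (cases "s u u = 0")
      case True
      then have "(cmod (s u g))\<^sup>2 \<le> 0" using psd_form_Cauchy_Schwarz[OF s u g] by simp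
      then show ?thesis by (simp add: s'_def True)
    qed (simp add: s'_def)
  qed
  show "v \<in> H \<Longrightarrow> (\<And>g. g \<in> H \<Longrightarrow> s v g = 0) \<Longrightarrow> g \<in> H \<Longrightarrow> s' v g = 0"
    using u by (simp add: s'_def)
  show "psd_form H s'"
    unfolding psd_form_def
  proof (intro conjI ballI allI)
    fix f g h assume "f \<in> H" "g \<in> H" "h \<in> H"
    then have "s (\<lambda>z. f z + g z) k = s f k + s g k" if "k \<in> H" for k
      using psd_formD[OF s] that by blast
    with u \<open>h \<in> H\<close> show "s' (\<lambda>z. f z + g z) h = s' f h + s' g h"
      by (simp add: s'_def add_divide_distrib algebra_simps)
  next
    fix c f h assume "f \<in> H" "h \<in> H"
    then have "s (\<lambda>z. c * f z) k = c * s f k" if "k \<in> H" for k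
      using psd_formD[OF s] that by blast
    with u \<open>h \<in> H\<close> show "s' (\<lambda>z. c * f z) h = c * s' f h"
      by (simp add: s'_def algebra_simps)
  next
    fix f h assume "f \<in> H" "h \<in> H"
    then show "s' h f = cnj (s' f h)"
      unfolding s'_def using herm[of h f] herm[of h u] herm[of u f] herm[OF u u] u
      by simp
  next
    fix f assume f: "f \<in> H"
    have "s f u / s u u * s u f = complex_of_real ((cmod (s f u))\<^sup>2 / Re (s u u))"
      unfolding herm[OF u f] by (subst (1) real[OF u]) (simp add: complex_norm_square del: of_real_power)
    then have "Re (s' f f) = Re (s f f) - (cmod (s f u))\<^sup>2 / Re (s u u)"
      unfolding s'_def by simp
    moreover have "(cmod (s f u))\<^sup>2 / Re (s u u) \<le> Re (s f f)"
      using psd_form_Cauchy_Schwarz[OF s f u] nonneg[OF u] nonneg[OF f]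
      by (cases "Re (s u u) = 0") (auto simp: divide_le_eq)
    ultimately show "0 \<le> Re (s' f f)" by simp
  qed
qed

lemma is_onb_basis: "is_onb H (range e)"
proof -
  have "e m = e n \<Longrightarrow> m = n" for m n
    using basis_orthonormal[of m n] basis_orthonormal[of m m] by (auto split: if_splits)
  then show ?thesis
    unfolding is_onb_def using basis_mem basis_orthonormal basis_total by (auto split: if_splits)
qed

section \<open>Arbitrary orthonormal bases and the trace\<close>

context
  fixes E assumes E: "is_onb H E"
begin

lemma onb_mem: "u \<in> E \<Longrightarrow> u \<in> H"
  and onb_orth: "u \<in> E \<Longrightarrow> v \<in> E \<Longrightarrow> ip u v = (if u = v then 1 else 0)"
  and onb_total: "f \<in> H \<Longrightarrow> (\<And>u. u \<in> E \<Longrightarrow> ip f u = 0) \<Longrightarrow> f = (\<lambda>z. 0)"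
  using E unfolding is_onb_def by blast+

lemma bessel_finite:
  assumes f: "f \<in> H" and F: "finite F" "F \<subseteq> E"
  shows "(\<Sum>u\<in>F. (cmod (ip f u))\<^sup>2) \<le> (nrm f)\<^sup>2"
proof -
  define x where "x = (\<lambda>z. \<Sum>u\<in>F. ip f u * u z)"
  have x: "x \<in> H" unfolding x_def using lincomb_mem[of F "\<lambda>u. u" "\<lambda>u. ip f u"] onb_mem F by blast
  have ipx: "ip x h = (\<Sum>u\<in>F. ip f u * ip u h)" if "h \<in> H" for h
    unfolding x_def using ip_lincomb[of F "\<lambda>u. u" h "\<lambda>u. ip f u"] onb_mem F that by blast
  have "ip x u = ip f u" if "u \<in> F" for u
  proof -
    have "ip x u = (\<Sum>v\<in>F. if v = u then ip f v else 0)"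
    proof -
      have uH: "u \<in> H" using onb_mem F that by blast
      show ?thesis unfolding ipx[OF uH] using onb_orth F that by (intro sum.cong) (auto simp: subset_iff)
    qed
    then show ?thesis using F that by simp
  qed
  then have xu: "ip u x = cnj (ip f u)" if "u \<in> F" for u unfolding ip_cnj[of u x] using that by simp
  have eq: "(\<Sum>u\<in>F. ip f u * cnj (ip f u)) = complex_of_real (\<Sum>u\<in>F. (cmod (ip f u))\<^sup>2)"
    by (simp only: complex_norm_square of_real_sum)
  have "ip x x = complex_of_real (\<Sum>u\<in>F. (cmod (ip f u))\<^sup>2)"
    unfolding ipx[OF x] eq[symmetric] by (intro sum.cong) (simp_all add: xu)
  then have nx: "(nrm x)\<^sup>2 = (\<Sum>u\<in>F. (cmod (ip f u))\<^sup>2)"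
    unfolding ip_self by (simp only: of_real_eq_iff)
  have "ip x f = complex_of_real (\<Sum>u\<in>F. (cmod (ip f u))\<^sup>2)"
    unfolding ipx[OF f] eq[symmetric] by (intro sum.cong) (simp_all add: ip_cnj[of _ f])
  then have "cmod (ip x f) = (nrm x)\<^sup>2" unfolding nx by (simp only: norm_of_real) (simp add: sum_nonneg)
  then have "nrm x * nrm x \<le> nrm x * nrm f"
    using Cauchy_Schwarz[OF x f] by (simp add: power2_eq_square)
  then have "nrm x \<le> nrm f"
    using nrm_nonneg[of x] by (cases "nrm x = 0") (auto simp: mult_le_cancel_left)
  then show ?thesis unfolding nx[symmetric] by (intro power_mono) auto
qed

lemma bessel: "f \<in> H \<Longrightarrow> (\<lambda>u. (cmod (ip f u))\<^sup>2) summable_on E"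
  by (rule nonneg_bounded_infsum[OF _ bessel_finite]) auto

lemma onb_product_summable:
  assumes f: "f \<in> H" and g: "g \<in> H"
  shows "(\<lambda>u. norm (ip f u * ip u g)) summable_on E" "(\<Sum>\<^sub>\<infinity>u\<in>E. cmod (ip f u * ip u g)) \<le> nrm f * nrm g"
proof -
  have bd: "(\<Sum>u\<in>F. cmod (ip f u * ip u g)) \<le> nrm f * nrm g" if F: "finite F" "F \<subseteq> E" for F
  proof -
    have "(\<Sum>u\<in>F. cmod (ip f u * ip u g)) = (\<Sum>u\<in>F. \<bar>cmod (ip f u)\<bar> * \<bar>cmod (ip g u)\<bar>)"
      by (intro sum.cong refl) (simp add: norm_mult ip_cnj[of _ g])
    also have "\<dots> \<le> L2_set (\<lambda>u. cmod (ip f u)) F * L2_set (\<lambda>u. cmod (ip g u)) F"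
      by (rule L2_set_mult_ineq)
    also have "\<dots> \<le> nrm f * nrm g"
      unfolding L2_set_def using bessel_finite[OF f F] bessel_finite[OF g F]
      by (intro mult_mono real_le_lsqrt) (auto intro!: sum_nonneg real_sqrt_ge_zero)
    finally show ?thesis .
  qed
  show "(\<lambda>u. norm (ip f u * ip u g)) summable_on E" "(\<Sum>\<^sub>\<infinity>u\<in>E. cmod (ip f u * ip u g)) \<le> nrm f * nrm g"
    by (rule nonneg_bounded_infsum[OF _ bd], simp_all)+
qed

text \<open>The sum over E is a bounded functional of f. Its Riesz vector has the same products with
  E as g, so it is g by totality.\<close>

lemma onb_parseval:
  assumes f: "f \<in> H" and g: "g \<in> H"
  shows "((\<lambda>u. ip f u * ip u g) has_sum ip f g) E"
proof -
  define L where "L f = (\<Sum>\<^sub>\<infinity>u\<in>E. ip f u * ip u g)" for f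
  have sm: "(\<lambda>u. ip f u * ip u g) summable_on E" if "f \<in> H" for f
    using onb_product_summable(1)[OF that g] by (rule abs_summable_summable)
  have "blf (nrm g) L"
    unfolding blf_def
  proof (intro conjI ballI allI)
    fix f h assume fh: "f \<in> H" "h \<in> H"
    have "L (\<lambda>z. f z + h z) = (\<Sum>\<^sub>\<infinity>u\<in>E. ip f u * ip u g + ip h u * ip u g)"
      unfolding L_def using fh onb_mem by (intro infsum_cong) (simp add: ip_add distrib_right)
    then show "L (\<lambda>z. f z + h z) = L f + L h"
      unfolding L_def using fh by (simp add: infsum_add sm)
  next
    fix c f assume f: "f \<in> H"
    show "L (\<lambda>z. c * f z) = c * L f"
      unfolding L_def ip_scale_left mult.assoc using sm[OF f] by (rule infsum_cmult_right)
  next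
    fix f assume f: "f \<in> H"
    have "cmod (L f) \<le> (\<Sum>\<^sub>\<infinity>u\<in>E. cmod (ip f u * ip u g))"
      unfolding L_def by (rule norm_infsum_bound[OF onb_product_summable(1)[OF f g]])
    also have "\<dots> \<le> nrm g * nrm f" using onb_product_summable(2)[OF f g] by (simp add: mult.commute)
    finally show "cmod (L f) \<le> nrm g * nrm f" .
  qed
  from riesz[OF this] obtain g' where g': "g' \<in> H" "\<And>f. f \<in> H \<Longrightarrow> L f = ip f g'" by blast
  have "ip (\<lambda>z. g' z - g z) u = 0" if u: "u \<in> E" for u
  proof -
    have "L u = (\<Sum>\<^sub>\<infinity>v\<in>{u}. ip u v * ip v g)"
      unfolding L_def using u onb_orth by (intro infsum_cong_neutral) auto
    then have "ip u g' = ip u g" using g'(2)[OF onb_mem[OF u]] onb_orth[OF u u] by simp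
    then have "ip g' u = ip g u" using ip_cnj[of g' u] ip_cnj[of g u] by simp
    then show ?thesis using g'(1) g onb_mem[OF u] by (simp add: ip_diff)
  qed
  then have "(\<lambda>z. g' z - g z) = (\<lambda>z. 0)"
    using g' g by (intro onb_total diff_mem) auto
  then have "g' = g" by (simp add: fun_eq_iff)
  then have "L f = ip f g" using g'(2)[OF f] by simp
  then show ?thesis using has_sum_infsum[OF sm[OF f]] unfolding L_def by simp
qed

lemma onb_nrm_has_sum:
  assumes f: "f \<in> H"
  shows "((\<lambda>u. (cmod (ip f u))\<^sup>2) has_sum (nrm f)\<^sup>2) E"
proof -
  have eq: "ip f u * ip u f = complex_of_real ((cmod (ip f u))\<^sup>2)" for u
    unfolding complex_norm_square ip_cnj[of u f] ..
  have "((\<lambda>u. complex_of_real ((cmod (ip f u))\<^sup>2)) has_sum complex_of_real ((nrm f)\<^sup>2)) E"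
    using onb_parseval[OF f f] unfolding eq ip_self .
  from has_sum_Re[OF this] show ?thesis by simp
qed

text \<open>Every element of E has a nonzero product with some e n, and each e n has a nonzero
  product with only countably many. \<open>trace_class_nuclear\<close> relies on this to enumerate
  E.\<close>

lemma onb_countable: "countable E"
proof -
  have "countable {u \<in> E. (cmod (ip (e n) u))\<^sup>2 \<noteq> 0}" for n
    by (rule summable_countable_real[OF bessel[OF basis_mem]])
  then have "countable (\<Union>n. {u \<in> E. (cmod (ip (e n) u))\<^sup>2 \<noteq> 0})" by blast
  moreover have "E \<subseteq> (\<Union>n. {u \<in> E. (cmod (ip (e n) u))\<^sup>2 \<noteq> 0})"
  proof
    fix u assume u: "u \<in> E"
    show "u \<in> (\<Union>n. {u \<in> E. (cmod (ip (e n) u))\<^sup>2 \<noteq> 0})"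
    proof (rule ccontr)
      assume "\<not> ?thesis"
      then have "ip u (e n) = 0" for n using u ip_cnj[of u "e n"] by auto
      then have "u = (\<lambda>z. 0)" using onb_mem[OF u] by (intro basis_total)
      then show False using onb_orth[OF u u] by simp
    qed
  qed
  ultimately show ?thesis using countable_subset by blast
qed

lemma onb_nonempty: "E \<noteq> {}"
  using onb_total[OF basis_mem[of 0]] basis_orthonormal[of 0 0] by force

text \<open>Absolute summability over the pairs (j, u) allows the sums to be interchanged, and the
  inner sum over E is Parseval. The value does not mention E, which is the independence of the trace
  from the basis.\<close>

lemma onb_trace_nuclear:
  assumes w: "\<And>j. w j \<in> H" and v: "\<And>j. v j \<in> H" and sm: "summable (\<lambda>j. nrm (w j) * nrm (v j))"
    and A: "\<And>f. f \<in> H \<Longrightarrow> ip (A f) f = (\<Sum>j. ip f (v j) * ip (w j) f)"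
  shows "(\<Sum>\<^sub>\<infinity>u\<in>E. ip (A u) u) = (\<Sum>j. ip (w j) (v j))"
proof -
  define t where "t = (\<lambda>(j, u). ip (w j) u * ip u (v j))"
  have "(\<lambda>p. norm (t p)) summable_on UNIV \<times> E"
  proof (subst Infinite_Sum.abs_summable_on_Sigma_iff, intro conjI ballI)
    show "(\<lambda>u. norm (t (j, u))) summable_on E" for j
      unfolding t_def by (simp add: onb_product_summable w v)
    have "norm (\<Sum>\<^sub>\<infinity>u\<in>E. norm (t (j, u))) \<le> nrm (w j) * nrm (v j)" for j
      unfolding t_def using onb_product_summable(2)[OF w v, of j j] by (simp add: infsum_nonneg)
    then have "summable (\<lambda>j. norm (\<Sum>\<^sub>\<infinity>u\<in>E. norm (t (j, u))))"
      by (intro summable_comparison_test'[OF sm, where N = 0]) simp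
    then show "(\<lambda>j. norm (\<Sum>\<^sub>\<infinity>u\<in>E. norm (t (j, u)))) summable_on UNIV"
      by (intro norm_summable_imp_summable_on) simp
  qed
  then have ts: "t summable_on UNIV \<times> E" by (rule abs_summable_summable)
  have suminf_eq: "suminf g = infsum g UNIV" if "summable (\<lambda>j. norm (g j))" for g :: "nat \<Rightarrow> complex"
    using norm_summable_imp_has_sum[OF that summable_sums[OF summable_norm_cancel[OF that]]] infsumI by metis
  have "(\<Sum>\<^sub>\<infinity>u\<in>E. ip (A u) u) = (\<Sum>\<^sub>\<infinity>u\<in>E. \<Sum>\<^sub>\<infinity>j. t (j, u))"
  proof (rule infsum_cong)
    fix u assume u: "u \<in> E"
    have "summable (\<lambda>j. norm (ip u (v j) * ip (w j) u))"
    proof (rule summable_comparison_test'[where N = 0])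
      show "summable (\<lambda>j. nrm (w j) * nrm (v j) * (nrm u * nrm u))" by (intro summable_mult2 sm)
      show "norm (norm (ip u (v j) * ip (w j) u)) \<le> nrm (w j) * nrm (v j) * (nrm u * nrm u)" for j
        using mult_mono[OF Cauchy_Schwarz[OF w onb_mem[OF u], of j] Cauchy_Schwarz[OF onb_mem[OF u] v, of j]]
        by (simp add: norm_mult mult_ac)
    qed
    from suminf_eq[OF this] show "ip (A u) u = (\<Sum>\<^sub>\<infinity>j. t (j, u))"
      using A[OF onb_mem[OF u]] by (simp add: t_def mult.commute)
  qed
  also have "\<dots> = (\<Sum>\<^sub>\<infinity>j. \<Sum>\<^sub>\<infinity>u\<in>E. t (j, u))"
    by (rule infsum_swap_banach[symmetric]) (use ts in simp)
  also have "(\<lambda>j. \<Sum>\<^sub>\<infinity>u\<in>E. t (j, u)) = (\<lambda>j. ip (w j) (v j))"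
    using infsumI[OF onb_parseval[OF w v]] by (simp add: t_def)
  also have "(\<Sum>\<^sub>\<infinity>j. ip (w j) (v j)) = (\<Sum>j. ip (w j) (v j))"
  proof (rule suminf_eq[symmetric], rule summable_comparison_test'[OF sm, where N = 0])
    show "norm (norm (ip (w j) (v j))) \<le> nrm (w j) * nrm (v j)" for j
      using Cauchy_Schwarz[OF w v] by simp
  qed
  finally show ?thesis .
qed

end

lemma op_trace_nuclear:
  assumes "\<And>j. w j \<in> H" "\<And>j. v j \<in> H" "summable (\<lambda>j. nrm (w j) * nrm (v j))"
    and "\<And>f. f \<in> H \<Longrightarrow> ip (A f) f = (\<Sum>j. ip f (v j) * ip (w j) f)"
  shows "op_trace H A = (\<Sum>j. ip (w j) (v j))"
proof -
  have "is_onb H (SOME E. is_onb H E)" using is_onb_basis by (rule someI)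
  from onb_trace_nuclear[OF this assms] show ?thesis unfolding op_trace_def .
qed

lemma op_trace_rank_one:
  assumes w: "w \<in> H" and v: "v \<in> H" and A: "\<And>f. f \<in> H \<Longrightarrow> ip (A f) f = ip f v * ip w f"
  shows "op_trace H A = ip w v"
proof -
  have z: "(\<Sum>j. if j = (0::nat) then c else 0) = c" "summable (\<lambda>j. if j = (0::nat) then c else 0)" for c :: "'a :: real_normed_vector"
    using sums_single[of 0 "\<lambda>_. c"] by (simp_all add: sums_iff)
  let ?w = "\<lambda>j. if j = (0::nat) then w else (\<lambda>z. 0)" and ?v = "\<lambda>j. if j = (0::nat) then v else (\<lambda>z. 0)"
  have ifs: "ip f (?v j) * ip (?w j) g = (if j = 0 then ip f v * ip w g else 0)"
    "ip (?w j) (?v j) = (if j = 0 then ip w v else 0)" "nrm (?w j) * nrm (?v j) = (if j = 0 then nrm w * nrm v else 0)" for f g j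
    by auto
  have "op_trace H A = (\<Sum>j. ip (?w j) (?v j))"
    by (rule op_trace_nuclear) (unfold ifs z, use w v zero_mem A z in auto)
  then show ?thesis unfolding ifs z .
qed

text \<open>Instead of the spectral theorem, Cholesky elimination of the positive form of \<open>\<bar>T\<bar> = P\<close> along
  the basis \<open>u\<close>: step \<open>j\<close> subtracts the rank one form of \<open>v j = P (x j)\<close>, and since
  \<open>nrm (T f) = nrm (P f)\<close> the vectors \<open>w j = T (x j)\<close> have the norms of the \<open>v j\<close>, whose
  squares add up to at most the trace of \<open>P\<close>. If a pivot \<open>q j\<close> vanishes then \<open>x j = 0\<close>, as \<open>1 / 0 = 0\<close>.\<close>

lemma trace_class_nuclear:
  assumes T: "T \<in> trace_class H"
  shows "\<exists>w v. (\<forall>j. w j \<in> H) \<and> (\<forall>j. v j \<in> H) \<and> summable (\<lambda>j. nrm (w j) * nrm (v j)) \<and>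
    (\<forall>f\<in>H. \<forall>g\<in>H. ip (T f) g = (\<Sum>j::nat. ip f (v j) * ip (w j) g))"
proof -
  from T obtain P E where TB: "T \<in> bounded_ops H" and abs: "is_abs_op H T P" and E: "is_onb H E"
    and sm: "(\<lambda>e. ip (P e) e) summable_on E"
    unfolding trace_class_def by blast
  have PB: "P \<in> bounded_ops H" using abs by (simp add: is_abs_op_def)
  note P = bounded_opsD[OF PB] and T = bounded_opsD[OF TB]
  have Ppos: "ip (P f) f \<in> \<real>" "0 \<le> Re (ip (P f) f)" if "f \<in> H" for f
    using abs that by (auto simp: is_abs_op_def)
  have PT: "ip (P (P f)) g = ip (T f) (T g)" if "f \<in> H" "g \<in> H" for f g
    using abs that by (auto simp: is_abs_op_def)
  \<comment> \<open>Polarization: the quadratic form of P is real, and the choices c = 1 and c =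
    \<i> determine both parts of ip (P h) f.\<close>
  have Pself: "ip (P h) f = cnj (ip (P f) h)" if f: "f \<in> H" and h: "h \<in> H" for f h
  proof -
    have Im0: "Im (ip (P k) k) = 0" if "k \<in> H" for k
      using Ppos(1)[OF that] by (simp add: complex_is_Real_iff)
    have e1: "ip (P (\<lambda>z. f z + c * h z)) (\<lambda>z. f z + c * h z)
        = ip (P f) f + cnj c * ip (P f) h + c * ip (P h) f + c * cnj c * ip (P h) h" for c
      using f h by (simp add: P scale_mem add_mem ip_add ip_add' ip_scale_left ip_scale_right algebra_simps)
    have "Im (ip (P f) f + cnj c * ip (P f) h + c * ip (P h) f + c * cnj c * ip (P h) h) = 0" for c
      unfolding e1[symmetric] by (intro Im0 add_mem scale_mem f h)
    from this[of 1] this[of \<i>] show ?thesis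
      using Im0[OF f] Im0[OF h] by (simp add: complex_eq_iff)
  qed
  have nPT: "nrm (T f) = nrm (P f)" if f: "f \<in> H" for f
  proof -
    have "ip (P (P f)) f = cnj (ip (P f) (P f))" using Pself[OF f P(1)[OF f]] .
    then have "ip (T f) (T f) = ip (P f) (P f)" using PT[OF f f] by (simp add: ip_self)
    then have "(nrm (T f))\<^sup>2 = (nrm (P f))\<^sup>2" unfolding ip_self by (simp only: of_real_eq_iff)
    then show ?thesis by (simp add: power2_eq_iff_nonneg)
  qed
  \<comment> \<open>If the enumeration repeats a vector, the later occurrence has pivot 0 and
    contributes nothing.\<close>
  define u where "u = from_nat_into E"
  have uE: "range u = E" unfolding u_def using onb_nonempty[OF E] onb_countable[OF E] by (rule range_from_nat_into)
  have u: "u n \<in> H" for n using onb_mem[OF E] uE by blast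
  define G where "G = schur_op P u"
  define s where "s j f g = ip (P (G j f)) g" for j f g
  have G0: "G 0 f = f" for f by (simp add: G_def)
  have GS: "G (Suc j) f = (\<lambda>z. G j f z - s j f (u j) / s j (u j) (u j) * G j (u j) z)" for j f
    by (simp add: G_def s_def)
  have GH: "G j f \<in> H" if "f \<in> H" for j f
    using that
  proof (induction j arbitrary: f)
    case (Suc j)
    then show ?case unfolding GS using Suc.IH[OF u] by (intro diff_mem scale_mem) auto
  qed (simp add: G0)
  have sS: "s (Suc j) f g = s j f g - s j f (u j) / s j (u j) (u j) * s j (u j) g" if f: "f \<in> H" and g: "g \<in> H" for j f g
  proof -
    define c where "c = - (s j f (u j) / s j (u j) (u j))"
    have "P (G (Suc j) f) = (\<lambda>z. P (G j f) z + c * P (G j (u j)) z)"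
    proof -
      have "G (Suc j) f = (\<lambda>z. G j f z + c * G j (u j) z)" by (simp add: GS c_def)
      then show ?thesis using P(2)[OF GH[OF f] scale_mem[OF GH[OF u]]] P(3)[OF GH[OF u]] by simp
    qed
    then show ?thesis
      unfolding s_def[of "Suc j"] using P(1)[OF GH[OF f]] P(1)[OF GH[OF u]] g
      by (simp add: ip_add scale_mem ip_scale_left) (simp add: s_def c_def)
  qed
  have psd: "psd_form H (s j)" for j
  proof (induction j)
    case 0
    show ?case
      unfolding psd_form_def s_def G0
      by (intro conjI ballI allI Ppos(2) Pself) (simp_all add: P ip_add ip_scale_left)
  next
    case (Suc j)
    show ?case by (rule psd_form_cong[OF psd_form_step(1)[OF Suc u[of j]] sS])
  qed
  \<comment> \<open>After step i the vector u i lies in the kernel of the remaining form, and it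
    stays there.\<close>
  have kill: "s j (u i) g = 0" if "i < j" "g \<in> H" for i j g
    using that
  proof (induction j arbitrary: g)
    case (Suc j)
    show ?case
    proof (cases "i = j")
      case True
      show ?thesis unfolding True sS[OF u Suc.prems(2)] by (rule psd_form_step(2)[OF psd u Suc.prems(2)])
    next
      case False
      then have "s j (u i) g = 0" if "g \<in> H" for g using Suc that by simp
      then show ?thesis unfolding sS[OF u Suc.prems(2)] by (rule psd_form_step(3)[OF psd u u _ Suc.prems(2)])
    qed
  qed simp
  define q where "q j = Re (s j (u j) (u j))" for j
  have herm: "s j h k = cnj (s j k h)" if "h \<in> H" "k \<in> H" for j h k
    by (rule psd_formD(3)[OF psd that(2,1)])
  have q: "0 \<le> q j" "s j (u j) (u j) = complex_of_real (q j)" for j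
    using psd_formD(4)[OF psd u, of j] arg_cong[OF herm[OF u[of j] u[of j], of j], of Im]
    by (simp_all add: q_def complex_eq_iff)
  define x where "x j = (\<lambda>z. complex_of_real (1 / sqrt (q j)) * G j (u j) z)" for j
  define v where "v j = P (x j)" for j
  define w where "w j = T (x j)" for j
  have x: "x j \<in> H" for j unfolding x_def by (intro scale_mem GH u)
  have v: "v j \<in> H" and w: "w j \<in> H" for j unfolding v_def w_def by (intro P T x)+
  have ipv: "ip (v j) g = complex_of_real (1 / sqrt (q j)) * s j (u j) g" for j g
    unfolding v_def x_def P(3)[OF GH[OF u]] ip_scale_left s_def ..
  have ipv': "ip g (v j) = complex_of_real (1 / sqrt (q j)) * s j g (u j)" if "g \<in> H" for j g
    unfolding ip_cnj[of g "v j"] ipv using herm[OF that u] by simp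
  have qq: "complex_of_real (1 / sqrt (q j)) * complex_of_real (1 / sqrt (q j)) = 1 / s j (u j) (u j)" for j
    unfolding q(2) of_real_mult[symmetric] using q(1)[of j] by (simp add: real_sqrt_mult_self)
  have s_step: "s j f g - s (Suc j) f g = ip f (v j) * ip (v j) g" if "f \<in> H" "g \<in> H" for j f g
  proof -
    have "ip f (v j) * ip (v j) g = (complex_of_real (1 / sqrt (q j)) * complex_of_real (1 / sqrt (q j))) * (s j f (u j) * s j (u j) g)"
      unfolding ipv ipv'[OF that(1)] by (simp only: mult_ac)
    then show ?thesis unfolding qq sS[OF that] by simp
  qed
  have G_step: "G (Suc j) f = (\<lambda>z. G j f z - ip f (v j) * x j z)" if "f \<in> H" for j f
  proof -
    have "ip f (v j) * x j z = (complex_of_real (1 / sqrt (q j)) * complex_of_real (1 / sqrt (q j))) * (s j f (u j) * G j (u j) z)" for z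
      unfolding x_def ipv'[OF that] by (simp only: mult_ac)
    then show ?thesis unfolding qq GS by simp
  qed
  have G_sum: "G J f = (\<lambda>z. f z - (\<Sum>j<J. ip f (v j) * x j z))" if "f \<in> H" for J f
    by (induction J) (simp_all add: G0 G_step[OF that] algebra_simps del: lessThan_Suc)
  have sum_v: "(\<Sum>j<J. (cmod (ip (v j) f))\<^sup>2) \<le> Re (ip (P f) f)" if f: "f \<in> H" for J f
  proof -
    have "complex_of_real (\<Sum>j<J. (cmod (ip (v j) f))\<^sup>2) = (\<Sum>j<J. ip f (v j) * ip (v j) f)"
      unfolding of_real_sum complex_norm_square ip_cnj[of f "v _"] by (simp only: mult.commute)
    also have "\<dots> = (\<Sum>j<J. s j f f - s (Suc j) f f)" by (simp only: s_step[OF f f])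
    also have "\<dots> = s 0 f f - s J f f" by (induction J) simp_all
    finally have "(\<Sum>j<J. (cmod (ip (v j) f))\<^sup>2) = Re (s 0 f f) - Re (s J f f)"
      by (metis Re_complex_of_real minus_complex.simps(1))
    moreover have "0 \<le> Re (s J f f)" by (rule psd_formD(4)[OF psd f])
    ultimately show ?thesis by (simp add: s_def G0)
  qed
  define B where "B = (\<Sum>\<^sub>\<infinity>u\<in>E. Re (ip (P u) u))"
  have smRe: "(\<lambda>u. Re (ip (P u) u)) summable_on E" by (rule summable_on_Re[OF sm])
  have "(\<Sum>j<J. (nrm (v j))\<^sup>2) \<le> B" for J
  proof -
    have "((\<lambda>u. \<Sum>j<J. (cmod (ip (v j) u))\<^sup>2) has_sum (\<Sum>j<J. (nrm (v j))\<^sup>2)) E"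
    proof (induction J)
      case (Suc J)
      show ?case using has_sum_add[OF Suc onb_nrm_has_sum[OF E v]] by simp
    qed simp
    then show ?thesis
      unfolding B_def by (rule has_sum_mono[OF _ has_sum_infsum[OF smRe]]) (auto intro!: sum_v onb_mem[OF E])
  qed
  then have "summable (\<lambda>j. (nrm (v j))\<^sup>2)"
    by (intro summableI_nonneg_bounded[where x = B]) auto
  moreover have "nrm (w j) = nrm (v j)" for j unfolding w_def v_def by (rule nPT[OF x])
  ultimately have sum_wv: "summable (\<lambda>j. nrm (w j) * nrm (v j))" by (simp add: power2_eq_square)
  \<comment> \<open>At u n the elimination stops: P, and with it T, vanishes on G (Suc n) (u n),
    which by \<open>G_sum\<close> is u n minus a finite combination of the x j. Terms with j > n are
    zero by \<open>kill\<close>.\<close>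
  have Tu: "ip (T (u n)) g = (\<Sum>j. ip (u n) (v j) * ip (w j) g)" if g: "g \<in> H" for n g
  proof -
    have "P (G (Suc n) (u n)) = (\<lambda>z. 0)"
      using kill[of n "Suc n"] by (intro basis_total P GH u) (simp add: s_def basis_mem)
    then have "nrm (T (G (Suc n) (u n))) = 0" using nPT[OF GH[OF u]] by simp
    then have T0: "T (G (Suc n) (u n)) = (\<lambda>z. 0)" by (intro nrm_eq_0 T GH u)
    obtain C where C: "op_bound C T" using bounded_ops_op_bound[OF TB] .
    have b: "blf (C * nrm g) (\<lambda>f. ip (T f) g)" using op_bound_bform[OF C] g by (auto simp: bform_def)
    have "0 = ip (T (u n)) g - ip (T (\<lambda>z. \<Sum>j<Suc n. ip (u n) (v j) * x j z)) g"
      using T0 unfolding G_sum[OF u]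
      by (subst blf_diff[OF b u lincomb_mem[OF x], symmetric]) (simp only: ip_zero_left)
    also have "ip (T (\<lambda>z. \<Sum>j<Suc n. ip (u n) (v j) * x j z)) g = (\<Sum>j<Suc n. ip (u n) (v j) * ip (w j) g)"
      unfolding w_def by (rule blf_lincomb[OF b x])
    also have "\<dots> = (\<Sum>j. ip (u n) (v j) * ip (w j) g)"
    proof (rule suminf_finite[symmetric])
      fix j assume "j \<notin> {..<Suc n}"
      then have "s j (u n) (u j) = 0" by (intro kill u) auto
      then show "ip (u n) (v j) * ip (w j) g = 0" by (simp add: ipv'[OF u])
    qed simp
    finally show ?thesis by simp
  qed
  \<comment> \<open>Both sides are bounded functionals of f; their Riesz vectors a and b agree on
    E.\<close>
  have "ip (T f) g = (\<Sum>j. ip f (v j) * ip (w j) g)" if f: "f \<in> H" and g: "g \<in> H" for f g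
  proof -
    define L where "L f = (\<Sum>j. ip f (v j) * ip (w j) g)" for f
    have smf: "summable (\<lambda>j. norm (ip f (v j) * ip (w j) g))"
      and bdf: "(\<Sum>j. norm (ip f (v j) * ip (w j) g)) \<le> (\<Sum>j. nrm (w j) * nrm (v j)) * nrm g * nrm f"
      if f: "f \<in> H" for f
    proof -
      have le: "norm (ip f (v j) * ip (w j) g) \<le> nrm (w j) * nrm (v j) * (nrm g * nrm f)" for j
        using mult_mono[OF Cauchy_Schwarz[OF f v, of j] Cauchy_Schwarz[OF w g, of j]]
        by (simp add: norm_mult mult_ac)
      have s2: "summable (\<lambda>j. nrm (w j) * nrm (v j) * (nrm g * nrm f))" by (intro summable_mult2 sum_wv)
      show s1: "summable (\<lambda>j. norm (ip f (v j) * ip (w j) g))"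
        by (rule summable_comparison_test'[OF s2, where N = 0]) (use le in simp)
      have "(\<Sum>j. norm (ip f (v j) * ip (w j) g)) \<le> (\<Sum>j. nrm (w j) * nrm (v j) * (nrm g * nrm f))"
        by (rule suminf_le[OF le s1 s2])
      also have "\<dots> = (\<Sum>j. nrm (w j) * nrm (v j)) * (nrm g * nrm f)"
        by (rule suminf_mult2[OF sum_wv, symmetric])
      finally show "(\<Sum>j. norm (ip f (v j) * ip (w j) g)) \<le> (\<Sum>j. nrm (w j) * nrm (v j)) * nrm g * nrm f"
        by (simp only: mult.assoc)
    qed
    have "blf ((\<Sum>j. nrm (w j) * nrm (v j)) * nrm g) L"
      unfolding blf_def
    proof (intro conjI ballI allI)
      fix f h assume fh: "f \<in> H" "h \<in> H"
      have "L (\<lambda>z. f z + h z) = (\<Sum>j. ip f (v j) * ip (w j) g + ip h (v j) * ip (w j) g)"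
        unfolding L_def using fh v by (simp add: ip_add distrib_right)
      then show "L (\<lambda>z. f z + h z) = L f + L h"
        unfolding L_def using suminf_add[OF smf[OF fh(1), THEN summable_norm_cancel] smf[OF fh(2), THEN summable_norm_cancel]] by simp
    next
      fix c f assume f: "f \<in> H"
      show "L (\<lambda>z. c * f z) = c * L f"
        unfolding L_def ip_scale_left mult.assoc by (rule suminf_mult[OF summable_norm_cancel[OF smf[OF f]]])
    next
      fix f assume f: "f \<in> H"
      have "cmod (L f) \<le> (\<Sum>j. norm (ip f (v j) * ip (w j) g))"
        unfolding L_def by (rule summable_norm[OF smf[OF f]])
      then show "cmod (L f) \<le> (\<Sum>j. nrm (w j) * nrm (v j)) * nrm g * nrm f" using bdf[OF f] by linarith
    qed
    from riesz[OF this] obtain b where b: "b \<in> H" "\<And>f. f \<in> H \<Longrightarrow> L f = ip f b" by blast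
    from adjoint[OF TB g] obtain a where a: "a \<in> H" "\<And>f. f \<in> H \<Longrightarrow> ip (T f) g = ip f a" by blast
    have "ip (\<lambda>z. a z - b z) y = 0" if "y \<in> E" for y
    proof -
      from that obtain n where y: "y = u n" using uE by blast
      have "ip (u n) a = ip (u n) b" using Tu[OF g, of n] a(2)[OF u] b(2)[OF u] by (simp add: L_def)
      then have "ip a (u n) = ip b (u n)" using ip_cnj[of a "u n"] ip_cnj[of b "u n"] by simp
      then show ?thesis unfolding y by (simp add: ip_diff a b u)
    qed
    then have "(\<lambda>z. a z - b z) = (\<lambda>z. 0)" by (intro onb_total[OF E] diff_mem a b)
    then have "a = b" by (simp add: fun_eq_iff)
    then show ?thesis using a(2)[OF f] b(2)[OF f] by (simp add: L_def)
  qed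
  with w v sum_wv show ?thesis by blast
qed

text \<open>A nuclear representation of T turns the trace of B T into the sum of ip (B (w j)) (v j).
  Each term converges by \<open>bform_limit\<close> and is dominated by C nrm (w j) nrm (v j), so
  Tannery's theorem applies.\<close>

lemma op_trace_limit:
  assumes T: "T \<in> trace_class H" and B: "\<And>M. op_bound C (B M)" and B': "op_bound C B'"
    and lim: "\<And>m n. (\<lambda>M. ip (B M (e n)) (e m)) \<longlonglongrightarrow> ip (B' (e n)) (e m)"
  shows "(\<lambda>M. op_trace H (B M \<circ> T)) \<longlonglongrightarrow> op_trace H (B' \<circ> T)"
proof -
  obtain w v where w: "\<And>j. w j \<in> H" and v: "\<And>j. v j \<in> H" and sm: "summable (\<lambda>j. nrm (w j) * nrm (v j))"
    and Twv: "\<And>f g. f \<in> H \<Longrightarrow> g \<in> H \<Longrightarrow> ip (T f) g = (\<Sum>j::nat. ip f (v j) * ip (w j) g)"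
    using trace_class_nuclear[OF T] by blast
  have TB: "T \<in> bounded_ops H" using T by (simp add: trace_class_def)
  have tr: "op_trace H (A \<circ> T) = (\<Sum>j. ip (A (w j)) (v j))" if A: "op_bound C A" for A
  proof (rule op_trace_nuclear)
    have AB: "A \<in> bounded_ops H" using A by (simp add: op_bound_def)
    show "A (w j) \<in> H" for j by (rule bounded_opsD(1)[OF AB w])
    have "nrm (A (w j)) * nrm (v j) \<le> C * (nrm (w j) * nrm (v j))" for j
      using A w by (auto simp: op_bound_def mult.assoc[symmetric] intro!: mult_right_mono)
    then show "summable (\<lambda>j. nrm (A (w j)) * nrm (v j))"
      by (intro summable_comparison_test'[OF summable_mult[OF sm, of C], where N = 0]) simp
    fix f assume f: "f \<in> H"
    obtain f' where f': "f' \<in> H" "\<And>h. h \<in> H \<Longrightarrow> ip (A h) f = ip h f'" using adjoint[OF AB f] by blast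
    have "ip ((A \<circ> T) f) f = ip (T f) f'" using f'(2)[OF bounded_opsD(1)[OF TB f]] by simp
    also have "\<dots> = (\<Sum>j. ip f (v j) * ip (w j) f')" by (rule Twv[OF f f'(1)])
    also have "\<dots> = (\<Sum>j. ip f (v j) * ip (A (w j)) f)" by (simp only: f'(2)[OF w])
    finally show "ip ((A \<circ> T) f) f = (\<Sum>j. ip f (v j) * ip (A (w j)) f)" .
  qed (rule v)
  have "(\<lambda>M. \<Sum>j. ip (B M (w j)) (v j)) \<longlonglongrightarrow> (\<Sum>j. ip (B' (w j)) (v j))"
  proof -
    have "norm (ip (B M (w j)) (v j)) \<le> C * (nrm (w j) * nrm (v j))" for M j
      using op_bound_bform[OF B[of M]] w v[of j] unfolding bform_def blf_def by (auto simp: mult_ac)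
    then have ev: "eventually (\<lambda>(j, M). norm (ip (B M (w j)) (v j)) \<le> C * (nrm (w j) * nrm (v j))) (at_top \<times>\<^sub>F sequentially)"
      by (intro always_eventually) auto
    have "(\<lambda>M. ip (B M (w j)) (v j)) \<longlonglongrightarrow> ip (B' (w j)) (v j)" for j
      by (rule bform_limit[OF op_bound_bform[OF B] op_bound_bform[OF B'] lim w v])
    from tannerys_theorem[OF this ev summable_mult[OF sm]] show ?thesis by simp
  qed
  then show ?thesis by (simp only: tr[OF B] tr[OF B'])
qed

section \<open>Limits and closed conditions in the weak-star topology\<close>

lemma topspace_weak_star: "topspace (weak_star H) = bounded_ops H"
  unfolding weak_star_def topspace_pullback_topology by (simp add: vimage_def)

text \<open>The members of the sequence may lie in the closure only, so that one limit can be taken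
  after another.\<close>

lemma weak_star_closure_limit:
  assumes B: "\<And>M. op_bound C (B M)" and B': "op_bound C B'"
    and lim: "\<And>m n. (\<lambda>M. ip (B M (e n)) (e m)) \<longlonglongrightarrow> ip (B' (e n)) (e m)"
    and mem: "\<And>M. B M \<in> weak_star H closure_of S"
  shows "B' \<in> weak_star H closure_of S"
proof -
  let ?F = "\<lambda>A. \<lambda>T\<in>trace_class H. op_trace H (A \<circ> T)"
  have l: "limitin (product_topology (\<lambda>_. euclidean) (trace_class H)) (\<lambda>M. ?F (B M)) (?F B') sequentially"
    unfolding limitin_componentwise using op_trace_limit[OF _ B B' lim] by auto
  define S' where "S' = weak_star H closure_of S"
  have "B' \<in> weak_star H closure_of S'"
    unfolding in_closure_of
  proof (intro conjI allI impI)
    show "B' \<in> topspace (weak_star H)" using B' by (simp add: topspace_weak_star op_bound_def)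
    fix V assume V: "B' \<in> V \<and> openin (weak_star H) V"
    then obtain U where U: "openin (product_topology (\<lambda>_. euclidean) (trace_class H)) U" "V = ?F -` U \<inter> bounded_ops H"
      unfolding weak_star_def openin_pullback_topology by blast
    then have "?F B' \<in> U" using V by blast
    with l U(1) have "\<forall>\<^sub>F M in sequentially. ?F (B M) \<in> U" unfolding limitin_def by blast
    then obtain M where "?F (B M) \<in> U" using eventually_happens'[OF sequentially_bot] by blast
    moreover have "B M \<in> bounded_ops H" using B by (simp add: op_bound_def)
    ultimately show "\<exists>y. y \<in> S' \<and> y \<in> V" using U(2) mem unfolding S'_def by blast
  qed
  then show ?thesis by (simp add: S'_def)
qed

text \<open>The projection onto a unit vector is positive and idempotent, hence its own absolute
  value.\<close>

lemma rank_one_trace_class: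
  assumes g: "g \<in> H" and n: "nrm g = 1"
  shows "rank_one H g g \<in> trace_class H"
proof -
  let ?T = "rank_one H g g"
  have app: "?T f = (\<lambda>w. ip f g * g w)" if "f \<in> H" for f using that by (simp add: rank_one_def)
  have gg: "ip g g = 1" unfolding ip_self n by simp
  have T: "?T \<in> bounded_ops H"
  proof (rule bounded_opsI[where C = 1])
    fix f assume f: "f \<in> H"
    show "nrm (?T f) \<le> 1 * nrm f"
      using Cauchy_Schwarz[OF f g] n by (simp add: app[OF f] nrm_scale)
    show "?T f \<in> H" unfolding app[OF f] by (rule scale_mem[OF g])
    show "?T (\<lambda>z. c * f z) = (\<lambda>z. c * ?T f z)" for c
      unfolding app[OF f] app[OF scale_mem[OF f]] ip_scale_left by (simp only: mult.assoc)
    fix h assume h: "h \<in> H"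
    show "?T (\<lambda>z. f z + h z) = (\<lambda>z. ?T f z + ?T h z)"
      unfolding app[OF f] app[OF h] app[OF add_mem[OF f h]] ip_add[OF f h g] by (simp only: distrib_right)
  qed (simp add: rank_one_def)
  moreover have "is_abs_op H ?T ?T"
    unfolding is_abs_op_def
  proof (intro conjI ballI T)
    fix f assume f: "f \<in> H"
    have "ip (?T f) f = complex_of_real ((cmod (ip f g))\<^sup>2)"
      unfolding app[OF f] ip_scale_left complex_norm_square ip_cnj[of g f] ..
    then show "ip (?T f) f \<in> \<real>" "0 \<le> Re (ip (?T f) f)" by simp_all
    fix h assume h: "h \<in> H"
    show "ip (?T (?T f)) h = ip (?T f) (?T h)"
      unfolding app[OF h] app[OF f] using app[OF scale_mem[OF g]]
      by (simp add: ip_scale_left ip_scale_right gg ip_cnj[of g h])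
  qed
  moreover have "(\<lambda>u. ip (?T u) u) summable_on range e"
  proof -
    have "ip (?T u) u = ip g u * ip u g" if "u \<in> range e" for u
      using that basis_mem by (auto simp: app ip_scale_left)
    then show ?thesis
      using abs_summable_summable[OF onb_product_summable(1)[OF is_onb_basis g g]]
      by (subst summable_on_cong) auto
  qed
  ultimately show ?thesis unfolding trace_class_def using is_onb_basis by blast
qed

lemma op_trace_rank_one_comp:
  assumes A: "A \<in> bounded_ops H" and g: "g \<in> H"
  shows "op_trace H (A \<circ> rank_one H g g) = ip (A g) g"
proof (rule op_trace_rank_one[OF bounded_opsD(1)[OF A g] g])
  fix f assume f: "f \<in> H"
  then have "(A \<circ> rank_one H g g) f = (\<lambda>z. ip f g * A g z)"
    by (simp add: rank_one_def bounded_opsD(3)[OF A g])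
  then show "ip ((A \<circ> rank_one H g g) f) f = ip f g * ip (A g) f"
    by (simp only: ip_scale_left)
qed

text \<open>The trace of A composed with the projection onto g is one of the coordinates that define
  the topology.\<close>

lemma closedin_weak_star_quadratic:
  assumes g: "g \<in> H" and n: "nrm g = 1"
  shows "closedin (weak_star H) {A \<in> bounded_ops H. ip (A g) g = 0}"
proof -
  let ?F = "\<lambda>A. \<lambda>T\<in>trace_class H. op_trace H (A \<circ> T)"
  let ?R = "rank_one H g g"
  have R: "?R \<in> trace_class H" by (rule rank_one_trace_class[OF g n])
  have "continuous_map (product_topology (\<lambda>_. euclidean) (trace_class H)) euclidean (\<lambda>x. x ?R :: complex)"
    by (rule continuous_map_product_projection[OF R])
  from continuous_map_pullback[OF this, of "bounded_ops H" ?F]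
  have "continuous_map (weak_star H) euclidean ((\<lambda>x. x ?R) \<circ> ?F)" unfolding weak_star_def .
  from closedin_continuous_map_preimage[OF this, of "{0}"]
  have "closedin (weak_star H) {A \<in> bounded_ops H. ((\<lambda>x. x ?R) \<circ> ?F) A \<in> {0}}"
    by (simp add: topspace_weak_star)
  moreover have "{A \<in> bounded_ops H. ((\<lambda>x. x ?R) \<circ> ?F) A \<in> {0}} = {A \<in> bounded_ops H. ip (A g) g = 0}"
    using R op_trace_rank_one_comp[OF _ g] by auto
  ultimately show ?thesis by simp
qed

end

section \<open>Weyl operators, normalized kernels and the Berezin transform\<close>

lemma true_fock_hilbert_basis: "hilbert_basis (true_fock (Suc N)) (ebas N)"
proof
  show "f \<in> true_fock (Suc N) \<Longrightarrow> (\<And>n. ip f (ebas N n) = 0) \<Longrightarrow> f = (\<lambda>z. 0)" for f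
    by (rule true_fock_zero_if_orthogonal)
  show "\<exists>f\<in>true_fock (Suc N). \<forall>n. ip f (ebas N n) = a n" if "summable (\<lambda>n. (cmod (a n))\<^sup>2)" for a
    using ebas_synthesis[OF that] by blast
qed (simp_all add: true_fock_L2 true_fock_add true_fock_scale ebas_true_fock ip_ebas true_fock_expansion(1))

lemma weyl_measurable: "f \<in> borel_measurable borel \<Longrightarrow> weyl z f \<in> borel_measurable borel"
proof -
  assume [measurable]: "f \<in> borel_measurable borel"
  have [measurable]: "(\<lambda>w. exp (w * cnj z - complex_of_real ((cmod z)\<^sup>2) / 2)) \<in> borel_measurable borel"
    by (intro borel_measurable_continuous_onI continuous_intros) simp
  show ?thesis unfolding weyl_def[abs_def] by measurable
qed

lemma cmod_exp_weyl: "(cmod (exp (w * cnj z - complex_of_real ((cmod z)\<^sup>2) / 2)))\<^sup>2 = exp (2 * Re (w * cnj z) - (cmod z)\<^sup>2)"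
  unfolding norm_exp_eq_Re exp_double[symmetric] by (simp add: algebra_simps)

lemma weyl_L2:
  assumes f: "f \<in> L2_gauss"
  shows "weyl z f \<in> L2_gauss"
proof (rule L2_gaussI)
  note [measurable] = L2_gaussD(1)[OF f]
  show "weyl z f \<in> borel_measurable borel" by (intro weyl_measurable L2_gaussD f)
  have "(\<lambda>w. (cmod (weyl z f w))\<^sup>2) = (\<lambda>w. exp (2 * Re (w * cnj z) - (cmod z)\<^sup>2) *\<^sub>R (cmod (f (w - z)))\<^sup>2)"
    unfolding weyl_def norm_mult power_mult_distrib cmod_exp_weyl by simp
  then show "integrable gauss (\<lambda>w. (cmod (weyl z f w))\<^sup>2)"
    using gauss_translation(2)[of "\<lambda>w. (cmod (f w))\<^sup>2" z] L2_gaussD(2)[OF f] by simp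
qed

lemma ip_weyl_weyl:
  assumes f: "f \<in> L2_gauss" and g: "g \<in> L2_gauss"
  shows "ip (weyl z f) (weyl z g) = ip f g"
proof -
  note [measurable] = L2_gaussD(1)[OF f] L2_gaussD(1)[OF g]
  have "weyl z f w * cnj (weyl z g w) = exp (2 * Re (w * cnj z) - (cmod z)\<^sup>2) *\<^sub>R (f (w - z) * cnj (g (w - z)))" for w
  proof -
    define E where "E = exp (w * cnj z - complex_of_real ((cmod z)\<^sup>2) / 2)"
    have "E * cnj E = complex_of_real (exp (2 * Re (w * cnj z) - (cmod z)\<^sup>2))"
      unfolding complex_norm_square[symmetric] E_def cmod_exp_weyl ..
    then show ?thesis
      unfolding weyl_def E_def[symmetric] scaleR_conv_of_real
      by (metis (no_types, lifting) complex_cnj_mult mult.assoc mult.commute)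
  qed
  then show ?thesis
    unfolding ip_def using gauss_translation(1)[of "\<lambda>w. f w * cnj (g w)" z] by simp
qed

lemma weyl_weyl: "weyl z (weyl w f) v = exp (- \<i> * complex_of_real (Im (z * cnj w))) * weyl (z + w) f v"
proof -
  have "(v * cnj z - complex_of_real ((cmod z)\<^sup>2) / 2) + ((v - z) * cnj w - complex_of_real ((cmod w)\<^sup>2) / 2)
      = - \<i> * complex_of_real (Im (z * cnj w)) + (v * cnj (z + w) - complex_of_real ((cmod (z + w))\<^sup>2) / 2)"
    unfolding cmod_power2 by (simp add: complex_eq_iff power2_eq_square field_simps)
  then show ?thesis
    unfolding weyl_def mult.assoc[symmetric] exp_add[symmetric] by (simp add: diff_diff_eq)
qed

lemma weyl_0: "weyl 0 f = f"
  by (simp add: weyl_def fun_eq_iff)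

lemma weyl_inverse: "weyl (- z) (weyl z f) = f" "weyl z (weyl (- z) f) = f"
proof -
  have "Im (z * cnj z) = 0" by simp
  then show "weyl (- z) (weyl z f) = f" "weyl z (weyl (- z) f) = f"
    by (simp_all add: fun_eq_iff weyl_weyl weyl_0 del: times_complex.sel)
qed

lemma ip_weyl: "f \<in> L2_gauss \<Longrightarrow> g \<in> L2_gauss \<Longrightarrow> ip (weyl z f) g = ip f (weyl (- z) g)"
  using ip_weyl_weyl[of "weyl z f" g "- z"] by (simp add: weyl_inverse weyl_L2)

lemma weyl_fock: "f \<in> fock n \<Longrightarrow> weyl z f \<in> fock n"
  by (simp add: fock_iff weyl_L2 polyan_weyl)

text \<open>Weyl operators preserve \<open>fock N\<close> and their adjoints are again Weyl
  operators, so the orthogonality to \<open>fock N\<close> is preserved as well.\<close>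

lemma weyl_true_fock: "f \<in> true_fock (Suc N) \<Longrightarrow> weyl z f \<in> true_fock (Suc N)"
proof -
  assume f: "f \<in> true_fock (Suc N)"
  have "ip (weyl z f) g = 0" if g: "g \<in> fock N" for g
  proof -
    have "ip (weyl z f) g = ip f (weyl (- z) g)"
      using true_fock_L2[OF f] g by (intro ip_weyl) (auto simp: fock_iff)
    then show ?thesis using f weyl_fock[OF g, of "- z"] by (simp add: true_fock_Suc)
  qed
  with f weyl_fock[of f "Suc N" z] show ?thesis by (simp add: true_fock_Suc)
qed

lemma weyl_add: "weyl z (\<lambda>w. f w + g w) = (\<lambda>w. weyl z f w + weyl z g w)"
  by (simp add: weyl_def fun_eq_iff distrib_left)

lemma weyl_scale: "weyl z (\<lambda>w. c * f w) = (\<lambda>w. c * weyl z f w)"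
  by (simp add: weyl_def fun_eq_iff)

lemma nrm_weyl: "f \<in> L2_gauss \<Longrightarrow> nrm (weyl z f) = nrm f"
  using ip_weyl_weyl[of f f z] unfolding ip_self of_real_eq_iff
  by (simp add: power2_eq_iff_nonneg)

lemma parity_L2:
  assumes f: "f \<in> L2_gauss"
  shows "parity f \<in> L2_gauss"
proof (rule L2_gaussI)
  note fm [measurable] = L2_gaussD(1)[OF f]
  show pm: "parity f \<in> borel_measurable borel" unfolding parity_def[abs_def] by measurable
  have "(\<integral>\<^sup>+z. ennreal ((cmod (f z))\<^sup>2) \<partial>gauss) = (\<integral>\<^sup>+z. ennreal ((cmod (f (- z)))\<^sup>2) \<partial>gauss)"
  proof -
    have "(\<integral>\<^sup>+z. ennreal ((cmod (f z))\<^sup>2) \<partial>gauss) = (\<integral>\<^sup>+z. ennreal (exp (- (cmod z)\<^sup>2) / pi) * ennreal ((cmod (f z))\<^sup>2) \<partial>distr lborel borel (\<lambda>z. - 1 * z))"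
      by (subst lborel_distr_rotation) (simp_all add: nn_integral_gauss)
    also have "\<dots> = (\<integral>\<^sup>+z. ennreal (exp (- (cmod z)\<^sup>2) / pi) * ennreal ((cmod (f (- z)))\<^sup>2) \<partial>lborel)"
      by (subst nn_integral_distr) auto
    also have "\<dots> = (\<integral>\<^sup>+z. ennreal ((cmod (f (- z)))\<^sup>2) \<partial>gauss)"
      by (subst nn_integral_gauss) auto
    finally show ?thesis .
  qed
  then show "integrable gauss (\<lambda>z. (cmod (parity f z))\<^sup>2)"
    using L2_gaussD(2)[OF f] pm unfolding integrable_iff_bounded parity_def
    by (simp add: measurable_gauss_iff)
qed

lemma ip_parity:
  assumes f: "f \<in> L2_gauss" and g: "g \<in> L2_gauss"
  shows "ip (parity f) g = ip f (parity g)"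
proof -
  note [measurable] = L2_gaussD(1)[OF f] L2_gaussD(1)[OF g]
  show ?thesis
    unfolding ip_def parity_def
    using integral_gauss_rotation[of "-1" "\<lambda>z. f (- z) * cnj (g z)"] by simp
qed

lemma parity_fock:
  assumes "f \<in> fock n"
  shows "parity f \<in> fock n"
proof -
  from assms obtain h where h: "\<And>j. h j holomorphic_on UNIV" "f = (\<lambda>z. \<Sum>j<n. cnj z ^ j * h j z)"
    unfolding fock_iff polyan_def by blast
  have "(\<lambda>z. (-1) ^ j * h j (- z)) holomorphic_on UNIV" for j
  proof -
    have "(\<lambda>z::complex. - z) holomorphic_on UNIV" by (intro holomorphic_intros)
    from holomorphic_on_compose_gen[OF this h(1)] have "(\<lambda>z. h j (- z)) holomorphic_on UNIV" by (simp add: o_def)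
    then show ?thesis by (intro holomorphic_intros)
  qed
  moreover have "parity f = (\<lambda>z. \<Sum>j<n. cnj z ^ j * ((-1) ^ j * h j (- z)))"
    unfolding parity_def[abs_def] h(2) by (simp add: power_minus[of "cnj _"] mult_ac)
  ultimately have "polyan n (parity f)"
    unfolding polyan_def by (intro exI[of _ "\<lambda>j z. (-1) ^ j * h j (- z)"]) auto
  then show ?thesis using assms parity_L2 by (simp add: fock_iff)
qed

lemma parity_true_fock: "f \<in> true_fock (Suc N) \<Longrightarrow> parity f \<in> true_fock (Suc N)"
proof -
  assume f: "f \<in> true_fock (Suc N)"
  have "ip (parity f) g = 0" if g: "g \<in> fock N" for g
  proof -
    have "ip (parity f) g = ip f (parity g)"
      using true_fock_L2[OF f] g by (intro ip_parity) (auto simp: fock_iff)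
    then show ?thesis using f parity_fock[OF g] by (simp add: true_fock_Suc)
  qed
  with f parity_fock[of f "Suc N"] show ?thesis by (simp add: true_fock_Suc)
qed

section \<open>Normalized kernels and the reproducing property\<close>

lemma ebas_0: "ebas N m 0 = (if m = N then (- 1) ^ N else 0)"
proof -
  have "herm N m 0 = (\<Sum>i\<in>{N}. herm_coeff N m i * zmon (m - i) (N - i) 0)"
    unfolding herm_def by (rule sum.mono_neutral_right) (auto simp: zmon_def)
  also have "\<dots> = (if m = N then (- 1) ^ N * fact N else 0)"
    by (auto simp: zmon_def herm_coeff_def)
  finally show ?thesis
    unfolding ebas_def by (simp add: real_sqrt_mult_self)
qed

text \<open>The reflection i -> N - i matches the Laguerre sum with \<open>herm N N\<close>, and the
  normalization of \<open>ebas N N\<close> is 1 / N!; so the kernel at 0 is a basis function up to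
  sign.\<close>

lemma nkernel_0: "nkernel (Suc N) 0 = (\<lambda>w. (- 1) ^ N * ebas N N w)"
proof
  fix w
  have term_eq: "complex_of_real ((- 1) ^ (N - i) * real (N choose i) * (((cmod w)\<^sup>2) ^ (N - i) / fact (N - i)))
      = (- 1) ^ N * (herm_coeff N N i * zmon (N - i) (N - i) w) / fact N" if "i \<le> N" for i
  proof -
    have "(- 1 :: complex) ^ N = (- 1) ^ (N - i) * (- 1) ^ i"
      using that by (simp add: power_add[symmetric])
    then have sgn: "(- 1 :: complex) ^ (N - i) = (- 1) ^ N * (- 1) ^ i"
      by (simp add: mult.assoc power_mult_distrib[symmetric])
    have "fact i * fact (N - i) * of_nat (N choose i) = (fact N :: complex)"
      using binomial_fact_lemma[OF that] by (metis of_nat_fact of_nat_mult)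
    then have bin: "1 / fact (N - i) = (fact i * of_nat (N choose i) / fact N :: complex)"
      by (simp add: field_simps)
    have pow: "complex_of_real (((cmod w)\<^sup>2) ^ (N - i)) = w ^ (N - i) * cnj w ^ (N - i)"
      unfolding of_real_power[of "(cmod w)\<^sup>2"] complex_norm_square power_mult_distrib ..
    have "complex_of_real ((- 1) ^ (N - i) * real (N choose i) * (((cmod w)\<^sup>2) ^ (N - i) / fact (N - i)))
        = (- 1) ^ (N - i) * of_nat (N choose i) * (complex_of_real (((cmod w)\<^sup>2) ^ (N - i)) * (1 / fact (N - i)))"
      by simp
    then show ?thesis
      unfolding pow sgn bin herm_coeff_def zmon_def by (simp only: divide_inverse mult_ac)
  qed
  have "complex_of_real (laguerre N 0 ((cmod w)\<^sup>2))
      = (\<Sum>j\<le>N. complex_of_real ((- 1) ^ j * (real N gchoose (N - j)) * (((cmod w)\<^sup>2) ^ j / fact j)))"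
    by (simp add: laguerre_def)
  also have "\<dots> = (\<Sum>i\<le>N. complex_of_real ((- 1) ^ (N - i) * real (N choose i) * (((cmod w)\<^sup>2) ^ (N - i) / fact (N - i))))"
    by (rule sum.reindex_bij_witness[of _ "\<lambda>i. N - i" "\<lambda>j. N - j"]) (auto simp: binomial_gbinomial)
  also have "\<dots> = (\<Sum>i\<le>N. (- 1) ^ N * (herm_coeff N N i * zmon (N - i) (N - i) w) / fact N)"
    by (intro sum.cong term_eq) auto
  also have "\<dots> = (- 1) ^ N * ebas N N w"
    unfolding ebas_def herm_def sum_distrib_left by (intro sum.cong refl) (simp add: real_sqrt_mult_self)
  finally show "nkernel (Suc N) 0 w = (- 1) ^ N * ebas N N w" by (simp add: nkernel_def)
qed

lemma nkernel_eq_weyl: "nkernel (Suc N) z = weyl z (nkernel (Suc N) 0)"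
  by (simp add: nkernel_def weyl_def fun_eq_iff)

lemma nkernel_true_fock: "nkernel (Suc N) z \<in> true_fock (Suc N)"
  unfolding nkernel_eq_weyl[of N z] nkernel_0 by (intro weyl_true_fock true_fock_scale ebas_true_fock)

text \<open>\<open>ebas N N\<close> is the only basis function that does not vanish at 0, so the
  pointwise expansion at 0 has a single term.\<close>

lemma ip_nkernel_0:
  assumes f: "f \<in> true_fock (Suc N)"
  shows "ip f (nkernel (Suc N) 0) = f 0"
proof -
  have "(\<lambda>m. if m = N then ip f (ebas N m) * (- 1) ^ N else 0) sums f 0"
    using true_fock_expansion(2)[OF f, of 0] by (simp add: ebas_0 if_distrib[of "\<lambda>x. _ * x"] cong: if_cong)
  from sums_unique2[OF this sums_single] show ?thesis
    by (simp add: nkernel_0 ip_scale_right)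
qed

text \<open>The kernel at z is the Weyl translate of the kernel at 0. Moving the translation to f
  and evaluating at 0 leaves the Gaussian factor.\<close>

lemma ip_nkernel:
  assumes f: "f \<in> true_fock (Suc N)"
  shows "ip f (nkernel (Suc N) z) = complex_of_real (exp (- (cmod z)\<^sup>2 / 2)) * f z"
proof -
  have "ip f (nkernel (Suc N) z) = cnj (ip (weyl z (nkernel (Suc N) 0)) f)"
    unfolding nkernel_eq_weyl[of N z] by (rule ip_cnj)
  also have "\<dots> = ip (weyl (- z) f) (nkernel (Suc N) 0)"
    by (subst ip_weyl) (simp_all add: true_fock_L2[OF nkernel_true_fock] true_fock_L2[OF f] flip: ip_cnj)
  also have "\<dots> = weyl (- z) f 0" by (rule ip_nkernel_0[OF weyl_true_fock[OF f]])
  also have "\<dots> = complex_of_real (exp (- (cmod z)\<^sup>2 / 2)) * f z"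
    by (simp add: weyl_def exp_of_real[symmetric] del: of_real_power)
  finally show ?thesis .
qed

lemma nrm_nkernel: "nrm (nkernel (Suc N) z) = 1"
proof -
  have "ip (nkernel (Suc N) 0) (nkernel (Suc N) 0) = 1"
    unfolding ip_nkernel_0[OF nkernel_true_fock] by (simp add: nkernel_0 ebas_0 power_add[symmetric])
  then have "(nrm (nkernel (Suc N) 0))\<^sup>2 = 1" unfolding ip_self by (simp only: of_real_eq_1_iff)
  then have "nrm (nkernel (Suc N) 0) = 1"
    using power2_eq_1_iff[of "nrm (nkernel (Suc N) 0)"] nrm_nonneg[of "nkernel (Suc N) 0"] by linarith
  then show ?thesis unfolding nkernel_eq_weyl[of N z] by (simp add: nrm_weyl true_fock_L2[OF nkernel_true_fock])
qed

lemma parity_weyl_nkernel: "parity (weyl (- z) (nkernel (Suc N) 0)) = nkernel (Suc N) z"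
proof
  fix w
  have "cmod (- w + z) = cmod (w - z)"
  proof -
    have "- w + z = - (w - z)" by simp
    then show ?thesis by (simp only: norm_minus_cancel)
  qed
  then show "parity (weyl (- z) (nkernel (Suc N) 0)) w = nkernel (Suc N) z w"
    by (simp add: parity_def weyl_def nkernel_def)
qed

text \<open>The operator under the trace has rank one. Moving Weyl and parity operators across the
  inner product turns the kernel at 0 into the kernel at z, by \<open>parity_weyl_nkernel\<close>,
  on both sides of A.\<close>

lemma convol_nkernel:
  assumes A: "A \<in> bounded_ops (true_fock (Suc N))"
  shows "convol (true_fock (Suc N)) (rank_one (true_fock (Suc N)) (nkernel (Suc N) 0) (nkernel (Suc N) 0)) A z
    = ip (A (nkernel (Suc N) z)) (nkernel (Suc N) z)"
proof -
  interpret hilbert_basis "true_fock (Suc N)" "ebas N" by (rule true_fock_hilbert_basis)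
  let ?H = "true_fock (Suc N)" and ?k = "nkernel (Suc N)"
  note kH = nkernel_true_fock[of N] and wH = weyl_true_fock[of _ N] and pH = parity_true_fock[of _ N]
  note AH = bounded_opsD(1)[OF A]
  obtain a where aH: "a \<in> ?H" and a': "\<forall>f\<in>?H. ip (A f) (?k z) = ip f a"
    using bexE[OF adjoint[OF A kH[of z]]] .
  note a = aH a'[rule_format]
  have move: "ip (parity (weyl (- z) f)) g = ip f (weyl z (parity g))" if "f \<in> ?H" "g \<in> ?H" for f g
    using that by (simp add: ip_parity ip_weyl L2 wH pH)
  have "op_trace ?H (rank_one ?H (?k 0) (?k 0) \<circ> weyl z \<circ> parity \<circ> A \<circ> parity \<circ> weyl (- z)) = ip (?k 0) (weyl z (parity a))"
  proof (rule op_trace_rank_one)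
    fix f assume f: "f \<in> ?H"
    define B where "B = weyl z (parity (A (parity (weyl (- z) f))))"
    have B: "B \<in> ?H" unfolding B_def by (intro wH pH AH f)
    have "ip B (?k 0) = ip (A (parity (weyl (- z) f))) (parity (weyl (- z) (?k 0)))"
      unfolding B_def by (simp add: ip_parity ip_weyl L2 wH pH AH f kH)
    also have "\<dots> = ip (parity (weyl (- z) f)) a"
      unfolding parity_weyl_nkernel by (intro a(2) wH pH f)
    also have "\<dots> = ip f (weyl z (parity a))" by (rule move[OF f a(1)])
    finally have "ip B (?k 0) = ip f (weyl z (parity a))" .
    then show "ip ((rank_one ?H (?k 0) (?k 0) \<circ> weyl z \<circ> parity \<circ> A \<circ> parity \<circ> weyl (- z)) f) f
        = ip f (weyl z (parity a)) * ip (?k 0) f"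
      using B by (simp add: rank_one_def B_def[symmetric] ip_scale_left)
  qed (intro kH wH pH a)+
  also have "\<dots> = ip (A (?k z)) (?k z)"
    unfolding move[OF kH a(1), symmetric] parity_weyl_nkernel by (rule a(2)[OF kH, symmetric])
  finally show ?thesis unfolding convol_def .
qed

section \<open>Matrix entries of the Weyl operators\<close>

lemma weyl_op_bound:
  "hilbert_basis.op_bound (true_fock (Suc N)) 1 (restrict (weyl z) (true_fock (Suc N)))"
proof -
  interpret hilbert_basis "true_fock (Suc N)" "ebas N" by (rule true_fock_hilbert_basis)
  have "restrict (weyl z) (true_fock (Suc N)) \<in> bounded_ops (true_fock (Suc N))"
    by (rule bounded_opsI[where C = 1])
       (simp_all add: weyl_true_fock add_mem scale_mem weyl_add weyl_scale nrm_weyl L2)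
  then show ?thesis by (simp add: op_bound_def nrm_weyl L2)
qed

text \<open>Entry (m, n) of \<open>weyl \<xi>\<close> in the basis \<open>ebas N\<close>, see
  \<open>ip_weyl_ebas\<close>. No N appears because dbar^N commutes with Weyl operators and
  identifies the levels.\<close>

definition wmat :: "nat \<Rightarrow> nat \<Rightarrow> complex \<Rightarrow> complex" where
  "wmat m n \<xi> = of_real (exp (- (cmod \<xi>)\<^sup>2 / 2)) * of_real (sqrt (fact m)) / of_real (sqrt (fact n)) *
     (\<Sum>i\<le>n. if i \<le> m then of_nat (n choose i) * (- \<xi>) ^ (n - i) * cnj \<xi> ^ (m - i) / fact (m - i) else 0)"

lemma powser_unique:
  fixes a b :: "nat \<Rightarrow> complex"
  assumes a: "\<And>z. (\<lambda>m. a m * z ^ m) sums f z" and b: "\<And>z. (\<lambda>m. b m * z ^ m) sums f z"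
  shows "a m = b m"
proof (rule ccontr)
  assume ne: "a m \<noteq> b m"
  have d: "(\<lambda>m. (a m - b m) * z ^ m) sums 0" for z
    using sums_diff[OF a[of z] b[of z]] by (simp add: algebra_simps)
  \<comment> \<open>\<open>powser_0_nonzero\<close> asks for a positive index; index 0 is settled by
    z = 0.\<close>
  have "a 0 = b 0"
    using d[of 0] by simp
  with ne have "0 < m" by (cases m) auto
  show False
  proof (rule powser_0_nonzero[of 1 0 "\<lambda>m. a m - b m" "\<lambda>_. 0" m])
    show "(\<lambda>n. (a n - b n) * (x - 0) ^ n) sums 0" for x using d[of x] by simp
    fix s :: real
    assume "0 < s" and nz: "\<And>z. z \<in> cball 0 s - {0 :: complex} \<Longrightarrow> (0::complex) \<noteq> 0"
    then show False using nz[of "of_real s"] by simp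
  qed (use ne \<open>0 < m\<close> in auto)
qed

text \<open>dbar^N turns \<open>ebas N n\<close> into a multiple of z^n, from which the Weyl
  operator makes an explicit entire function. Comparing its Taylor coefficients with
  \<open>true_fock_expansion(3)\<close> gives the entries.\<close>

lemma ip_weyl_ebas: "ip (weyl \<xi> (ebas N n)) (ebas N m) = wmat m n \<xi>"
proof -
  define W where "W = weyl \<xi> (ebas N n)"
  have WH: "W \<in> true_fock (Suc N)" unfolding W_def by (intro weyl_true_fock ebas_true_fock)
  have top: "(dbar ^^ N) (ebas N n) z / of_real (sqrt (fact N)) = z ^ n / of_real (sqrt (fact n))" for z
  proof -
    have "(\<lambda>m. if m = n then z ^ m / of_real (sqrt (fact m)) else 0) sums ((dbar ^^ N) (ebas N n) z / of_real (sqrt (fact N)))"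
    proof (rule sums_cong[THEN iffD1, OF _ true_fock_expansion(3)[OF ebas_true_fock]])
      show "ip (ebas N n) (ebas N m) / of_real (sqrt (fact m)) * z ^ m = (if m = n then z ^ m / of_real (sqrt (fact m)) else 0)" for m
        by (simp add: ip_ebas)
    qed
    from sums_unique2[OF this sums_single] show ?thesis .
  qed
  have "(dbar ^^ N) W = weyl \<xi> ((dbar ^^ N) (ebas N n))"
    unfolding W_def by (rule dbar_funpow_weyl[OF true_fock_polyan[OF ebas_true_fock]])
  then have W: "(dbar ^^ N) W z / of_real (sqrt (fact N))
      = exp (z * cnj \<xi> - complex_of_real ((cmod \<xi>)\<^sup>2) / 2) * ((z - \<xi>) ^ n / of_real (sqrt (fact n)))" for z
  proof -
    have "(dbar ^^ N) W z / of_real (sqrt (fact N))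
        = exp (z * cnj \<xi> - complex_of_real ((cmod \<xi>)\<^sup>2) / 2) * ((dbar ^^ N) (ebas N n) (z - \<xi>) / of_real (sqrt (fact N)))"
      unfolding \<open>(dbar ^^ N) W = weyl \<xi> ((dbar ^^ N) (ebas N n))\<close> weyl_def by simp
    then show ?thesis unfolding top .
  qed
  define c where "c = of_real (exp (- (cmod \<xi>)\<^sup>2 / 2)) / complex_of_real (sqrt (fact n))"
  have shifted: "(\<lambda>m. if i \<le> m then cnj \<xi> ^ (m - i) / fact (m - i) * z ^ m else 0) sums (z ^ i * exp (z * cnj \<xi>))" for i z
  proof -
    define g where "g m = (if i \<le> m then cnj \<xi> ^ (m - i) / fact (m - i) * z ^ m else 0)" for m
    have "(\<lambda>m. z ^ i * ((z * cnj \<xi>) ^ m /\<^sub>R fact m)) sums (z ^ i * exp (z * cnj \<xi>))"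
      by (intro sums_mult exp_converges)
    moreover have "z ^ i * ((z * cnj \<xi>) ^ m /\<^sub>R fact m) = g (m + i)" for m
      by (simp add: g_def scaleR_conv_of_real power_mult_distrib power_add field_simps)
    ultimately have "(\<lambda>m. g (m + i)) sums (z ^ i * exp (z * cnj \<xi>))" by simp
    moreover have "(\<Sum>m<i. g m) = 0" by (simp add: g_def)
    ultimately have "g sums (z ^ i * exp (z * cnj \<xi>))" using sums_iff_shift'[of g i] by simp
    then show ?thesis by (simp add: g_def[abs_def])
  qed
  have "(\<lambda>m. c * (\<Sum>i\<le>n. if i \<le> m then of_nat (n choose i) * (- \<xi>) ^ (n - i) * cnj \<xi> ^ (m - i) / fact (m - i) else 0) * z ^ m)
      sums ((dbar ^^ N) W z / of_real (sqrt (fact N)))" for z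
  proof -
    have "(\<lambda>m. c * (\<Sum>i\<le>n. of_nat (n choose i) * (- \<xi>) ^ (n - i) * (if i \<le> m then cnj \<xi> ^ (m - i) / fact (m - i) * z ^ m else 0)))
       sums (c * (\<Sum>i\<le>n. of_nat (n choose i) * (- \<xi>) ^ (n - i) * (z ^ i * exp (z * cnj \<xi>))))"
      by (intro sums_mult sums_sum shifted)
    moreover have "c * (\<Sum>i\<le>n. of_nat (n choose i) * (- \<xi>) ^ (n - i) * (z ^ i * exp (z * cnj \<xi>)))
        = (dbar ^^ N) W z / of_real (sqrt (fact N))"
    proof -
      have "(z - \<xi>) ^ n = (\<Sum>i\<le>n. of_nat (n choose i) * z ^ i * (- \<xi>) ^ (n - i))"
        using binomial_ring[of z "- \<xi>" n] by simp
      note bin = this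
      have "(\<Sum>i\<le>n. of_nat (n choose i) * (- \<xi>) ^ (n - i) * (z ^ i * exp (z * cnj \<xi>))) = (z - \<xi>) ^ n * exp (z * cnj \<xi>)"
        unfolding bin sum_distrib_right by (intro sum.cong refl) (simp only: mult_ac)
      moreover have "exp (z * cnj \<xi> - complex_of_real ((cmod \<xi>)\<^sup>2) / 2) = of_real (exp (- (cmod \<xi>)\<^sup>2 / 2)) * exp (z * cnj \<xi>)"
        unfolding exp_of_real[symmetric] exp_add[symmetric] by (simp add: algebra_simps)
      ultimately show ?thesis unfolding W c_def by simp
    qed
    ultimately show ?thesis
      by (simp add: sum_distrib_right mult.assoc if_distrib[of "\<lambda>x. _ * x"] if_distrib[of "\<lambda>x. x * _"] cong: if_cong)
  qed
  from powser_unique[OF true_fock_expansion(3)[OF WH] this, of m]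
  have "ip W (ebas N m) = of_real (sqrt (fact m)) *
     (c * (\<Sum>i\<le>n. if i \<le> m then of_nat (n choose i) * (- \<xi>) ^ (n - i) * cnj \<xi> ^ (m - i) / fact (m - i) else 0))"
    by (simp add: field_simps)
  then show ?thesis unfolding W_def wmat_def c_def by (simp add: field_simps)
qed

section \<open>Zeros of the Laguerre polynomials\<close>

definition lag_coeff :: "nat \<Rightarrow> nat \<Rightarrow> nat \<Rightarrow> real" where
  "lag_coeff n a j = (- 1) ^ j * real ((n + a) choose (n - j)) / fact j"

definition lag_poly :: "nat \<Rightarrow> nat \<Rightarrow> real poly" where
  "lag_poly n a = (\<Sum>j\<le>n. monom (lag_coeff n a j) j)"

lemma coeff_lag_poly: "coeff (lag_poly n a) j = (if j \<le> n then lag_coeff n a j else 0)"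
  by (simp add: lag_poly_def coeff_sum)

lemma poly_lag_poly: "poly (lag_poly n a) x = laguerre n (real a) x"
  unfolding lag_poly_def laguerre_def lag_coeff_def poly_sum poly_monom
  by (intro sum.cong refl) (simp add: binomial_gbinomial)

text \<open>A Rodrigues relation in disguise: the derivative of x^(a+1) exp(-x) L_n^(a+1) is (n+1)
  x^a exp(-x) L_(n+1)^a. Coefficients are compared.\<close>

lemma lag_poly_rec:
  "smult (real (Suc n)) (lag_poly (Suc n) a)
    = pCons 0 (pderiv (lag_poly n (Suc a))) + [:real (Suc a), - 1:] * lag_poly n (Suc a)"
proof (rule poly_eqI)
  fix j
  let ?q = "lag_poly n (Suc a)"
  have lhs: "coeff (smult (real (Suc n)) (lag_poly (Suc n) a)) j = (if j \<le> Suc n then real (Suc n) * lag_coeff (Suc n) a j else 0)"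
    by (simp add: coeff_lag_poly)
  have rhs: "coeff (pCons 0 (pderiv ?q) + [:real (Suc a), - 1:] * ?q) j
      = real (j + Suc a) * coeff ?q j - (if j = 0 then 0 else coeff ?q (j - 1))"
    by (cases j) (simp_all add: coeff_pderiv algebra_simps)
  have main: "real (Suc n) * lag_coeff (Suc n) a j = real (j + Suc a) * lag_coeff n (Suc a) j - (if j = 0 then 0 else lag_coeff n (Suc a) (j - 1))"
    if "j \<le> n"
  proof -
    let ?M = "n + Suc a"
    \<comment> \<open>Absorption expresses the binomial coefficient of
      \<open>lag_coeff n (Suc a) j\<close> by the one in
      \<open>lag_coeff (Suc n) a j\<close>.\<close>
    have "Suc (n - j) * (?M choose Suc (n - j)) = (?M choose (n - j)) * (?M - (n - j))"
      using binomial_absorb_comp[of ?M "n - j"] binomial_absorption[of "n - j" ?M] that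
      by (metis Suc_times_binomial_eq add_Suc_right binomial_absorb_comp diff_Suc_1 mult.commute times_binomial_minus1_eq zero_less_Suc)
    moreover have "?M - (n - j) = j + Suc a" using that by simp
    ultimately have "(?M choose (n - j)) * (j + Suc a) = Suc (n - j) * (?M choose (Suc n - j))"
      using that by (simp add: Suc_diff_le)
    then have eq: "real (?M choose (n - j)) * real (j + Suc a) = real (Suc n - j) * real (?M choose (Suc n - j))"
      using that by (metis Suc_diff_le of_nat_mult)
    show ?thesis
    proof (cases j)
      case 0
      then show ?thesis using eq by (simp add: lag_coeff_def mult_ac)
    next
      case (Suc i)
      have f: "fact j = real j * (fact i :: real)" using Suc by simp
      have "real (j + Suc a) * lag_coeff n (Suc a) j = (- 1) ^ j * (real (Suc n - j) * real (?M choose (Suc n - j))) / fact j"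
        unfolding lag_coeff_def eq[symmetric] by (simp add: mult_ac)
      moreover have "lag_coeff n (Suc a) (j - 1) = - ((- 1) ^ j * (real j * real (?M choose (Suc n - j))) / fact j)"
        unfolding lag_coeff_def f using Suc that by (simp add: Suc_diff_Suc)
      moreover have "real (Suc n - j) + real j = real (Suc n)" using that by simp
      then have "real (Suc n) * lag_coeff (Suc n) a j
          = (- 1) ^ j * (real (Suc n - j) * real (?M choose (Suc n - j))) / fact j + (- 1) ^ j * (real j * real (?M choose (Suc n - j))) / fact j"
        unfolding lag_coeff_def by (simp add: add_divide_distrib[symmetric] distrib_left[symmetric] distrib_right[symmetric])
      ultimately show ?thesis using Suc by simp
    qed
  qed
  consider "j \<le> n" | "j = Suc n" | "Suc n < j" by linarith
  then show "coeff (smult (real (Suc n)) (lag_poly (Suc n) a)) j = coeff (pCons 0 (pderiv ?q) + [:real (Suc a), - 1:] * ?q) j"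
  proof cases
    case 1
    then show ?thesis unfolding lhs rhs coeff_lag_poly using main by auto
  next
    case 2
    then show ?thesis unfolding lhs rhs coeff_lag_poly by (simp add: lag_coeff_def del: of_nat_Suc)
  next
    case 3
    then show ?thesis unfolding lhs rhs coeff_lag_poly by auto
  qed
qed

lemma poly_exp_minus_tendsto_0: "((\<lambda>x. poly p x * exp (- x)) \<longlongrightarrow> (0 :: real)) at_top"
proof -
  have "((\<lambda>x. \<Sum>i\<le>degree p. coeff p i * (x ^ i / exp x)) \<longlongrightarrow> (\<Sum>i\<le>degree p. coeff p i * 0)) at_top"
    by (intro tendsto_sum tendsto_mult tendsto_const tendsto_power_div_exp_0)
  moreover have "poly p x * exp (- x) = (\<Sum>i\<le>degree p. coeff p i * (x ^ i / exp x))" for x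
    unfolding poly_altdef sum_distrib_right
    by (intro sum.cong refl) (simp add: exp_minus divide_inverse mult.assoc)
  ultimately show ?thesis by simp
qed

text \<open>If f is positive at r + 1, it later drops below that value since it tends to 0, so a
  maximum over a compact interval is attained inside. The negative case is the positive one for
  -f.\<close>

lemma Rolle_at_top:
  fixes f f' :: "real \<Rightarrow> real"
  assumes d: "\<And>x. (f has_real_derivative f' x) (at x)" and r: "f r = 0" and lim: "(f \<longlongrightarrow> 0) at_top"
  shows "\<exists>\<xi>>r. f' \<xi> = 0"
proof -
  have pos: "\<exists>\<xi>>r. g' \<xi> = 0"
    if d: "\<And>x. (g has_real_derivative g' x) (at x)" and r: "g r = 0" and lim: "(g \<longlongrightarrow> 0) at_top" and c: "0 < g (r + 1)" for g g'
  proof -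
    have "\<forall>\<^sub>F x in at_top. g x < g (r + 1) \<and> r + 1 < x"
      using order_tendstoD(2)[OF lim c] eventually_gt_at_top by (rule eventually_conj)
    then obtain Y where Y: "g Y < g (r + 1)" "r + 1 < Y"
      by (auto simp: eventually_at_top_linorder)
    have "continuous_on {r..Y} g"
      using d by (meson DERIV_isCont continuous_at_imp_continuous_on)
    from continuous_attains_sup[OF _ _ this] Y obtain \<xi> where \<xi>: "\<xi> \<in> {r..Y}" "\<And>y. y \<in> {r..Y} \<Longrightarrow> g y \<le> g \<xi>"
      by (auto simp: compact_Icc)
    have "g (r + 1) \<le> g \<xi>" using \<xi>(2)[of "r + 1"] Y by simp
    then have "\<xi> \<noteq> r" "\<xi> \<noteq> Y" using r c Y by auto
    then have in1: "r < \<xi>" "\<xi> < Y" using \<xi>(1) by auto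
    have "g' \<xi> = 0"
    proof (rule DERIV_local_max[OF d])
      show "0 < min (\<xi> - r) (Y - \<xi>)" using in1 by simp
      show "\<forall>y. \<bar>\<xi> - y\<bar> < min (\<xi> - r) (Y - \<xi>) \<longrightarrow> g y \<le> g \<xi>"
        by (intro allI impI \<xi>(2)) (auto simp: abs_if split: if_splits)
    qed
    with in1 show ?thesis by blast
  qed
  consider "f (r + 1) = 0" | "0 < f (r + 1)" | "0 < - f (r + 1)" by linarith
  then show ?thesis
  proof cases
    case 1
    have "\<exists>z>r. z < r + 1 \<and> DERIV f z :> 0"
      by (rule Rolle) (use d r 1 in \<open>auto intro!: continuous_at_imp_continuous_on DERIV_isCont simp: real_differentiable_def\<close>)
    then show ?thesis using d DERIV_unique by blast
  next
    case 2
    then show ?thesis by (rule pos[OF d r lim])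
  next
    case 3
    have "\<exists>\<xi>>r. - f' \<xi> = 0"
      by (rule pos[of "\<lambda>x. - f x"]) (use d r 3 tendsto_minus[OF lim] in \<open>auto intro!: DERIV_minus\<close>)
    then show ?thesis by simp
  qed
qed

text \<open>Each zero gets a critical point before the next zero, and the last one gets its own from
  the decay at infinity, so the count does not drop by one as it does on a compact interval.\<close>

lemma Rolle_count:
  fixes f f' :: "real \<Rightarrow> real"
  assumes d: "\<And>x. (f has_real_derivative f' x) (at x)" and lim: "(f \<longlongrightarrow> 0) at_top"
    and R: "finite R" "\<And>x. x \<in> R \<Longrightarrow> f x = 0"
  shows "\<exists>S. finite S \<and> card S = card R \<and> (\<forall>x\<in>S. f' x = 0 \<and> (\<exists>r\<in>R. r < x))"
proof -
  have "\<exists>\<xi>. f' \<xi> = 0 \<and> r < \<xi> \<and> (\<forall>s\<in>R. r < s \<longrightarrow> \<xi> < s)" if r: "r \<in> R" for r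
  proof (cases "{s \<in> R. r < s} = {}")
    case True
    then show ?thesis using Rolle_at_top[OF d R(2)[OF r] lim] by auto
  next
    case False
    define s where "s = Min {s \<in> R. r < s}"
    have s: "s \<in> R" "r < s" "\<And>t. t \<in> R \<Longrightarrow> r < t \<Longrightarrow> s \<le> t"
      using Min_in[of "{s \<in> R. r < s}"] False R(1) by (auto simp: s_def)
    have "\<exists>z>r. z < s \<and> DERIV f z :> 0"
      by (rule Rolle) (use d s r R(2) in \<open>auto intro!: continuous_at_imp_continuous_on DERIV_isCont simp: real_differentiable_def\<close>)
    then show ?thesis using d DERIV_unique s(3) by (meson less_le_trans)
  qed
  then obtain \<xi> where \<xi>: "\<And>r. r \<in> R \<Longrightarrow> f' (\<xi> r) = 0 \<and> r < \<xi> r \<and> (\<forall>s\<in>R. r < s \<longrightarrow> \<xi> r < s)"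
    by metis
  have "inj_on \<xi> R"
  proof (rule inj_onI)
    fix r s assume "r \<in> R" "s \<in> R" "\<xi> r = \<xi> s"
    then show "r = s" using \<xi>[of r] \<xi>[of s] by (metis less_asym linorder_neqE_linordered_idom)
  qed
  then show ?thesis
    using \<xi> R(1) by (intro exI[of _ "\<xi> ` R"]) (auto simp: card_image)
qed

text \<open>Induction with a arbitrary: the factor x^(a+1) adds the zero 0 to the n positive zeros
  of L_n^(a+1), and the n + 1 critical points from \<open>Rolle_count\<close> are zeros of L_(n+1)^a
  by \<open>lag_poly_rec\<close>.\<close>

lemma laguerre_roots:
  "\<exists>S. finite S \<and> card S = n \<and> (\<forall>x\<in>S. 0 < x \<and> laguerre n (real a) x = 0)"
proof (induction n arbitrary: a)
  case 0
  then show ?case by (intro exI[of _ "{}"]) simp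
next
  case (Suc n)
  from Suc[of "Suc a"] obtain S where S: "finite S" "card S = n" "\<And>x. x \<in> S \<Longrightarrow> 0 < x \<and> poly (lag_poly n (Suc a)) x = 0"
    by (auto simp: poly_lag_poly)
  let ?q = "lag_poly n (Suc a)"
  define f where "f x = poly (monom 1 (Suc a) * ?q) x * exp (- x)" for x
  define f' where "f' x = x ^ a * exp (- x) * poly (pCons 0 (pderiv ?q) + [:real (Suc a), - 1:] * ?q) x" for x
  have d: "(f has_real_derivative f' x) (at x)" for x
  proof -
    have p: "((\<lambda>x. x ^ Suc a) has_real_derivative real (Suc a) * x ^ a) (at x)"
      using DERIV_pow[of "Suc a" x] by simp
    have e: "((\<lambda>x. exp (- x)) has_real_derivative - exp (- x)) (at x)"
      by (auto intro!: derivative_eq_intros)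
    have "((\<lambda>x. x ^ Suc a * poly ?q x * exp (- x)) has_real_derivative f' x) (at x)"
      by (rule DERIV_cong[OF DERIV_mult[OF DERIV_mult[OF p poly_DERIV] e]]) (simp add: f'_def algebra_simps)
    then show ?thesis by (simp add: f_def[abs_def] poly_monom)
  qed
  have lim: "(f \<longlongrightarrow> 0) at_top" unfolding f_def[abs_def] by (rule poly_exp_minus_tendsto_0)
  have "0 \<notin> S" using S(3) by force
  have "f x = 0" if "x \<in> insert 0 S" for x
    using that S(3)[of x] by (auto simp: f_def poly_monom)
  from Rolle_count[OF d lim _ this] S(1) obtain S' where S': "finite S'" "card S' = card (insert 0 S)"
    "\<And>x. x \<in> S' \<Longrightarrow> f' x = 0 \<and> (\<exists>r\<in>insert 0 S. r < x)"
    by (metis finite_insert)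
  have "0 < x \<and> laguerre (Suc n) (real a) x = 0" if "x \<in> S'" for x
  proof -
    have x: "0 < x" using S'(3)[OF that] S(3) by force
    have "f' x = 0" using S'(3)[OF that] by blast
    then have "poly (smult (real (Suc n)) (lag_poly (Suc n) a)) x = 0"
      unfolding lag_poly_rec f'_def using x by simp
    with x show ?thesis by (simp add: poly_lag_poly)
  qed
  moreover have "card S' = Suc n" using S'(2) S(1,2) \<open>0 \<notin> S\<close> by simp
  ultimately show ?case using S'(1) by blast
qed

section \<open>Interpolation of diagonals\<close>

text \<open>Subtracting x N times equation n from equation n + 1 eliminates the last node and leaves
  a smaller system for c' j = c j (x j - x N).\<close>

lemma vandermonde_solvable:
  fixes x :: "nat \<Rightarrow> complex"
  assumes "inj_on x {..<N}"
  shows "\<exists>c. \<forall>n<N. (\<Sum>j<N. c j * x j ^ n) = b n"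
  using assms
proof (induction N arbitrary: b)
  case 0
  then show ?case by simp
next
  case (Suc N)
  have "inj_on x {..<N}" using Suc.prems by (rule inj_on_subset) auto
  from Suc.IH[OF this, of "\<lambda>n. b (Suc n) - x N * b n"] obtain c' where
    c': "\<And>n. n < N \<Longrightarrow> (\<Sum>j<N. c' j * x j ^ n) = b (Suc n) - x N * b n" by blast
  \<comment> \<open>The last coefficient is set by the equation for n = 0; the other equations
    follow by induction on n.\<close>
  define c where "c j = (if j < N then c' j / (x j - x N) else b 0 - (\<Sum>j<N. c' j / (x j - x N)))" for j
  have ne: "x j - x N \<noteq> 0" if "j < N" for j
    using Suc.prems that by (auto simp: inj_on_def)
  have "(\<Sum>j<Suc N. c j * x j ^ n) = b n" if "n < Suc N" for n
    using that
  proof (induction n)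
    case 0
    show ?case by (simp add: c_def)
  next
    case (Suc n)
    have "(\<Sum>j<Suc N. c j * x j ^ Suc n) - x N * (\<Sum>j<Suc N. c j * x j ^ n) = (\<Sum>j<Suc N. c j * (x j - x N) * x j ^ n)"
      unfolding sum_distrib_left sum_subtractf[symmetric] by (intro sum.cong refl) (simp add: algebra_simps)
    also have "\<dots> = (\<Sum>j<N. c' j * x j ^ n)"
      using ne by (simp add: c_def)
    also have "\<dots> = b (Suc n) - x N * b n" using c' Suc.prems by simp
    finally show ?case using Suc by simp
  qed
  then show ?case by blast
qed

lemma triangular_solvable:
  fixes t :: "nat \<Rightarrow> nat \<Rightarrow> complex"
  assumes "\<And>n. t n n \<noteq> 0"
  shows "\<exists>b. \<forall>n<N. (\<Sum>i\<le>n. t n i * b i) = a n"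
proof (induction N)
  case 0
  then show ?case by simp
next
  case (Suc N)
  then obtain b where b: "\<And>n. n < N \<Longrightarrow> (\<Sum>i\<le>n. t n i * b i) = a n" by blast
  define b' where "b' = b(N := (a N - (\<Sum>i<N. t N i * b i)) / t N N)"
  have "(\<Sum>i\<le>n. t n i * b' i) = a n" if "n < Suc N" for n
  proof (cases "n = N")
    case True
    have "(\<Sum>i\<le>N. t N i * b' i) = (\<Sum>i<N. t N i * b' i) + t N N * b' N"
      by (simp add: lessThan_Suc_atMost[symmetric])
    also have "(\<Sum>i<N. t N i * b' i) = (\<Sum>i<N. t N i * b i)" by (intro sum.cong) (auto simp: b'_def)
    finally show ?thesis using True assms[of N] by (simp add: b'_def)
  next
    case False
    then have "(\<Sum>i\<le>n. t n i * b' i) = (\<Sum>i\<le>n. t n i * b i)"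
      using that by (intro sum.cong) (auto simp: b'_def)
    then show ?thesis using b False that by simp
  qed
  then show ?case by blast
qed

text \<open>Row n is a polynomial of exact degree n in the node, so prescribing the row values
  amounts to prescribing weighted power sums of the nodes; \<open>s j\<close> is absorbed into the
  coefficient.\<close>

lemma triangular_interpolation:
  fixes x :: "nat \<Rightarrow> complex" and t :: "nat \<Rightarrow> nat \<Rightarrow> complex" and s :: "nat \<Rightarrow> complex"
  assumes x: "inj_on x {..<N}" and t: "\<And>n. t n n \<noteq> 0" and s: "\<And>j. j < N \<Longrightarrow> s j \<noteq> 0"
    and w: "\<And>n j. j < N \<Longrightarrow> w n j = s j * (\<Sum>i\<le>n. t n i * x j ^ i)"
  shows "\<exists>c. \<forall>n<N. (\<Sum>j<N. c j * w n j) = a n"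
proof -
  obtain b where b: "\<And>n. n < N \<Longrightarrow> (\<Sum>i\<le>n. t n i * b i) = a n"
    using triangular_solvable[of t N a] t by blast
  obtain c where c: "\<And>n. n < N \<Longrightarrow> (\<Sum>j<N. c j * x j ^ n) = b n"
    using vandermonde_solvable[OF x, of b] by blast
  have "(\<Sum>j<N. (c j / s j) * w n j) = a n" if n: "n < N" for n
  proof -
    have "(\<Sum>j<N. (c j / s j) * w n j) = (\<Sum>j<N. \<Sum>i\<le>n. t n i * (c j * x j ^ i))"
      by (intro sum.cong refl) (simp add: w s sum_distrib_left mult_ac)
    also have "\<dots> = (\<Sum>i\<le>n. t n i * (\<Sum>j<N. c j * x j ^ i))"
      by (subst sum.swap) (simp add: sum_distrib_left)
    also have "\<dots> = (\<Sum>i\<le>n. t n i * b i)" using n c by (intro sum.cong) auto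
    finally show ?thesis using b[OF n] by simp
  qed
  then show ?thesis by (intro exI[of _ "\<lambda>j. c j / s j"]) blast
qed

text \<open>With l = p - i, row p of this diagonal is a common factor times a polynomial of exact
  degree p in r^2 (a multiple of a Laguerre polynomial with parameter d), the shape required by
  \<open>triangular_interpolation\<close>.\<close>

lemma wmat_lower:
  fixes r :: real
  shows "wmat (p + d) p (of_real r) = (of_real (exp (- r\<^sup>2 / 2)) * of_real r ^ d) *
    (\<Sum>l\<le>p. (of_real (sqrt (fact (p + d))) / of_real (sqrt (fact p)) * of_nat (p choose l) * (- 1) ^ l / fact (l + d)) * (of_real (r\<^sup>2)) ^ l)"
proof -
  have "(\<Sum>i\<le>p. if i \<le> p + d then of_nat (p choose i) * (- complex_of_real r) ^ (p - i) * cnj (of_real r) ^ (p + d - i) / fact (p + d - i) else 0)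
      = (\<Sum>l\<le>p. of_real r ^ d * (of_nat (p choose l) * (- 1) ^ l / fact (l + d) * (of_real (r\<^sup>2)) ^ l))"
  proof (rule sum.reindex_bij_witness[of _ "\<lambda>l. p - l" "\<lambda>i. p - i"])
    fix i assume i: "i \<in> {..p}"
    have pd: "p + d - i = (p - i) + d" using i by simp
    have e1: "cnj (complex_of_real r) ^ (p + d - i) = of_real r ^ (p - i) * of_real r ^ d"
      unfolding pd by (simp add: power_add)
    have e2: "(- complex_of_real r) ^ (p - i) = (- 1) ^ (p - i) * of_real r ^ (p - i)" by (rule power_minus)
    have e3: "(complex_of_real (r\<^sup>2)) ^ (p - i) = of_real r ^ (p - i) * of_real r ^ (p - i)"
      by (simp add: power2_eq_square power_mult_distrib)
    have e4: "p choose i = p choose (p - i)" by (rule binomial_symmetric) (use i in simp)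
    show "of_real r ^ d * (of_nat (p choose (p - i)) * (- 1) ^ (p - i) / fact (p - i + d) * complex_of_real (r\<^sup>2) ^ (p - i))
      = (if i \<le> p + d then of_nat (p choose i) * (- complex_of_real r) ^ (p - i) * cnj (complex_of_real r) ^ (p + d - i) / fact (p + d - i) else 0)"
      unfolding e1 e2 e3 e4[symmetric] unfolding pd using i by simp
  qed auto
  then show ?thesis
    unfolding wmat_def by (simp add: sum_distrib_left mult_ac)
qed

text \<open>The same shape above the main diagonal; the sign (-1)^d only changes the
  constants.\<close>

lemma wmat_upper:
  fixes r :: real
  shows "wmat p (p + d) (of_real r) = (of_real (exp (- r\<^sup>2 / 2)) * of_real r ^ d) *
    (\<Sum>l\<le>p. (of_real (sqrt (fact p)) / of_real (sqrt (fact (p + d))) * of_nat ((p + d) choose (p - l)) * (- 1) ^ (l + d) / fact l) * (of_real (r\<^sup>2)) ^ l)"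
proof -
  have "(\<Sum>i\<le>p + d. if i \<le> p then of_nat ((p + d) choose i) * (- complex_of_real r) ^ (p + d - i) * cnj (of_real r) ^ (p - i) / fact (p - i) else 0)
      = (\<Sum>i\<le>p. of_nat ((p + d) choose i) * (- complex_of_real r) ^ (p + d - i) * cnj (of_real r) ^ (p - i) / fact (p - i))"
    by (rule sum.mono_neutral_cong_right) auto
  also have "\<dots> = (\<Sum>l\<le>p. of_real r ^ d * (of_nat ((p + d) choose (p - l)) * (- 1) ^ (l + d) / fact l * (of_real (r\<^sup>2)) ^ l))"
  proof (rule sum.reindex_bij_witness[of _ "\<lambda>l. p - l" "\<lambda>i. p - i"])
    fix i assume i: "i \<in> {..p}"
    have "p + d - i = (p - i) + d" using i by simp
    moreover have "(- complex_of_real r) ^ (p - i + d) = (- 1) ^ (p - i + d) * (of_real r ^ (p - i) * of_real r ^ d)"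
      by (simp add: power_minus[of "complex_of_real r"] power_add)
    moreover have "(complex_of_real (r\<^sup>2)) ^ (p - i) = of_real r ^ (p - i) * of_real r ^ (p - i)"
      by (simp add: power2_eq_square power_mult_distrib)
    ultimately show "of_real r ^ d * (of_nat ((p + d) choose (p - (p - i))) * (- 1) ^ (p - i + d) / fact (p - i) * complex_of_real (r\<^sup>2) ^ (p - i))
      = of_nat ((p + d) choose i) * (- complex_of_real r) ^ (p + d - i) * cnj (complex_of_real r) ^ (p - i) / fact (p - i)"
      using i by simp
  qed auto
  finally show ?thesis
    unfolding wmat_def by (simp add: sum_distrib_left mult_ac)
qed

text \<open>The pair (p + nat D, p + nat (- D)) runs through the diagonal m - n = D with p = min m
  n, for either sign of D. Positive radii keep the factor r^d nonzero and make squaring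
  injective.\<close>

lemma wmat_interpolation:
  fixes r :: "nat \<Rightarrow> real"
  assumes r: "\<And>j. j < N \<Longrightarrow> 0 < r j" and inj: "inj_on r {..<N}"
  shows "\<exists>c. \<forall>p<N. (\<Sum>j<N. c j * wmat (p + nat D) (p + nat (- D)) (of_real (r j))) = a p"
proof -
  let ?s = "\<lambda>j. complex_of_real (exp (- (r j)\<^sup>2 / 2)) * of_real (r j) ^ nat \<bar>D\<bar>"
  have x: "inj_on (\<lambda>j. complex_of_real ((r j)\<^sup>2)) {..<N}"
    using inj r unfolding inj_on_def of_real_eq_iff by (simp add: power2_eq_iff_nonneg less_imp_le)
  have s: "?s j \<noteq> 0" if "j < N" for j using r[OF that] by simp
  show ?thesis
  proof (cases "0 \<le> D")
    case True
    then have D: "nat (- D) = 0" "nat \<bar>D\<bar> = nat D" by auto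
    show ?thesis unfolding D add_0_right
      by (rule triangular_interpolation[OF x _ s[unfolded D] wmat_lower]) (simp_all add: binomial_eq_0_iff)
  next
    case False
    then have D: "nat D = 0" "nat \<bar>D\<bar> = nat (- D)" by auto
    show ?thesis unfolding D add_0_right
      by (rule triangular_interpolation[OF x _ s[unfolded D] wmat_upper]) (simp_all add: binomial_eq_0_iff)
  qed
qed

text \<open>A rotation of \<xi> multiplies the entry by a character of weight n - m, so averaging
  over rotations singles out diagonals.\<close>

lemma wmat_rotation:
  assumes u: "cmod u = 1"
  shows "wmat m n (u * \<xi>) = u ^ n * cnj u ^ m * wmat m n \<xi>"
proof -
  have uu: "u * cnj u = 1" using u by (simp add: complex_norm_square[symmetric])
  have "(\<Sum>i\<le>n. if i \<le> m then of_nat (n choose i) * (- (u * \<xi>)) ^ (n - i) * cnj (u * \<xi>) ^ (m - i) / fact (m - i) else 0)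
      = (\<Sum>i\<le>n. u ^ n * cnj u ^ m * (if i \<le> m then of_nat (n choose i) * (- \<xi>) ^ (n - i) * cnj \<xi> ^ (m - i) / fact (m - i) else 0))"
  proof (intro sum.cong refl)
    fix i assume i: "i \<in> {..n}"
    show "(if i \<le> m then of_nat (n choose i) * (- (u * \<xi>)) ^ (n - i) * cnj (u * \<xi>) ^ (m - i) / fact (m - i) else 0)
      = u ^ n * cnj u ^ m * (if i \<le> m then of_nat (n choose i) * (- \<xi>) ^ (n - i) * cnj \<xi> ^ (m - i) / fact (m - i) else 0)"
    proof (cases "i \<le> m")
      case True
      have "u ^ n * cnj u ^ m = u ^ (n - i) * cnj u ^ (m - i) * (u * cnj u) ^ i"
      proof -
        have "u ^ (n - i) * u ^ i = u ^ n" "cnj u ^ (m - i) * cnj u ^ i = cnj u ^ m"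
          using i True by (simp_all add: power_add[symmetric])
        then show ?thesis unfolding power_mult_distrib by (metis mult.assoc mult.left_commute)
      qed
      then have "u ^ n * cnj u ^ m = u ^ (n - i) * cnj u ^ (m - i)" by (simp add: uu)
      moreover have "(- (u * \<xi>)) ^ (n - i) = u ^ (n - i) * (- \<xi>) ^ (n - i)"
        by (simp add: power_mult_distrib[symmetric])
      ultimately show ?thesis using True by (simp add: power_mult_distrib mult_ac)
    qed simp
  qed
  then show ?thesis
    unfolding wmat_def by (simp add: sum_distrib_left[symmetric] norm_mult u mult_ac)
qed

section \<open>Uniqueness for diagonals\<close>

text \<open>For p \<ge> N every monomial carries at least the power p - N of r; for smaller p the
  lowest power is N - p instead.\<close>

lemma ebas_real_factor:
  fixes r :: real
  assumes "N \<le> p"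
  shows "ebas N p (of_real r) = of_real r ^ (p - N) *
    (of_real (1 / sqrt (fact p * fact N)) * (\<Sum>i\<le>N. herm_coeff N p i * of_real r ^ (2 * (N - i))))"
proof -
  have "zmon (p - i) (N - i) (of_real r) = of_real r ^ (p - N) * of_real r ^ (2 * (N - i))" if "i \<le> N" for i
  proof -
    have "p - i + (N - i) = p - N + 2 * (N - i)" using that assms by simp
    then show ?thesis
      by (simp only: zmon_def complex_cnj_complex_of_real power_add[symmetric])
  qed
  then show ?thesis
    unfolding ebas_def herm_def by (simp add: sum_distrib_left mult_ac)
qed

text \<open>Divide by the power of r that belongs to the first nonzero index p0 and let r tend to 0:
  later terms carry extra factors r^2, and only a nonzero constant stays. By \<open>b0\<close> this
  p0 is at least N, where the orders increase; uniform convergence on [0, 1] justifies the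
  limit.\<close>

lemma diagonal_unique:
  fixes b :: "nat \<Rightarrow> complex"
  assumes bd: "\<And>p. cmod (b p) \<le> C" and b0: "\<And>p. p < N \<Longrightarrow> b p = 0"
    and z: "\<And>r::real. 0 < r \<Longrightarrow> r \<le> 1 \<Longrightarrow> (\<lambda>p. b p * ebas N p (of_real r) * ebas N (p + d) (of_real r)) sums 0"
  shows "b p = 0"
proof (rule ccontr)
  assume ne: "b p \<noteq> 0"
  define p0 where "p0 = (LEAST p. b p \<noteq> 0)"
  have p0: "b p0 \<noteq> 0" and lt: "\<And>p. p < p0 \<Longrightarrow> b p = 0"
    unfolding p0_def using LeastI[of "\<lambda>p. b p \<noteq> 0", OF ne] not_less_Least by blast+
  have N: "N \<le> p0" using b0 p0 by (meson not_le)
  define S where "S p = (\<Sum>i\<le>N. cmod (herm_coeff N p i)) / sqrt (fact p * fact N)" for p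
  have sumS: "summable S" unfolding S_def by (rule summable_ebas_bound)
  have S0: "0 \<le> S p" for p unfolding S_def by (simp add: sum_nonneg)
  define s where "s p r = complex_of_real (1 / sqrt (fact p * fact N)) * (\<Sum>i\<le>N. herm_coeff N p i * of_real r ^ (2 * (N - i)))" for p and r :: real
  have sS: "cmod (s p r) \<le> S p" if "r \<in> {0..1}" for p r
  proof -
    have "cmod (\<Sum>i\<le>N. herm_coeff N p i * of_real r ^ (2 * (N - i))) \<le> (\<Sum>i\<le>N. cmod (herm_coeff N p i) * 1)"
      using that by (intro sum_norm_le) (auto simp: norm_mult norm_power intro!: mult_left_le power_le_one)
    then have "(1 / sqrt (fact p * fact N)) * cmod (\<Sum>i\<le>N. herm_coeff N p i * of_real r ^ (2 * (N - i)))
        \<le> (1 / sqrt (fact p * fact N)) * (\<Sum>i\<le>N. cmod (herm_coeff N p i))"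
      by (intro mult_left_mono) auto
    then show ?thesis by (simp add: s_def S_def norm_mult norm_divide)
  qed
  have s_cont: "continuous_on A (s p)" for p A
    unfolding s_def[abs_def] by (intro continuous_intros)
  \<comment> \<open>At r = 0 only i = N is left, and its coefficient contains p choose N, which is
    nonzero.\<close>
  have s_0: "s p 0 \<noteq> 0" if "N \<le> p" for p
  proof -
    have "(\<Sum>i\<le>N. herm_coeff N p i * complex_of_real 0 ^ (2 * (N - i))) = (\<Sum>i\<in>{N}. herm_coeff N p i * complex_of_real 0 ^ (2 * (N - i)))"
      by (rule sum.mono_neutral_right) auto
    then show ?thesis using that by (simp add: s_def herm_coeff_def)
  qed
  obtain B where B: "\<And>p. S p \<le> B"
  proof -
    have "S p \<le> suminf S" for p using sum_le_suminf[OF sumS, of "{p}"] S0 by simp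
    then show ?thesis using that by blast
  qed
  define t where "t k r = of_real r ^ (2 * k) * (b (p0 + k) * s (p0 + k) r * s (p0 + k + d) r)" for k and r :: real
  have t_bd: "norm (t k r) \<le> C * (S (k + p0) * B)" if r: "r \<in> {0..1}" for k r
  proof -
    have "cmod (of_real r ^ (2 * k)) \<le> 1" using r by (auto simp: norm_power intro!: power_le_one)
    moreover have "cmod (b (p0 + k) * s (p0 + k) r * s (p0 + k + d) r) \<le> C * S (p0 + k) * B"
      unfolding norm_mult
      by (intro mult_mono bd sS[OF r] order_trans[OF sS[OF r] B]) (use S0 order_trans[OF norm_ge_zero bd] in \<open>auto intro!: mult_nonneg_nonneg\<close>)
    ultimately have "cmod (of_real r ^ (2 * k)) * cmod (b (p0 + k) * s (p0 + k) r * s (p0 + k + d) r) \<le> 1 * (C * S (p0 + k) * B)"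
      by (intro mult_mono) auto
    then show ?thesis by (simp add: t_def norm_mult add.commute mult_ac)
  qed
  have "summable (\<lambda>k. C * (S (k + p0) * B))"
    by (intro summable_mult summable_mult2 summable_ignore_initial_segment sumS)
  with t_bd have unif: "uniform_limit {0..1} (\<lambda>n r. \<Sum>k<n. t k r) (\<lambda>r. \<Sum>k. t k r) sequentially"
    by (intro Weierstrass_m_test[where M = "\<lambda>k. C * (S (k + p0) * B)"]) auto
  define g where "g r = (\<Sum>k. t k r)" for r
  have cont: "continuous_on {0..1} g"
    unfolding g_def
    by (rule uniform_limit_theorem[OF _ unif])
       (auto intro!: always_eventually continuous_intros s_cont simp: t_def)
  have g0: "g r = 0" if r: "0 < r" "r \<le> 1" for r
  proof -
    have "(\<lambda>p. b p * ebas N p (of_real r) * ebas N (p + d) (of_real r)) sums 0" by (rule z[OF r])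
    then have "(\<lambda>k. b (k + p0) * ebas N (k + p0) (of_real r) * ebas N (k + p0 + d) (of_real r)) sums 0"
      by (subst sums_zero_iff_shift) (auto simp: lt)
    moreover have "b (k + p0) * ebas N (k + p0) (of_real r) * ebas N (k + p0 + d) (of_real r)
        = of_real r ^ (2 * (p0 - N) + d) * t k r" for k
    proof -
      have "k + p0 - N + (k + p0 + d - N) = 2 * (p0 - N) + d + 2 * k" using N by simp
      then have "of_real r ^ (2 * (p0 - N) + d) * of_real r ^ (2 * k) = complex_of_real r ^ (k + p0 - N) * of_real r ^ (k + p0 + d - N)"
        by (simp only: power_add[symmetric])
      moreover have "ebas N (k + p0) (of_real r) = of_real r ^ (k + p0 - N) * s (k + p0) r"
        "ebas N (k + p0 + d) (of_real r) = of_real r ^ (k + p0 + d - N) * s (k + p0 + d) r"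
        unfolding s_def by (rule ebas_real_factor, use N in simp)+
      ultimately show ?thesis by (simp add: t_def add.commute[of p0 k] mult_ac)
    qed
    ultimately have "(\<lambda>k. of_real r ^ (2 * (p0 - N) + d) * t k r) sums 0" by simp
    then have "(\<lambda>k. t k r) sums 0" 
      using sums_mult_iff[of "complex_of_real r ^ (2 * (p0 - N) + d)" "\<lambda>k. t k r" 0] r by simp
    then show ?thesis by (simp add: g_def sums_iff)
  qed
  have "g 0 = b p0 * s p0 0 * s (p0 + d) 0"
  proof -
    have "(\<lambda>k. t k 0) = (\<lambda>k. if k = 0 then b p0 * s p0 0 * s (p0 + d) 0 else 0)"
      by (auto simp: t_def fun_eq_iff)
    then show ?thesis unfolding g_def using sums_single[of 0 "\<lambda>_. b p0 * s p0 0 * s (p0 + d) 0"] by (simp add: sums_iff)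
  qed
  then have "g 0 \<noteq> 0" using p0 s_0 N by simp
  have "(\<lambda>n. g (1 / real (Suc n))) \<longlonglongrightarrow> g 0"
  proof (rule continuous_on_tendsto_compose[OF cont])
    show "(\<lambda>n. 1 / real (Suc n)) \<longlonglongrightarrow> 0" by (rule LIMSEQ_inverse_real_of_nat[unfolded inverse_eq_divide])
  qed (auto intro!: always_eventually)
  then have "(\<lambda>n. 0 :: complex) \<longlonglongrightarrow> g 0" by (simp add: g0)
  then show False using \<open>g 0 \<noteq> 0\<close> LIMSEQ_unique tendsto_const by blast
qed

section \<open>Averages over roots of unity\<close>

text \<open>For k \<noteq> 0 the sum over the roots of unity of order M + 1 vanishes as soon as M +
  1 > |k|, so the sequence is eventually constant.\<close>

lemma root_average_tendsto:
  "(\<lambda>M. (\<Sum>l<Suc M. cis (2 * pi * real l * real_of_int k / real (Suc M))) / of_nat (Suc M)) \<longlonglongrightarrow> (if k = 0 then 1 else 0)"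
proof (cases "k = 0")
  case True
  then show ?thesis by (simp del: of_nat_Suc sum.lessThan_Suc)
next
  case False
  have "(\<Sum>l<Suc M. cis (2 * pi * real l * real_of_int k / real (Suc M))) = 0" if M: "nat \<bar>k\<bar> \<le> M" for M
  proof -
    define w where "w = cis (2 * pi * real_of_int k / real (Suc M))"
    have "w \<noteq> 1"
    proof
      assume "w = 1"
      then have "cos (2 * pi * real_of_int k / real (Suc M)) = 1" by (simp add: w_def complex_eq_iff)
      then obtain n :: int where "2 * pi * real_of_int k / real (Suc M) = real_of_int n * 2 * pi"
        unfolding cos_one_2pi_int by (auto simp: mult_ac)
      then have "2 * pi * real_of_int k = real_of_int n * 2 * pi * real (Suc M)"
        by (simp add: divide_eq_eq del: of_nat_Suc)
      then have "(2 * pi) * real_of_int k = (2 * pi) * (real_of_int n * real (Suc M))"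
        by (simp only: mult_ac)
      then have "real_of_int k = real_of_int n * real (Suc M)"
        by (simp del: of_nat_Suc)
      then have "k = n * int (Suc M)"
        by (metis of_int_eq_iff of_int_mult of_int_of_nat_eq)
      then have "int (Suc M) dvd k" by simp
      then have "int (Suc M) \<le> \<bar>k\<bar>" using dvd_imp_le_int[OF False, of "int (Suc M)"] by simp
      then show False using M by simp
    qed
    have "cis (2 * pi * real l * real_of_int k / real (Suc M)) = w ^ l" for l
      by (simp add: w_def Complex.DeMoivre mult_ac)
    then have "(\<Sum>l<Suc M. cis (2 * pi * real l * real_of_int k / real (Suc M))) = (\<Sum>l<Suc M. w ^ l)" by simp
    also have "\<dots> = (w ^ Suc M - 1) / (w - 1)" using \<open>w \<noteq> 1\<close> by (rule geometric_sum)
    also have "w ^ Suc M = cis (2 * pi * real_of_int k)"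
      unfolding w_def Complex.DeMoivre by (simp add: field_simps del: of_nat_Suc)
    also have "cis (2 * pi * real_of_int k) = 1" by (rule cis_multiple_2pi) simp
    finally show ?thesis by simp
  qed
  then have "\<forall>\<^sub>F M in sequentially. (\<Sum>l<Suc M. cis (2 * pi * real l * real_of_int k / real (Suc M))) / of_nat (Suc M) = 0"
    unfolding eventually_sequentially by (intro exI[of _ "nat \<bar>k\<bar>"]) (auto simp del: of_nat_Suc sum.lessThan_Suc)
  then show ?thesis using False by (simp add: tendsto_eventually)
qed

section \<open>Matrices of bounded operators\<close>

context hilbert_basis
begin

lemma ip_sums:
  assumes f: "f \<in> H" and g: "g \<in> H"
  shows "(\<lambda>n. ip f (e n) * cnj (ip g (e n))) sums ip f g"
proof -
  have "ip (trunc K f) g = (\<Sum>n<K. ip f (e n) * cnj (ip g (e n)))" for K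
    unfolding trunc_def by (subst ip_lincomb[OF basis_mem g]) (simp add: ip_cnj[of "e _" g])
  then show ?thesis using blf_trunc_tendsto[OF blf_ip[OF g] f] by (simp add: sums_def)
qed

lemma bessel_basis:
  assumes f: "f \<in> H" and I: "finite I"
  shows "(\<Sum>n\<in>I. (cmod (ip f (e n)))\<^sup>2) \<le> (nrm f)\<^sup>2"
  using sum_le_suminf[OF sums_summable[OF parseval[OF f]] I] parseval[OF f] by (simp add: sums_iff)

lemma op_bound_mono: "op_bound C A \<Longrightarrow> C \<le> C' \<Longrightarrow> op_bound C' A"
  unfolding op_bound_def by (meson mult_right_mono nrm_nonneg order_trans)

lemma op_bound_entry:
  assumes "op_bound C A"
  shows "cmod (ip (A (e n)) (e m)) \<le> C"
proof -
  have AB: "A \<in> bounded_ops H" using assms by (simp add: op_bound_def)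
  have "cmod (ip (A (e n)) (e m)) \<le> nrm (A (e n)) * nrm (e m)"
    by (rule Cauchy_Schwarz[OF bounded_opsD(1)[OF AB basis_mem] basis_mem])
  also have "\<dots> = nrm (A (e n))" by (simp add: nrm_basis)
  also have "\<dots> \<le> C * nrm (e n)" using assms basis_mem[of n] unfolding op_bound_def by blast
  finally show ?thesis by (simp add: nrm_basis)
qed

lemma op_eq_zero:
  assumes A: "A \<in> bounded_ops H" and 0: "\<And>m n. ip (A (e n)) (e m) = 0" and f: "f \<in> H"
  shows "A f = (\<lambda>z. 0)"
proof (rule basis_total[OF bounded_opsD(1)[OF A f]])
  fix m
  obtain g where g: "g \<in> H" and eq: "\<forall>f\<in>H. ip (A f) (e m) = ip f g"
    using bexE[OF adjoint[OF A basis_mem[of m]]] .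
  have "ip (e n) g = 0" for n
    using bspec[OF eq basis_mem[of n]] 0[of n m] by simp
  then have "ip g (e n) = 0" for n unfolding ip_cnj[of g "e n"] by simp
  then have "g = (\<lambda>z. 0)" by (rule basis_total[OF g])
  then show "ip (A f) (e m) = 0" using eq f by simp
qed

text \<open>A weighted shift carrying the single diagonal m - n = D. The index map m -> m - D is
  injective, so bounded weights give a bounded operator; the condition D \<le> int m guards the
  truncation of \<open>nat\<close>.\<close>

lemma shift_op:
  fixes D :: int
  assumes \<beta>: "\<And>m. cmod (\<beta> m) \<le> C"
  shows "\<exists>B. op_bound C B \<and>
    (\<forall>f\<in>H. \<forall>m. ip (B f) (e m) = (if D \<le> int m then \<beta> m * ip f (e (nat (int m - D))) else 0))"
proof -
  define c where "c f m = (if D \<le> int m then \<beta> m * ip f (e (nat (int m - D))) else 0)" for f m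
  have C: "0 \<le> C" using order_trans[OF norm_ge_zero \<beta>] .
  have bd: "(\<Sum>m<K. (cmod (c f m))\<^sup>2) \<le> (C * nrm f)\<^sup>2" if f: "f \<in> H" for f K
  proof -
    define S where "S = {m. m < K \<and> D \<le> int m}"
    have inj: "inj_on (\<lambda>m. nat (int m - D)) S" by (rule inj_onI) (auto simp: S_def)
    have "(\<Sum>m<K. (cmod (c f m))\<^sup>2) = (\<Sum>m\<in>S. (cmod (c f m))\<^sup>2)"
      by (rule sum.mono_neutral_right) (auto simp: S_def c_def)
    also have "\<dots> \<le> (\<Sum>m\<in>S. C\<^sup>2 * (cmod (ip f (e (nat (int m - D)))))\<^sup>2)"
      using \<beta> by (intro sum_mono) (auto simp: S_def c_def norm_mult power_mult_distrib intro!: mult_right_mono power_mono)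
    also have "\<dots> = C\<^sup>2 * (\<Sum>n\<in>(\<lambda>m. nat (int m - D)) ` S. (cmod (ip f (e n)))\<^sup>2)"
      by (simp add: sum_distrib_left sum.reindex[OF inj])
    also have "\<dots> \<le> C\<^sup>2 * (nrm f)\<^sup>2"
      by (intro mult_left_mono bessel_basis f) (auto simp: S_def)
    finally show ?thesis by (simp add: power_mult_distrib)
  qed
  have "\<exists>F\<in>H. \<forall>m. ip F (e m) = c f m" if f: "f \<in> H" for f
    by (intro synthesis summableI_nonneg_bounded[where x = "(C * nrm f)\<^sup>2"] bd f) auto
  then obtain B0 where B0: "\<And>f. f \<in> H \<Longrightarrow> B0 f \<in> H \<and> (\<forall>m. ip (B0 f) (e m) = c f m)" by metis
  define B where "B = restrict B0 H"
  have BH: "B f \<in> H" and Bc: "ip (B f) (e m) = c f m" if "f \<in> H" for f m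
    using B0[OF that] that by (auto simp: B_def)
  have nB: "nrm (B f) \<le> C * nrm f" if f: "f \<in> H" for f
  proof (rule power2_le_imp_le)
    have "(\<lambda>m. (cmod (c f m))\<^sup>2) sums (nrm (B f))\<^sup>2" using parseval[OF BH[OF f]] by (simp add: Bc[OF f])
    then show "(nrm (B f))\<^sup>2 \<le> (C * nrm f)\<^sup>2"
      using bd[OF f] by (auto simp: sums_def intro: LIMSEQ_le_const2)
  qed (use C in simp)
  have "B \<in> bounded_ops H"
  proof (rule bounded_opsI[OF BH _ _ _ nB])
    show "B (\<lambda>z. f z + g z) = (\<lambda>z. B f z + B g z)" if "f \<in> H" "g \<in> H" for f g
      using that by (intro eqI) (auto simp: BH Bc add_mem ip_add basis_mem c_def algebra_simps)
    show "B (\<lambda>z. a * f z) = (\<lambda>z. a * B f z)" if "f \<in> H" for a f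
      using that by (intro eqI) (auto simp: BH Bc scale_mem ip_scale_left c_def)
  qed (auto simp: B_def)
  then show ?thesis using nB C Bc by (intro exI[of _ B]) (auto simp: op_bound_def c_def)
qed

text \<open>Weights of total modulus at most 1 keep the bound C, which is what averages over roots
  of unity require.\<close>

lemma bform_lincomb:
  assumes F: "\<And>i. i \<in> I \<Longrightarrow> bform C (F i)" and c: "(\<Sum>i\<in>I. cmod (c i)) \<le> 1" and C: "0 \<le> C"
  shows "bform C (\<lambda>f g. \<Sum>i\<in>I. c i * F i f g)"
proof (rule bformI[OF C])
  fix f g assume "f \<in> H" "g \<in> H"
  then have "cmod (F i f g) \<le> C * nrm f * nrm g" if "i \<in> I" for i
    using F[OF that] by (auto simp: bform_def blf_def mult_ac)
  then have "cmod (\<Sum>i\<in>I. c i * F i f g) \<le> (\<Sum>i\<in>I. cmod (c i) * (C * nrm f * nrm g))"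
    by (intro sum_norm_le) (auto simp: norm_mult intro!: mult_left_mono)
  also have "\<dots> \<le> 1 * (C * nrm f * nrm g)"
    unfolding sum_distrib_right[symmetric] using c C by (intro mult_right_mono) auto
  finally show "cmod (\<Sum>i\<in>I. c i * F i f g) \<le> C * nrm f * nrm g" by simp
next
  fix f g h assume H: "f \<in> H" "g \<in> H" "h \<in> H"
  have "F i (\<lambda>z. f z + g z) h = F i f h + F i g h" if "i \<in> I" for i
    using F[OF that] H by (auto simp: bform_def blf_def)
  then show "(\<Sum>i\<in>I. c i * F i (\<lambda>z. f z + g z) h) = (\<Sum>i\<in>I. c i * F i f h) + (\<Sum>i\<in>I. c i * F i g h)"
    by (simp add: sum.distrib[symmetric] distrib_left)
next
  fix f g h assume H: "f \<in> H" "g \<in> H" "h \<in> H"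
  have "F i h (\<lambda>z. f z + g z) = F i h f + F i h g" if "i \<in> I" for i
  proof -
    have "cnj (F i h (\<lambda>z. f z + g z)) = cnj (F i h f) + cnj (F i h g)"
      using F[OF that] H by (auto simp: bform_def blf_def)
    then show ?thesis by (metis complex_cnj_add complex_cnj_cancel_iff)
  qed
  then show "(\<Sum>i\<in>I. c i * F i h (\<lambda>z. f z + g z)) = (\<Sum>i\<in>I. c i * F i h f) + (\<Sum>i\<in>I. c i * F i h g)"
    by (simp add: sum.distrib[symmetric] distrib_left)
next
  fix a f h assume H: "f \<in> H" "h \<in> H"
  have "F i (\<lambda>z. a * f z) h = a * F i f h" if "i \<in> I" for i
    using F[OF that] H by (auto simp: bform_def blf_def)
  then show "(\<Sum>i\<in>I. c i * F i (\<lambda>z. a * f z) h) = a * (\<Sum>i\<in>I. c i * F i f h)"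
    by (simp add: sum_distrib_left mult_ac)
next
  fix a f h assume H: "f \<in> H" "h \<in> H"
  have "F i h (\<lambda>z. a * f z) = cnj a * F i h f" if "i \<in> I" for i
  proof -
    have "cnj (F i h (\<lambda>z. a * f z)) = a * cnj (F i h f)"
      using F[OF that] H by (auto simp: bform_def blf_def)
    then show ?thesis by (metis complex_cnj_mult complex_cnj_cnj)
  qed
  then show "(\<Sum>i\<in>I. c i * F i h (\<lambda>z. a * f z)) = cnj a * (\<Sum>i\<in>I. c i * F i h f)"
    by (simp add: sum_distrib_left mult_ac)
qed

lemma bform_double_sum:
  assumes F: "bform C F"
  shows "F (\<lambda>z. \<Sum>k<K. a k * e k z) (\<lambda>z. \<Sum>m<L. b m * e m z) = (\<Sum>k<K. \<Sum>m<L. a k * cnj (b m) * F (e k) (e m))"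
proof -
  define g where "g = (\<lambda>z. \<Sum>m<L. b m * e m z)"
  have gH: "g \<in> H" unfolding g_def by (intro lincomb_mem basis_mem)
  have 1: "blf (C * nrm g) (\<lambda>f. F f g)" and 2: "blf (C * nrm (e k)) (\<lambda>g. cnj (F (e k) g))" for k
    using F gH basis_mem by (auto simp: bform_def)
  have "F (e k) g = (\<Sum>m<L. cnj (b m) * F (e k) (e m))" for k
  proof -
    have "cnj (F (e k) g) = (\<Sum>m<L. b m * cnj (F (e k) (e m)))"
      unfolding g_def by (rule blf_lincomb[OF 2 basis_mem])
    then have "cnj (cnj (F (e k) g)) = cnj (\<Sum>m<L. b m * cnj (F (e k) (e m)))" by (rule arg_cong)
    then show ?thesis by simp
  qed
  moreover have "F (\<lambda>z. \<Sum>k<K. a k * e k z) g = (\<Sum>k<K. a k * F (e k) g)"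
    by (rule blf_lincomb[OF 1 basis_mem])
  ultimately show ?thesis
    unfolding g_def[symmetric] by (simp add: sum_distrib_left mult.assoc)
qed

text \<open>The Fejer weight \<open>1 - \<bar>m - k\<bar> / n\<close> is \<open>1 / n\<close> times the number of windows
  \<open>{i..<i + n}\<close> containing both indices, so the Fejer mean is an average of the
  compressions of \<open>A\<close> to windows of consecutive basis vectors.\<close>

lemma fejer_op_bound:
  assumes A: "op_bound C A" and X: "op_bound C' X" and n: "0 < n"
    and entries: "\<And>k m. ip (X (e k)) (e m) = of_real (max 0 (1 - \<bar>real m - real k\<bar> / real n)) * ip (A (e k)) (e m)"
  shows "op_bound C X"
proof -
  have C: "0 \<le> C" using A by (simp add: op_bound_def)
  have XB: "X \<in> bounded_ops H" using X by (simp add: op_bound_def)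
  note bA = op_bound_bform[OF A] and bX = op_bound_bform[OF X]
  have fin: "cmod (ip (X (trunc K f)) (trunc K g)) \<le> C * nrm f * nrm g" if f: "f \<in> H" and g: "g \<in> H" for f g K
  proof -
    define Q where "Q i = {i..<i + n}" for i :: nat
    \<comment> \<open>\<open>P q\<close> keeps the coefficients with q - n < i \<le> q, a window of
      length n; the range q < K + n covers all windows that meet {..<K}.\<close>
    define P where "P q h = (\<lambda>z. \<Sum>i<K. (if q \<in> Q i then ip h (e i) else 0) * e i z)" for q h
    have PH: "P q h \<in> H" for q h unfolding P_def by (intro lincomb_mem basis_mem)
    have card: "real (card {q. q < K + n \<and> q \<in> Q k \<and> q \<in> Q m}) = real n * max 0 (1 - \<bar>real m - real k\<bar> / real n)"
      if "k < K" "m < K" for k m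
    proof -
      have "{q. q < K + n \<and> q \<in> Q k \<and> q \<in> Q m} = {max k m..<min k m + n}"
        using that by (auto simp: Q_def)
      then have "real (card {q. q < K + n \<and> q \<in> Q k \<and> q \<in> Q m}) = real (min k m + n - max k m)" by simp
      also have "\<dots> = max 0 (real n - \<bar>real m - real k\<bar>)" by (auto simp: max_def min_def)
      also have "\<dots> = real n * max 0 (1 - \<bar>real m - real k\<bar> / real n)"
        using n by (auto simp: max_def field_simps)
      finally show ?thesis .
    qed
    have "(\<Sum>q<K + n. ip (A (P q f)) (P q g))
        = (\<Sum>q<K + n. \<Sum>k<K. \<Sum>m<K. if q \<in> Q k \<and> q \<in> Q m then ip f (e k) * cnj (ip g (e m)) * ip (A (e k)) (e m) else 0)"
      unfolding P_def bform_double_sum[OF bA] by (intro sum.cong refl) auto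
    also have "\<dots> = (\<Sum>k<K. \<Sum>q<K + n. \<Sum>m<K. if q \<in> Q k \<and> q \<in> Q m then ip f (e k) * cnj (ip g (e m)) * ip (A (e k)) (e m) else 0)"
      by (rule sum.swap)
    also have "\<dots> = (\<Sum>k<K. \<Sum>m<K. \<Sum>q<K + n. if q \<in> Q k \<and> q \<in> Q m then ip f (e k) * cnj (ip g (e m)) * ip (A (e k)) (e m) else 0)"
      by (rule sum.cong[OF refl sum.swap])
    also have "\<dots> = (\<Sum>k<K. \<Sum>m<K. of_nat n * (ip f (e k) * cnj (ip g (e m)) * ip (X (e k)) (e m)))"
    proof (intro sum.cong refl)
      fix k m assume km: "k \<in> {..<K}" "m \<in> {..<K}"
      let ?c = "ip f (e k) * cnj (ip g (e m)) * ip (A (e k)) (e m)"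
      have "(\<Sum>q<K + n. if q \<in> Q k \<and> q \<in> Q m then ?c else 0) = of_nat (card {q. q < K + n \<and> q \<in> Q k \<and> q \<in> Q m}) * ?c"
        by (subst sum.If_cases) (auto simp: Int_def lessThan_def)
      also have "of_nat (card {q. q < K + n \<and> q \<in> Q k \<and> q \<in> Q m}) = complex_of_real (real n * max 0 (1 - \<bar>real m - real k\<bar> / real n))"
        unfolding card[OF km[unfolded lessThan_iff], symmetric] by (simp only: of_real_of_nat_eq)
      finally show "(\<Sum>q<K + n. if q \<in> Q k \<and> q \<in> Q m then ?c else 0)
          = of_nat n * (ip f (e k) * cnj (ip g (e m)) * ip (X (e k)) (e m))"
        unfolding entries by (simp add: mult_ac)
    qed
    also have "\<dots> = of_nat n * ip (X (trunc K f)) (trunc K g)"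
      unfolding trunc_def bform_double_sum[OF bX] by (simp add: sum_distrib_left)
    finally have eq: "of_nat n * ip (X (trunc K f)) (trunc K g) = (\<Sum>q<K + n. ip (A (P q f)) (P q g))" ..
    \<comment> \<open>Every index lies in exactly n windows.\<close>
    have Pn: "(\<Sum>q<K + n. (nrm (P q h))\<^sup>2) \<le> real n * (nrm h)\<^sup>2" if h: "h \<in> H" for h
    proof -
      have "(\<Sum>q<K + n. (nrm (P q h))\<^sup>2) = (\<Sum>q<K + n. \<Sum>i<K. if q \<in> Q i then (cmod (ip h (e i)))\<^sup>2 else 0)"
        unfolding P_def by (subst nrm_lincomb_basis) (auto intro!: sum.cong)
      also have "\<dots> = (\<Sum>i<K. \<Sum>q<K + n. if q \<in> Q i then (cmod (ip h (e i)))\<^sup>2 else 0)"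
        by (rule sum.swap)
      also have "\<dots> = (\<Sum>i<K. real n * (cmod (ip h (e i)))\<^sup>2)"
      proof (intro sum.cong refl)
        fix i assume "i \<in> {..<K}"
        then have "{..<K + n} \<inter> {q. q \<in> Q i} = Q i" by (auto simp: Q_def)
        then show "(\<Sum>q<K + n. if q \<in> Q i then (cmod (ip h (e i)))\<^sup>2 else 0) = real n * (cmod (ip h (e i)))\<^sup>2"
          by (subst sum.If_cases) (auto simp: Q_def)
      qed
      also have "\<dots> \<le> real n * (nrm h)\<^sup>2"
        unfolding sum_distrib_left[symmetric] by (intro mult_left_mono bessel_basis h) auto
      finally show ?thesis .
    qed
    have "real n * cmod (ip (X (trunc K f)) (trunc K g)) = cmod (\<Sum>q<K + n. ip (A (P q f)) (P q g))"
      unfolding eq[symmetric] by (simp add: norm_mult)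
    also have "\<dots> \<le> (\<Sum>q<K + n. C * (\<bar>nrm (P q f)\<bar> * \<bar>nrm (P q g)\<bar>))"
    proof (rule sum_norm_le)
      fix q
      show "cmod (ip (A (P q f)) (P q g)) \<le> C * (\<bar>nrm (P q f)\<bar> * \<bar>nrm (P q g)\<bar>)"
        using bA PH unfolding bform_def blf_def by (auto simp: mult_ac)
    qed
    also have "\<dots> \<le> C * (L2_set (\<lambda>q. nrm (P q f)) {..<K + n} * L2_set (\<lambda>q. nrm (P q g)) {..<K + n})"
      unfolding sum_distrib_left[symmetric] by (intro mult_left_mono L2_set_mult_ineq C)
    also have "\<dots> \<le> C * (sqrt (real n * (nrm f)\<^sup>2) * sqrt (real n * (nrm g)\<^sup>2))"
      unfolding L2_set_def by (intro mult_left_mono mult_mono real_sqrt_le_mono Pn f g C) (auto intro!: sum_nonneg)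
    also have "\<dots> = real n * (C * nrm f * nrm g)"
      by (simp add: real_sqrt_mult)
    finally show ?thesis using n by simp
  qed
  \<comment> \<open>The bound for truncations passes to the limit; the crude constant C' of X
    provides the continuity.\<close>
  have form: "cmod (ip (X f) g) \<le> C * nrm f * nrm g" if f: "f \<in> H" and g: "g \<in> H" for f g
  proof (rule LIMSEQ_le_const2)
    have b1: "blf (C' * nrm g) (\<lambda>f. ip (X f) g)" using bX g by (auto simp: bform_def)
    have "(\<lambda>K. ip (X (trunc K f)) (trunc K g)) \<longlonglongrightarrow> ip (X f) g"
    proof -
      have "(\<lambda>K. ip (X (trunc K f)) (trunc K g) - ip (X (trunc K f)) g) \<longlonglongrightarrow> 0"
      proof (rule Lim_null_comparison)
        show "(\<lambda>K. (C' * nrm f) * nrm (\<lambda>z. g z - trunc K g z)) \<longlonglongrightarrow> 0"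
          using tendsto_mult_left[OF trunc_tendsto[OF g], of "C' * nrm f"] by simp
        have "norm (ip (X (trunc K f)) (trunc K g) - ip (X (trunc K f)) g) \<le> (C' * nrm f) * nrm (\<lambda>z. g z - trunc K g z)" for K
        proof -
          have "ip (X (trunc K f)) (trunc K g) - ip (X (trunc K f)) g = - ip (X (trunc K f)) (\<lambda>z. g z - trunc K g z)"
            by (simp add: ip_diff'[OF g trunc_mem bounded_opsD(1)[OF XB trunc_mem]])
          then have "norm (ip (X (trunc K f)) (trunc K g) - ip (X (trunc K f)) g) \<le> nrm (X (trunc K f)) * nrm (\<lambda>z. g z - trunc K g z)"
            using Cauchy_Schwarz[OF bounded_opsD(1)[OF XB trunc_mem] diff_mem[OF g trunc_mem]] by simp
          also have "nrm (X (trunc K f)) \<le> C' * nrm f"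
            using X trunc_mem[of K f] nrm_trunc_le[OF f, of K] unfolding op_bound_def
            by (meson mult_left_mono order_trans)
          finally show ?thesis by (simp add: mult_right_mono)
        qed
        then show "\<forall>\<^sub>F K in sequentially. norm (ip (X (trunc K f)) (trunc K g) - ip (X (trunc K f)) g) \<le> (C' * nrm f) * nrm (\<lambda>z. g z - trunc K g z)"
          by (intro always_eventually allI)
      qed
      from tendsto_add[OF this blf_trunc_tendsto[OF b1 f]] show ?thesis by simp
    qed
    then show "(\<lambda>K. cmod (ip (X (trunc K f)) (trunc K g))) \<longlonglongrightarrow> cmod (ip (X f) g)" by (rule tendsto_norm)
  qed (use fin[OF f g] in auto)
  \<comment> \<open>Taking g = X f turns the form bound into an operator bound.\<close>
  have "nrm (X f) \<le> C * nrm f" if f: "f \<in> H" for f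
  proof -
    have "cmod (ip (X f) (X f)) \<le> C * nrm f * nrm (X f)" by (rule form[OF f bounded_opsD(1)[OF XB f]])
    then have "nrm (X f) * nrm (X f) \<le> (C * nrm f) * nrm (X f)"
      unfolding ip_self norm_of_real by (simp add: power2_eq_square)
    then show ?thesis using nrm_nonneg[of "X f"] C by (cases "nrm (X f) = 0") (auto simp: mult_le_cancel_right)
  qed
  then show ?thesis using C XB by (simp add: op_bound_def)
qed

text \<open>\<open>op_span\<close> sums over a set of operators, so the coefficients of equal
  members of the family are first added up.\<close>

lemma op_span_lincomb:
  assumes I: "finite I" and W: "\<And>i. i \<in> I \<Longrightarrow> W i \<in> X"
  shows "(\<lambda>f\<in>H. \<lambda>w. \<Sum>i\<in>I. c i * W i f w) \<in> op_span H X"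
proof -
  define c' where "c' B = (\<Sum>i\<in>{i \<in> I. W i = B}. c i)" for B
  have "(\<Sum>i\<in>I. c i * W i f w) = (\<Sum>B\<in>W ` I. c' B * B f w)" for f w
    unfolding c'_def sum_distrib_right
    by (subst sum.image_gen[OF I, of _ W]) (auto intro!: sum.cong)
  then have "(\<lambda>f\<in>H. \<lambda>w. \<Sum>i\<in>I. c i * W i f w) = (\<lambda>f\<in>H. \<lambda>w. \<Sum>B\<in>W ` I. c' B * B f w)" by simp
  then show ?thesis
    unfolding op_span_def using I W by (intro CollectI exI[of _ "W ` I"] exI[of _ c']) auto
qed

end

section \<open>Operators with vanishing Berezin transform\<close>

text \<open>All monomials of \<open>herm N n\<close> have rotation weight n - N.\<close>

lemma ebas_unimodular:
  assumes v: "cmod v = 1"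
  shows "ebas N n (v * z) = v ^ n * cnj v ^ N * ebas N n z"
proof -
  have vv: "v * cnj v = 1" using v by (simp add: complex_norm_square[symmetric])
  have "herm_coeff N n i * zmon (n - i) (N - i) (v * z) = v ^ n * cnj v ^ N * (herm_coeff N n i * zmon (n - i) (N - i) z)"
    if "i \<le> N" for i
  proof (cases "i \<le> n")
    case True
    have "v ^ n = v ^ (n - i) * v ^ i" "cnj v ^ N = cnj v ^ (N - i) * cnj v ^ i"
      using True that by (simp_all add: power_add[symmetric])
    then have "v ^ n * cnj v ^ N = v ^ (n - i) * cnj v ^ (N - i) * (v * cnj v) ^ i"
      unfolding power_mult_distrib by (simp only: mult_ac)
    then have "v ^ n * cnj v ^ N = v ^ (n - i) * cnj v ^ (N - i)" by (simp add: vv)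
    then show ?thesis by (simp add: zmon_def power_mult_distrib mult_ac)
  qed (simp add: herm_coeff_eq_0)
  then have "herm N n (v * z) = v ^ n * cnj v ^ N * herm N n z"
    unfolding herm_def sum_distrib_left by (intro sum.cong) auto
  then show ?thesis by (simp add: ebas_def mult_ac)
qed

lemma cnj_ebas_real: "cnj (ebas N n (of_real r)) = ebas N n (of_real r)"
  by (simp add: ebas_def herm_def zmon_def)

lemma ip_nkernel_ebas:
  "ip (nkernel (Suc N) z) (ebas N n) = of_real (exp (- (cmod z)\<^sup>2 / 2)) * cnj (ebas N n z)"
  unfolding ip_cnj[of "nkernel (Suc N) z"] ip_nkernel[OF ebas_true_fock] by simp

lemma isCont_nkernel: "isCont (\<lambda>z. nkernel (Suc N) z w) z"
  unfolding nkernel_def laguerre_def by (intro continuous_intros) auto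

lemma ip_nkernel_self: "ip (nkernel (Suc N) z) (nkernel (Suc N) z) = 1"
  by (simp add: ip_self nrm_nkernel)

definition berezin :: "nat \<Rightarrow> ((complex \<Rightarrow> complex) \<Rightarrow> (complex \<Rightarrow> complex)) \<Rightarrow> complex \<Rightarrow> complex" where
  "berezin N A z = ip (A (nkernel (Suc N) z)) (nkernel (Suc N) z)"

text \<open>Vanishing is pointwise here; \<open>Psi_kernel\<close> reconciles it with equality
  almost everywhere through continuity.\<close>

definition berezin_kernel :: "nat \<Rightarrow> ((complex \<Rightarrow> complex) \<Rightarrow> (complex \<Rightarrow> complex)) set" where
  "berezin_kernel N = {A \<in> bounded_ops (true_fock (Suc N)). \<forall>z. berezin N A z = 0}"

context
  fixes N :: nat
begin

interpretation hilbert_basis "true_fock (Suc N)" "ebas N"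
  by (rule true_fock_hilbert_basis)

lemma berezin_bound:
  assumes A: "op_bound C A"
  shows "cmod (berezin N A z) \<le> C"
proof -
  have "cmod (berezin N A z) \<le> C * nrm (nkernel (Suc N) z) * nrm (nkernel (Suc N) z)"
    using op_bound_bform[OF A] nkernel_true_fock[of N z]
    unfolding berezin_def bform_def blf_def by (auto simp: mult_ac)
  then show ?thesis by (simp add: nrm_nkernel)
qed

text \<open>The squared distance of two unit vectors is 2 - 2 Re of their product, and by
  \<open>ip_nkernel\<close> this product is an explicit continuous function of z.\<close>

lemma nkernel_norm_continuous:
  "((\<lambda>z. nrm (\<lambda>v. nkernel (Suc N) z v - nkernel (Suc N) w v)) \<longlongrightarrow> 0) (at w)"
proof -
  let ?k = "nkernel (Suc N)"
  note kH = nkernel_true_fock[of N]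
  have eq: "(nrm (\<lambda>v. ?k z v - ?k w v))\<^sup>2 = 2 - 2 * Re (ip (?k z) (?k w))" for z
  proof -
    have d: "(\<lambda>v. ?k z v - ?k w v) \<in> true_fock (Suc N)" by (intro diff_mem kH)
    have "ip (\<lambda>v. ?k z v - ?k w v) (\<lambda>v. ?k z v - ?k w v) = 2 - (ip (?k z) (?k w) + cnj (ip (?k z) (?k w)))"
      unfolding ip_diff[OF kH kH d] ip_diff'[OF kH kH kH] ip_nkernel_self ip_cnj[of "?k w" "?k z"] by simp
    also have "\<dots> = of_real (2 - 2 * Re (ip (?k z) (?k w)))" by (simp add: complex_add_cnj)
    finally show ?thesis unfolding ip_self of_real_eq_iff .
  qed
  have "((\<lambda>z. ip (?k z) (?k w)) \<longlongrightarrow> ip (?k w) (?k w)) (at w)"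
    unfolding ip_nkernel[OF kH] using isCont_nkernel[where N = N and w = w and z = w]
    by (intro tendsto_mult tendsto_const) (simp add: isCont_def)
  then have "((\<lambda>z. sqrt (2 - 2 * Re (ip (?k z) (?k w)))) \<longlongrightarrow> sqrt (2 - 2 * Re (ip (?k w) (?k w)))) (at w)"
    by (intro tendsto_intros)
  moreover have "nrm (\<lambda>v. ?k z v - ?k w v) = sqrt (2 - 2 * Re (ip (?k z) (?k w)))" for z
    unfolding eq[symmetric] by simp
  ultimately show ?thesis by (simp add: ip_nkernel_self)
qed

lemma berezin_continuous:
  assumes A: "A \<in> bounded_ops (true_fock (Suc N))"
  shows "continuous_on UNIV (berezin N A)"
proof -
  let ?k = "nkernel (Suc N)"
  note kH = nkernel_true_fock[of N]
  obtain C where C: "op_bound C A" using bounded_ops_op_bound[OF A] .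
  have fb: "cmod (ip (A f) g) \<le> C * nrm f * nrm g" if "f \<in> true_fock (Suc N)" "g \<in> true_fock (Suc N)" for f g
    using op_bound_bform[OF C] that unfolding bform_def blf_def by (auto simp: mult_ac)
  have "isCont (berezin N A) w" for w
  proof -
    let ?d = "\<lambda>z v. ?k z v - ?k w v"
    have "((\<lambda>z. berezin N A z - berezin N A w) \<longlongrightarrow> 0) (at w)"
    proof (rule Lim_null_comparison)
      have "((\<lambda>z. 2 * C * nrm (?d z)) \<longlongrightarrow> 2 * C * 0) (at w)"
        by (intro tendsto_mult tendsto_const nkernel_norm_continuous)
      then show "((\<lambda>z. 2 * C * nrm (?d z)) \<longlongrightarrow> 0) (at w)" by simp
      have "cmod (berezin N A z - berezin N A w) \<le> 2 * C * nrm (?d z)" for z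
      proof -
        have d: "?d z \<in> true_fock (Suc N)" by (intro diff_mem kH)
        have b: "blf (C * nrm (?k z)) (\<lambda>f. ip (A f) (?k z))"
          using op_bound_bform[OF C] kH by (auto simp: bform_def)
        have "ip (A (?d z)) (?k z) = ip (A (?k z)) (?k z) - ip (A (?k w)) (?k z)"
          by (rule blf_diff[OF b kH kH])
        moreover have "ip (A (?k w)) (?d z) = ip (A (?k w)) (?k z) - ip (A (?k w)) (?k w)"
          by (rule ip_diff'[OF kH kH bounded_opsD(1)[OF A kH]])
        ultimately have e: "berezin N A z - berezin N A w = ip (A (?d z)) (?k z) + ip (A (?k w)) (?d z)"
          by (simp add: berezin_def)
        have "cmod (ip (A (?d z)) (?k z) + ip (A (?k w)) (?d z)) \<le> C * nrm (?d z) * nrm (?k z) + C * nrm (?k w) * nrm (?d z)"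
          by (rule order_trans[OF norm_triangle_ineq add_mono]) (intro fb d kH)+
        then show ?thesis unfolding e nrm_nkernel by (simp only: mult_1_right mult.assoc mult_2 distrib_right)
      qed
      then show "\<forall>\<^sub>F z in at w. norm (berezin N A z - berezin N A w) \<le> 2 * C * nrm (?d z)"
        by (intro always_eventually allI)
    qed
    then show ?thesis unfolding isCont_def by (rule LIM_zero_cancel)
  qed
  then show ?thesis by (simp add: continuous_at_imp_continuous_on)
qed

lemma closedin_berezin_kernel: "closedin (weak_star (true_fock (Suc N))) (berezin_kernel N)"
proof -
  have "berezin_kernel N = (\<Inter>z. {A \<in> bounded_ops (true_fock (Suc N)). berezin N A z = 0})"
    by (auto simp: berezin_kernel_def)
  then show ?thesis
    unfolding berezin_def
    by (auto intro!: closedin_INT closedin_weak_star_quadratic nkernel_true_fock nrm_nkernel)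
qed

lemma weyl_in_berezin_kernel:
  assumes "\<xi> \<in> Sigma_set (Suc N)"
  shows "restrict (weyl \<xi>) (true_fock (Suc N)) \<in> berezin_kernel N"
proof -
  let ?W = "restrict (weyl \<xi>) (true_fock (Suc N))"
  have "?W \<in> bounded_ops (true_fock (Suc N))" using weyl_op_bound[of N \<xi>] by (simp add: op_bound_def)
  moreover have "berezin N ?W z = 0" for z
  proof -
    have "nkernel (Suc N) z (z - \<xi>) = 0"
      using assms by (simp add: nkernel_def Sigma_set_def)
    then have "weyl \<xi> (nkernel (Suc N) z) z = 0" by (simp add: weyl_def)
    then show ?thesis
      by (simp add: berezin_def nkernel_true_fock ip_nkernel weyl_true_fock)
  qed
  ultimately show ?thesis by (simp add: berezin_kernel_def)
qed

text \<open>The rotation is defined through its matrix, as a diagonal operator from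
  \<open>shift_op\<close>. It carries the kernel at z to a unimodular multiple of the kernel at the
  rotated point, so conjugation by it preserves vanishing of the Berezin transform.\<close>

lemma rotation_exists:
  assumes u: "cmod u = 1"
  shows "\<exists>R. op_bound 1 R \<and> (\<forall>f\<in>true_fock (Suc N). \<forall>m. ip (R f) (ebas N m) = u ^ m * ip f (ebas N m)) \<and>
    (\<forall>z. R (nkernel (Suc N) z) = (\<lambda>w. u ^ N * nkernel (Suc N) (cnj u * z) w))"
proof -
  obtain R where R: "op_bound 1 R"
    and "\<forall>f\<in>true_fock (Suc N). \<forall>m. ip (R f) (ebas N m) = (if 0 \<le> int m then u ^ m * ip f (ebas N (nat (int m - 0))) else 0)"
    using shift_op[of "\<lambda>m. u ^ m" 1 0] u by (auto simp: norm_power)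
  then have Rc: "ip (R f) (ebas N m) = u ^ m * ip f (ebas N m)" if "f \<in> true_fock (Suc N)" for f m
    using that by simp
  have RB: "R \<in> bounded_ops (true_fock (Suc N))" using R by (simp add: op_bound_def)
  have uu: "u * cnj u = 1" using u by (simp add: complex_norm_square[symmetric])
  have "R (nkernel (Suc N) z) = (\<lambda>w. u ^ N * nkernel (Suc N) (cnj u * z) w)" for z
  proof (rule eqI)
    fix n
    have "u ^ N * (u ^ n * cnj u ^ N) = u ^ n * (u * cnj u) ^ N"
      unfolding power_mult_distrib by (simp only: mult_ac)
    then have s: "u ^ N * (u ^ n * cnj u ^ N) = u ^ n" by (simp add: uu)
    have e: "ebas N n (cnj u * z) = cnj u ^ n * u ^ N * ebas N n z"
      using ebas_unimodular[of "cnj u" N n z] u by simp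
    have "ip (\<lambda>w. u ^ N * nkernel (Suc N) (cnj u * z) w) (ebas N n)
        = of_real (exp (- (cmod z)\<^sup>2 / 2)) * ((u ^ N * (u ^ n * cnj u ^ N)) * cnj (ebas N n z))"
      unfolding ip_scale_left ip_nkernel_ebas e using u by (simp add: norm_mult)
    then show "ip (R (nkernel (Suc N) z)) (ebas N n) = ip (\<lambda>w. u ^ N * nkernel (Suc N) (cnj u * z) w) (ebas N n)"
      unfolding s Rc[OF nkernel_true_fock] ip_nkernel_ebas by simp
  qed (intro bounded_opsD(1)[OF RB] scale_mem nkernel_true_fock)+
  with R Rc show ?thesis by blast
qed

text \<open>Averaging the conjugates of \<open>A\<close> under the rotations by the roots of unity of order
  \<open>M\<close> with the character of weight \<open>D\<close> keeps the Berezin transform zero and converges,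
  as \<open>M\<close> grows, to the part of \<open>A\<close> on the diagonal \<open>D\<close>.\<close>

lemma berezin_kernel_diagonal_sums:
  fixes r :: real and D :: int
  assumes A: "A \<in> berezin_kernel N"
  shows "(\<lambda>p. ip (A (ebas N (p + nat (- D)))) (ebas N (p + nat D)) * ebas N p (of_real r) * ebas N (p + nat \<bar>D\<bar>) (of_real r)) sums 0"
proof -
  let ?H = "true_fock (Suc N)" and ?k = "nkernel (Suc N)" and ?e = "ebas N"
  have AB: "A \<in> bounded_ops ?H" and A0: "\<And>z. ip (A (?k z)) (?k z) = 0"
    using A by (auto simp: berezin_kernel_def berezin_def)
  obtain C where C: "op_bound C A" using bounded_ops_op_bound[OF AB] .
  note kH = nkernel_true_fock[of N]
  \<comment> \<open>For m < D the truncation of \<open>nat\<close> gives an entry off the diagonal,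
    but \<open>Bc\<close> discards it.\<close>
  define \<beta> where "\<beta> m = ip (A (?e (nat (int m - D)))) (?e m)" for m
  have "cmod (\<beta> m) \<le> C" for m unfolding \<beta>_def by (rule op_bound_entry[OF C])
  from shift_op[of \<beta>, OF this, of D] obtain B where B: "op_bound C B"
    and Bc: "\<And>f m. f \<in> ?H \<Longrightarrow> ip (B f) (?e m) = (if D \<le> int m then \<beta> m * ip f (?e (nat (int m - D))) else 0)"
    by blast
  define u where "u M l = cis (2 * pi * real l / real (Suc M))" for M l :: nat
  have u1: "cmod (u M l) = 1" for M l by (simp add: u_def)
  have "\<exists>R. \<forall>M l. op_bound 1 (R M l) \<and> (\<forall>f\<in>?H. \<forall>m. ip (R M l f) (?e m) = u M l ^ m * ip f (?e m)) \<and>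
    (\<forall>z. R M l (?k z) = (\<lambda>w. u M l ^ N * ?k (cnj (u M l) * z) w))"
    using rotation_exists[OF u1] by metis
  then obtain R where R1: "\<And>M l. op_bound 1 (R M l)"
    and Rc: "\<And>M l f m. f \<in> ?H \<Longrightarrow> ip (R M l f) (?e m) = u M l ^ m * ip f (?e m)"
    and Rk: "\<And>M l z. R M l (?k z) = (\<lambda>w. u M l ^ N * ?k (cnj (u M l) * z) w)"
    by blast
  have RB: "R M l \<in> bounded_ops ?H" for M l using R1 by (simp add: op_bound_def)
  note RH = bounded_opsD(1)[OF RB] and AH = bounded_opsD(1)[OF AB]
  \<comment> \<open>The character of weight D. Together with the rotations the exponent becomes D +
    n - m, which averages to 1 on the diagonal m - n = D and to 0 elsewhere.\<close>
  define w where "w M l = cis (2 * pi * real l * real_of_int D / real (Suc M)) / of_nat (Suc M)" for M l :: nat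
  define F where "F M f g = (\<Sum>l<Suc M. w M l * ip (A (R M l f)) (R M l g))" for M f g
  have C0: "0 \<le> C" using C by (simp add: op_bound_def)
  have bF: "bform C (F M)" for M
    unfolding F_def
  proof (rule bform_lincomb[OF _ _ C0])
    show "bform C (\<lambda>f g. ip (A (R M l f)) (R M l g))" for l
    proof (rule bformI[OF C0])
      fix f g assume f: "f \<in> ?H" and g: "g \<in> ?H"
      have "cmod (ip (A (R M l f)) (R M l g)) \<le> C * nrm (R M l f) * nrm (R M l g)"
        using op_bound_bform[OF C] RH[OF f] RH[OF g] unfolding bform_def blf_def by (auto simp: mult_ac)
      also have "\<dots> \<le> C * nrm f * nrm g"
        using R1[of M l] f g C0 by (intro mult_mono mult_left_mono) (auto simp: op_bound_def)
      finally show "cmod (ip (A (R M l f)) (R M l g)) \<le> C * nrm f * nrm g" .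
    qed (simp_all add: bounded_opsD(2,3)[OF RB] bounded_opsD(2,3)[OF AB] RH AH ip_add ip_add' ip_scale_left ip_scale_right)
    show "(\<Sum>l<Suc M. cmod (w M l)) \<le> 1"
      by (simp add: w_def norm_divide del: of_nat_Suc sum.lessThan_Suc)
  qed
  have Re: "R M l (?e n) = (\<lambda>z. u M l ^ n * ?e n z)" for M l n
    by (rule eqI) (auto simp: RH basis_mem scale_mem Rc ip_scale_left basis_orthonormal)
  have entry: "F M (?e n) (?e m) = (\<Sum>l<Suc M. cis (2 * pi * real l * real_of_int (D + int n - int m) / real (Suc M))) / of_nat (Suc M) * ip (A (?e n)) (?e m)" for M n m
  proof -
    have "w M l * ip (A (R M l (?e n))) (R M l (?e m))
      = cis (2 * pi * real l * real_of_int (D + int n - int m) / real (Suc M)) / of_nat (Suc M) * ip (A (?e n)) (?e m)" for l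
    proof -
      have "cis (2 * pi * real l * real_of_int D / real (Suc M)) * (u M l ^ n * cnj (u M l ^ m))
          = cis (2 * pi * real l * real_of_int (D + int n - int m) / real (Suc M))"
        unfolding u_def Complex.DeMoivre cis_cnj cis_mult
        by (intro arg_cong[where f = cis]) (simp add: field_simps del: of_nat_Suc)
      then show ?thesis
        unfolding Re bounded_opsD(3)[OF AB basis_mem] ip_scale_left ip_scale_right w_def
        by (simp add: mult_ac del: of_nat_Suc)
    qed
    then show ?thesis
      unfolding F_def by (simp add: sum_distrib_right sum_divide_distrib del: of_nat_Suc sum.lessThan_Suc)
  qed
  have "(\<lambda>M. F M (?k (of_real r)) (?k (of_real r))) \<longlonglongrightarrow> ip (B (?k (of_real r))) (?k (of_real r))"
  proof (rule bform_limit[OF bF op_bound_bform[OF B] _ kH kH])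
    fix m n
    have "(\<lambda>M. F M (?e n) (?e m)) \<longlonglongrightarrow> (if D + int n - int m = 0 then 1 else 0) * ip (A (?e n)) (?e m)"
      unfolding entry by (intro tendsto_mult root_average_tendsto tendsto_const)
    moreover have "ip (B (?e n)) (?e m) = (if D + int n - int m = 0 then 1 else 0) * ip (A (?e n)) (?e m)"
      by (auto simp: Bc basis_mem basis_orthonormal \<beta>_def)
    ultimately show "(\<lambda>M. F M (?e n) (?e m)) \<longlonglongrightarrow> ip (B (?e n)) (?e m)" by simp
  qed
  moreover have "F M (?k z) (?k z) = 0" for M z
    unfolding F_def Rk bounded_opsD(3)[OF AB kH] ip_scale_left ip_scale_right A0 by simp
  ultimately have "ip (B (?k (of_real r))) (?k (of_real r)) = 0"
    by (simp add: LIMSEQ_const_iff)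
  moreover have BB: "B \<in> bounded_ops ?H" using B by (simp add: op_bound_def)
  ultimately have s: "(\<lambda>m. ip (B (?k (of_real r))) (?e m) * cnj (ip (?k (of_real r)) (?e m))) sums 0"
    using ip_sums[OF bounded_opsD(1)[OF BB kH] kH, of "of_real r" "of_real r"] by simp
  define E where "E = complex_of_real (exp (- (cmod (of_real r :: complex))\<^sup>2 / 2))"
  have ke: "ip (?k (of_real r)) (?e m) = E * ?e m (of_real r)" for m
    unfolding ip_nkernel_ebas E_def cnj_ebas_real ..
  have "cnj E = E" by (simp add: E_def)
  \<comment> \<open>The Gaussian factors of both kernels combine to a nonzero constant that can be
    cancelled.\<close>
  have "(\<lambda>m. (E * E) * (if D \<le> int m then \<beta> m * ?e (nat (int m - D)) (of_real r) * ?e m (of_real r) else 0)) sums ((E * E) * 0)"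
    using s unfolding Bc[OF kH] ke complex_cnj_mult \<open>cnj E = E\<close> cnj_ebas_real
    by (simp add: if_distrib[of "\<lambda>x. x * _"] if_distrib[of "\<lambda>x. _ * x"] mult_ac cong: if_cong)
  moreover have "E * E \<noteq> 0" by (simp add: E_def)
  ultimately have t: "(\<lambda>m. if D \<le> int m then \<beta> m * ?e (nat (int m - D)) (of_real r) * ?e m (of_real r) else 0) sums 0"
    using sums_mult_iff by blast
  show ?thesis
  proof (cases "0 \<le> D")
    case True
    \<comment> \<open>For D \<ge> 0 the first nat D terms are zero, and the index is shifted past
      them.\<close>
    have "(\<lambda>p. if D \<le> int (p + nat D) then \<beta> (p + nat D) * ?e (nat (int (p + nat D) - D)) (of_real r) * ?e (p + nat D) (of_real r) else 0) sums 0"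
      using t by (subst sums_zero_iff_shift) (use True in auto)
    moreover have "nat (int (p + nat D) - D) = p" for p using True by simp
    ultimately show ?thesis using True by (simp add: \<beta>_def)
  next
    case False
    then have "nat (int p - D) = p + nat (- D)" "D \<le> int p" for p by auto
    with t show ?thesis using False by (simp add: \<beta>_def mult_ac)
  qed
qed

lemma wmat_bound: "cmod (wmat m n \<xi>) \<le> 1"
  using op_bound_entry[OF weyl_op_bound, of \<xi> n m] by (simp add: ebas_true_fock ip_weyl_ebas)

text \<open>The N coefficients match the first N entries of the diagonal, and the difference falls
  under \<open>diagonal_unique\<close> because both sides have vanishing transform. The coefficients
  depend on D but the radii do not; for N = 0 the empty sum says that every entry vanishes.\<close>

lemma berezin_kernel_diagonal:
  fixes r :: "nat \<Rightarrow> real" and D :: int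
  assumes A: "A \<in> berezin_kernel N"
    and r: "\<And>j. j < N \<Longrightarrow> 0 < r j" "inj_on r {..<N}" "\<And>j. j < N \<Longrightarrow> laguerre N 0 ((r j)\<^sup>2) = 0"
  shows "\<exists>c. \<forall>m n. int m - int n = D \<longrightarrow> ip (A (ebas N n)) (ebas N m) = (\<Sum>j<N. c j * wmat m n (of_real (r j)))"
proof -
  let ?m = "\<lambda>p. p + nat D" and ?n = "\<lambda>p. p + nat (- D)"
  let ?a = "\<lambda>p. ip (A (ebas N (?n p))) (ebas N (?m p))"
  obtain c where c: "\<And>p. p < N \<Longrightarrow> (\<Sum>j<N. c j * wmat (?m p) (?n p) (of_real (r j))) = ?a p"
    using wmat_interpolation[OF r(1,2), of D ?a] by blast
  define b where "b p = ?a p - (\<Sum>j<N. c j * wmat (?m p) (?n p) (of_real (r j)))" for p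
  have AB: "A \<in> bounded_ops (true_fock (Suc N))" using A by (simp add: berezin_kernel_def)
  obtain C where C: "op_bound C A" using bounded_ops_op_bound[OF AB] .
  have "b p = 0" for p
  proof (rule diagonal_unique[where C = "C + (\<Sum>j<N. cmod (c j))" and d = "nat \<bar>D\<bar>" and N = N])
    show "cmod (b p) \<le> C + (\<Sum>j<N. cmod (c j))" for p
    proof -
      have "cmod (\<Sum>j<N. c j * wmat (?m p) (?n p) (of_real (r j))) \<le> (\<Sum>j<N. cmod (c j))"
        using wmat_bound by (intro sum_norm_le) (auto simp: norm_mult intro!: mult_left_le)
      then show ?thesis
        unfolding b_def using norm_triangle_ineq4[of "?a p" "\<Sum>j<N. c j * wmat (?m p) (?n p) (of_real (r j))"]
          op_bound_entry[OF C, of "?n p" "?m p"] by linarith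
    qed
    show "b p = 0" if "p < N" for p using c[OF that] by (simp add: b_def)
    fix x :: real
    let ?q = "\<lambda>p. ebas N p (of_real x) * ebas N (p + nat \<bar>D\<bar>) (of_real x)"
    have "(\<lambda>p. wmat (?m p) (?n p) (of_real (r j)) * ?q p) sums 0" if "j < N" for j
    proof -
      have "complex_of_real (r j) \<in> Sigma_set (Suc N)" using r(3)[OF that] by (simp add: Sigma_set_def)
      from berezin_kernel_diagonal_sums[OF weyl_in_berezin_kernel[OF this], of D x]
      show ?thesis by (simp add: ebas_true_fock ip_weyl_ebas mult.assoc)
    qed
    then have "(\<lambda>p. \<Sum>j<N. c j * (wmat (?m p) (?n p) (of_real (r j)) * ?q p)) sums (\<Sum>j<N. c j * 0)"
      by (intro sums_sum sums_mult) auto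
    moreover have "(\<lambda>p. ?a p * ?q p) sums 0"
      using berezin_kernel_diagonal_sums[OF A, of D x] by (simp add: mult.assoc)
    ultimately have "(\<lambda>p. ?a p * ?q p - (\<Sum>j<N. c j * (wmat (?m p) (?n p) (of_real (r j)) * ?q p))) sums (0 - (\<Sum>j<N. c j * 0))"
      by (intro sums_diff)
    moreover have "?a p * ?q p - (\<Sum>j<N. c j * (wmat (?m p) (?n p) (of_real (r j)) * ?q p))
        = b p * ebas N p (of_real x) * ebas N (p + nat \<bar>D\<bar>) (of_real x)" for p
      unfolding b_def by (simp add: left_diff_distrib sum_distrib_right mult.assoc)
    ultimately show "(\<lambda>p. b p * ebas N p (of_real x) * ebas N (p + nat \<bar>D\<bar>) (of_real x)) sums 0" by simp
  qed
  then have "?a p = (\<Sum>j<N. c j * wmat (?m p) (?n p) (of_real (r j)))" for p by (simp add: b_def)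
  then have "ip (A (ebas N n)) (ebas N m) = (\<Sum>j<N. c j * wmat m n (of_real (r j)))" if "int m - int n = D" for m n
  proof -
    have "m = min m n + nat D" "n = min m n + nat (- D)" using that by auto
    then show ?thesis using \<open>\<And>p. ?a p = _ p\<close> by metis
  qed
  then show ?thesis by blast
qed

lemma exists_radii:
  "\<exists>r. (\<forall>j<N. 0 < r j) \<and> inj_on r {..<N} \<and> (\<forall>j<N. laguerre N 0 ((r j)\<^sup>2) = 0)"
proof -
  obtain S where S: "finite S" "card S = N" "\<And>x. x \<in> S \<Longrightarrow> 0 < x \<and> laguerre N 0 x = 0"
    using laguerre_roots[of N 0] by auto
  obtain g where g: "bij_betw g {..<N} S"
    using ex_bij_betw_nat_finite[OF S(1)] S(2) by (auto simp: atLeast0LessThan)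
  then have gS: "g j \<in> S" if "j < N" for j using that by (auto simp: bij_betw_def)
  have "inj_on (\<lambda>j. sqrt (g j)) {..<N}"
    using g by (auto simp: bij_betw_def inj_on_def)
  then show ?thesis
    using gS S(3) by (intro exI[of _ "\<lambda>j. sqrt (g j)"]) (auto simp: less_imp_le)
qed

lemma op_span_subset_berezin_kernel:
  "op_span (true_fock (Suc N)) {restrict (weyl \<xi>) (true_fock (Suc N)) | \<xi>. \<xi> \<in> Sigma_set (Suc N)} \<subseteq> berezin_kernel N"
proof
  fix A assume "A \<in> op_span (true_fock (Suc N)) {restrict (weyl \<xi>) (true_fock (Suc N)) | \<xi>. \<xi> \<in> Sigma_set (Suc N)}"
  then obtain S c where A: "A = (\<lambda>f\<in>true_fock (Suc N). \<lambda>w. \<Sum>B\<in>S. c B * B f w)" "finite S"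
    and S: "S \<subseteq> {restrict (weyl \<xi>) (true_fock (Suc N)) | \<xi>. \<xi> \<in> Sigma_set (Suc N)}"
    unfolding op_span_def by blast
  have BK: "B \<in> berezin_kernel N" and B1: "op_bound 1 B" if "B \<in> S" for B
    using S that weyl_in_berezin_kernel weyl_op_bound by blast+
  have "op_bound (\<Sum>B\<in>S. cmod (c B) * 1) A"
    unfolding A(1) by (rule lincomb_op_bound[where B = "\<lambda>B. B", OF B1])
  then have "A \<in> bounded_ops (true_fock (Suc N))" by (simp add: op_bound_def)
  moreover have "berezin N A z = 0" for z
  proof -
    have "berezin N A z = (\<Sum>B\<in>S. c B * ip (B (nkernel (Suc N) z)) (nkernel (Suc N) z))"
      unfolding berezin_def A(1)
      by (rule ip_lincomb_op[where B = "\<lambda>B. B"]) (use B1 nkernel_true_fock in \<open>auto simp: op_bound_def\<close>)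
    also have "\<dots> = 0"
      using BK by (intro sum.neutral) (auto simp: berezin_kernel_def berezin_def)
    finally show ?thesis .
  qed
  ultimately show "A \<in> berezin_kernel N" by (simp add: berezin_kernel_def)
qed

text \<open>Two limits with different bounds. For fixed n, averages Y M of Weyl operators tend to
  the Fejer mean X n under a bound K that may depend on n; then X n tends to A under the bound C of
  A, by \<open>fejer_op_bound\<close>. \<open>weak_star_closure_limit\<close> chains them.\<close>

lemma berezin_kernel_subset_closure:
  "berezin_kernel N \<subseteq> weak_star (true_fock (Suc N)) closure_of
    op_span (true_fock (Suc N)) {restrict (weyl \<xi>) (true_fock (Suc N)) | \<xi>. \<xi> \<in> Sigma_set (Suc N)}"
proof
  let ?H = "true_fock (Suc N)" and ?e = "ebas N"
  let ?X = "{restrict (weyl \<xi>) ?H | \<xi>. \<xi> \<in> Sigma_set (Suc N)}"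
  let ?cl = "weak_star ?H closure_of op_span ?H ?X"
  fix A assume A: "A \<in> berezin_kernel N"
  then have AB: "A \<in> bounded_ops ?H" by (simp add: berezin_kernel_def)
  obtain C where C: "op_bound C A" using bounded_ops_op_bound[OF AB] .
  obtain r where r: "\<And>j. j < N \<Longrightarrow> 0 < r j" "inj_on r {..<N}" "\<And>j. j < N \<Longrightarrow> laguerre N 0 ((r j)\<^sup>2) = 0"
    using exists_radii by blast
  have "\<forall>D. \<exists>c. \<forall>m n. int m - int n = D \<longrightarrow> ip (A (?e n)) (?e m) = (\<Sum>j<N. c j * wmat m n (of_real (r j)))"
    using berezin_kernel_diagonal[OF A r] by blast
  then obtain c where c: "\<And>D m n. int m - int n = D \<Longrightarrow> ip (A (?e n)) (?e m) = (\<Sum>j<N. c D j * wmat m n (of_real (r j)))"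
    by metis
  have "\<exists>B. op_bound C B \<and> (\<forall>m n. ip (B (?e n)) (?e m) = (if int m - int n = D then ip (A (?e n)) (?e m) else 0))" for D :: int
  proof -
    have "cmod (ip (A (?e (nat (int m - D)))) (?e m)) \<le> C" for m by (rule op_bound_entry[OF C])
    from shift_op[of "\<lambda>m. ip (A (?e (nat (int m - D)))) (?e m)", OF this, of D]
    obtain B where "op_bound C B" and Bc: "\<And>f m. f \<in> ?H \<Longrightarrow> ip (B f) (?e m)
        = (if D \<le> int m then ip (A (?e (nat (int m - D)))) (?e m) * ip f (?e (nat (int m - D))) else 0)"
      by blast
    moreover have "ip (B (?e n)) (?e m) = (if int m - int n = D then ip (A (?e n)) (?e m) else 0)" for m n
      unfolding Bc[OF basis_mem] by (auto simp: basis_orthonormal)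
    ultimately show ?thesis by blast
  qed
  then obtain AD where AD: "\<And>D. op_bound C (AD D)"
    and ADe: "\<And>D m n. ip (AD D (?e n)) (?e m) = (if int m - int n = D then ip (A (?e n)) (?e m) else 0)"
    by metis
  have ADB: "AD D \<in> bounded_ops ?H" for D using AD by (simp add: op_bound_def)
  define \<tau> where "\<tau> n D = 1 - real_of_int \<bar>D\<bar> / real (Suc n)" for n :: nat and D :: int
  define X where "X n = (\<lambda>f\<in>?H. \<lambda>w. \<Sum>D\<in>{- int n..int n}. of_real (\<tau> n D) * AD D f w)" for n
  have X1: "op_bound (\<Sum>D\<in>{- int n..int n}. cmod (of_real (\<tau> n D)) * C) (X n)" for n
    unfolding X_def by (rule lincomb_op_bound[OF AD])
  have Xe: "ip (X n (?e k)) (?e m) = (if \<bar>int m - int k\<bar> \<le> int n then of_real (\<tau> n (int m - int k)) * ip (A (?e k)) (?e m) else 0)" for n m k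
  proof -
    have "ip (X n (?e k)) (?e m) = (\<Sum>D\<in>{- int n..int n}. if int m - int k = D then of_real (\<tau> n D) * ip (A (?e k)) (?e m) else 0)"
      unfolding X_def by (subst ip_lincomb_op[OF ADB basis_mem basis_mem], rule sum.cong[OF refl], simp add: ADe)
    moreover have "int m - int k \<in> {- int n..int n} \<longleftrightarrow> \<bar>int m - int k\<bar> \<le> int n" by auto
    ultimately show ?thesis by (simp only: sum.delta'[OF finite_atLeastAtMost_int])
  qed
  \<comment> \<open>The weight 1 - |m - k| / (n + 1) is nonpositive off the band, so
    \<open>max 0\<close> gives one formula for all entries, in the form that
    \<open>fejer_op_bound\<close> expects.\<close>
  have Xe': "ip (X n (?e k)) (?e m) = of_real (max 0 (1 - \<bar>real m - real k\<bar> / real (Suc n))) * ip (A (?e k)) (?e m)" for n m k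
  proof -
    have abs: "real_of_int \<bar>int m - int k\<bar> = \<bar>real m - real k\<bar>" by simp
    show ?thesis
    proof (cases "\<bar>int m - int k\<bar> \<le> int n")
      case True
      then have "real_of_int \<bar>int m - int k\<bar> \<le> real n" by linarith
      then have "0 \<le> 1 - \<bar>real m - real k\<bar> / real (Suc n)" unfolding abs by (simp add: field_simps)
      then show ?thesis unfolding Xe \<tau>_def abs using True by simp
    next
      case False
      then have "real (Suc n) \<le> real_of_int \<bar>int m - int k\<bar>" by linarith
      then have "1 - \<bar>real m - real k\<bar> / real (Suc n) \<le> 0" unfolding abs by (simp add: field_simps)
      then show ?thesis unfolding Xe using False by (simp add: max_absorb1)
    qed
  qed
  have XC: "op_bound C (X n)" for n
    by (rule fejer_op_bound[OF C X1[of n], where n = "Suc n"]) (simp_all only: Xe' zero_less_Suc)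
  have X_closure: "X n \<in> ?cl" for n
  proof -
    define u where "u M l = cis (2 * pi * real l / real (Suc M))" for M l :: nat
    define I where "I M = {- int n..int n} \<times> {..<N} \<times> {..<Suc M}" for M :: nat
    \<comment> \<open>Fejer weight, interpolation coefficient for the diagonal D, and the averaging
      character that selects D.\<close>
    define \<kappa> where "\<kappa> M = (\<lambda>(D, j, l). of_real (\<tau> n D) * c D j * (cis (2 * pi * real l * real_of_int D / real (Suc M)) / of_nat (Suc M)))" for M :: nat
    define W where "W M = (\<lambda>(D::int, j, l). restrict (weyl (u M l * of_real (r j))) ?H)" for M
    define Y where "Y M = (\<lambda>f\<in>?H. \<lambda>w. \<Sum>i\<in>I M. \<kappa> M i * W M i f w)" for M
    have finI: "finite (I M)" for M by (simp add: I_def)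
    have W1: "op_bound 1 (W M i)" for M i by (auto simp: W_def weyl_op_bound split: prod.split)
    have WB: "W M i \<in> bounded_ops ?H" for M i using W1 by (simp add: op_bound_def)
    have "W M i \<in> ?X" if "i \<in> I M" for M i
    proof -
      obtain D j l where i: "i = (D, j, l)" by (cases i rule: prod_cases3)
      with that have j: "j < N" by (simp add: I_def)
      have "u M l * of_real (r j) \<in> Sigma_set (Suc N)"
        using r(1,3)[OF j] by (simp add: Sigma_set_def u_def norm_mult)
      then show ?thesis unfolding i W_def by auto
    qed
    then have Y_span: "Y M \<in> op_span ?H ?X" for M
      unfolding Y_def by (intro op_span_lincomb finI)
    \<comment> \<open>The M + 1 averaging weights have modulus 1 / (M + 1) each, so this bound is
      free of M.\<close>
    define K where "K = (\<Sum>D\<in>{- int n..int n}. \<Sum>j<N. cmod (of_real (\<tau> n D) * c D j))"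
    have Y1: "op_bound K (Y M)" for M
    proof -
      have "(\<Sum>i\<in>I M. cmod (\<kappa> M i) * 1) = (\<Sum>D\<in>{- int n..int n}. \<Sum>j<N. \<Sum>l<Suc M. cmod (of_real (\<tau> n D) * c D j) / real (Suc M))"
        unfolding I_def \<kappa>_def sum.cartesian_product'
        by (simp add: norm_mult norm_divide del: of_nat_Suc sum.lessThan_Suc)
      also have "\<dots> = K" unfolding K_def by (simp del: of_nat_Suc sum.lessThan_Suc)
      finally show ?thesis
        using lincomb_op_bound[of "I M" "\<lambda>_. 1" "W M" "\<kappa> M", OF W1] unfolding Y_def by simp
    qed
    have Ye: "ip (Y M (?e k)) (?e m) = (\<Sum>D\<in>{- int n..int n}. \<Sum>j<N. of_real (\<tau> n D) * c D j * wmat m k (of_real (r j)) *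
        ((\<Sum>l<Suc M. cis (2 * pi * real l * real_of_int (D + int k - int m) / real (Suc M))) / of_nat (Suc M)))" for M k m
    proof -
      have "ip (Y M (?e k)) (?e m) = (\<Sum>i\<in>I M. \<kappa> M i * ip (W M i (?e k)) (?e m))"
        unfolding Y_def by (rule ip_lincomb_op[OF WB basis_mem basis_mem])
      also have "\<dots> = (\<Sum>D\<in>{- int n..int n}. \<Sum>j<N. \<Sum>l<Suc M. of_real (\<tau> n D) * c D j * wmat m k (of_real (r j)) *
          (cis (2 * pi * real l * real_of_int (D + int k - int m) / real (Suc M)) / of_nat (Suc M)))"
        unfolding I_def sum.cartesian_product'
      proof (intro sum.cong refl)
        fix D j l
        have "cis (2 * pi * real l * real_of_int D / real (Suc M)) * (u M l ^ k * cnj (u M l) ^ m)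
            = cis (2 * pi * real l * real_of_int (D + int k - int m) / real (Suc M))"
          unfolding u_def cis_cnj Complex.DeMoivre cis_mult
          by (intro arg_cong[where f = cis]) (simp add: field_simps del: of_nat_Suc)
        moreover have "ip (W M (D, j, l) (?e k)) (?e m) = u M l ^ k * cnj (u M l) ^ m * wmat m k (of_real (r j))"
          by (simp add: W_def ebas_true_fock ip_weyl_ebas wmat_rotation u_def)
        ultimately show "\<kappa> M (D, j, l) * ip (W M (D, j, l) (?e k)) (?e m) = of_real (\<tau> n D) * c D j * wmat m k (of_real (r j)) *
          (cis (2 * pi * real l * real_of_int (D + int k - int m) / real (Suc M)) / of_nat (Suc M))"
          unfolding \<kappa>_def by (simp add: mult_ac del: of_nat_Suc)
      qed
      finally show ?thesis by (simp only: sum_distrib_left sum_divide_distrib)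
    qed
    show ?thesis
    proof (rule weak_star_closure_limit)
      show "op_bound (max K C) (Y M)" for M by (rule op_bound_mono[OF Y1]) simp
      show "op_bound (max K C) (X n)" by (rule op_bound_mono[OF XC]) simp
      show "Y M \<in> ?cl" for M
      proof -
        have "op_span ?H ?X \<subseteq> topspace (weak_star ?H)"
          using op_span_subset_berezin_kernel by (auto simp: topspace_weak_star berezin_kernel_def)
        then show ?thesis using Y_span closure_of_subset by blast
      qed
      fix m k
      have "(\<lambda>M. ip (Y M (?e k)) (?e m)) \<longlonglongrightarrow> (\<Sum>D\<in>{- int n..int n}. \<Sum>j<N. of_real (\<tau> n D) * c D j * wmat m k (of_real (r j)) *
          (if D + int k - int m = 0 then 1 else 0))"
        unfolding Ye by (intro tendsto_sum tendsto_mult_left root_average_tendsto)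
      \<comment> \<open>On the selected diagonal the sum over j is the interpolation formula for the
        entry of A.\<close>
      also have "(\<Sum>D\<in>{- int n..int n}. \<Sum>j<N. of_real (\<tau> n D) * c D j * wmat m k (of_real (r j)) * (if D + int k - int m = 0 then 1 else 0))
          = (\<Sum>D\<in>{- int n..int n}. if int m - int k = D then of_real (\<tau> n D) * ip (A (?e k)) (?e m) else 0)"
      proof (intro sum.cong refl)
        fix D
        show "(\<Sum>j<N. of_real (\<tau> n D) * c D j * wmat m k (of_real (r j)) * (if D + int k - int m = 0 then 1 else 0))
          = (if int m - int k = D then of_real (\<tau> n D) * ip (A (?e k)) (?e m) else 0)"
          by (auto simp: c[of m k D] sum_distrib_left mult.assoc)
      qed
      also have "\<dots> = ip (X n (?e k)) (?e m)"
        unfolding Xe by (auto simp: abs_le_iff)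
      finally show "(\<lambda>M. ip (Y M (?e k)) (?e m)) \<longlonglongrightarrow> ip (X n (?e k)) (?e m)" .
    qed
  qed
  show "A \<in> ?cl"
  proof (rule weak_star_closure_limit[OF XC C _ X_closure])
    fix m k
    have "(\<lambda>n. \<bar>real m - real k\<bar> * (1 / real (Suc n))) \<longlonglongrightarrow> \<bar>real m - real k\<bar> * 0"
      by (intro tendsto_mult_left LIMSEQ_inverse_real_of_nat[unfolded inverse_eq_divide])
    then have "(\<lambda>n. max 0 (1 - \<bar>real m - real k\<bar> * (1 / real (Suc n)))) \<longlonglongrightarrow> max 0 (1 - \<bar>real m - real k\<bar> * 0)"
      by (intro tendsto_max tendsto_diff tendsto_const)
    then have "(\<lambda>n. of_real (max 0 (1 - \<bar>real m - real k\<bar> / real (Suc n))) * ip (A (?e k)) (?e m)) \<longlonglongrightarrow> of_real 1 * ip (A (?e k)) (?e m)"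
      by (intro tendsto_mult tendsto_const tendsto_of_real) simp
    then show "(\<lambda>n. ip (X n (?e k)) (?e m)) \<longlonglongrightarrow> ip (A (?e k)) (?e m)"
      unfolding Xe' by simp
  qed
qed

lemma berezin_kernel_eq_closure:
  "berezin_kernel N = weak_star (true_fock (Suc N)) closure_of
    op_span (true_fock (Suc N)) {restrict (weyl \<xi>) (true_fock (Suc N)) | \<xi>. \<xi> \<in> Sigma_set (Suc N)}"
  using berezin_kernel_subset_closure
    closure_of_minimal[OF op_span_subset_berezin_kernel closedin_berezin_kernel] by (rule equalityI)

section \<open>From the Berezin transform to the map Psi\<close>

lemma Psi_eq_berezin:
  assumes "A \<in> bounded_ops (true_fock (Suc N))"
  shows "Psi (Suc N) A = ae_class (berezin N A)"
proof -
  have "convol (true_fock (Suc N)) (rank_one (true_fock (Suc N)) (nkernel (Suc N) 0) (nkernel (Suc N) 0)) A = berezin N A"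
    by (rule ext) (simp add: berezin_def convol_nkernel[OF assms])
  then show ?thesis by (simp add: Psi_def)
qed

lemma berezin_measurable:
  assumes "A \<in> bounded_ops (true_fock (Suc N))"
  shows "berezin N A \<in> borel_measurable lborel"
  using borel_measurable_continuous_onI[OF berezin_continuous[OF assms]] by simp

lemma Psi_in_Linfty:
  assumes A: "A \<in> bounded_ops (true_fock (Suc N))"
  shows "Psi (Suc N) A \<in> Linfty"
proof -
  obtain C where "op_bound C A" using bounded_ops_op_bound[OF A] .
  from berezin_bound[OF this] have "AE z in lborel. cmod (berezin N A z) \<le> C" by simp
  then show ?thesis
    unfolding Psi_eq_berezin[OF A] Linfty_def using berezin_measurable[OF A] by blast
qed

text \<open>The set where two continuous functions differ is open, and an open null set is empty; so
  a class has at most one continuous representative.\<close>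

lemma ae_class_eq_berezin:
  assumes A: "A \<in> bounded_ops (true_fock (Suc N))" and g: "g \<in> borel_measurable lborel" "continuous_on UNIV g"
  shows "Psi (Suc N) A = ae_class g \<longleftrightarrow> berezin N A = g"
proof
  assume "Psi (Suc N) A = ae_class g"
  then have "ae_class (berezin N A) = ae_class g" by (simp add: Psi_eq_berezin[OF A])
  moreover have "g \<in> ae_class g" using g by (simp add: ae_class_def)
  ultimately have "AE z in lborel. g z = berezin N A z" by (auto simp: ae_class_def)
  then have "AE z in lebesgue. g z = berezin N A z" by (rule AE_completion)
  then have "negligible {z. \<not> (g z = berezin N A z)}"
    by (simp add: eventually_ae_filter_negligible) (meson Collect_mono negligible_subset subsetI mem_Collect_eq)
  moreover have "open {z. g z \<noteq> berezin N A z}"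
    using g berezin_continuous[OF A] by (intro open_Collect_neq)
  ultimately have "{z. g z \<noteq> berezin N A z} = {}"
    using open_not_negligible by fastforce
  then show "berezin N A = g" by auto
qed (simp add: Psi_eq_berezin[OF A])

lemma Psi_kernel: "{A \<in> bounded_ops (true_fock (Suc N)). Psi (Suc N) A = ae_class (\<lambda>_. 0)} = berezin_kernel N"
  using ae_class_eq_berezin[of _ "\<lambda>_. 0"] by (auto simp: berezin_kernel_def fun_eq_iff)

lemma Psi_inj:
  assumes "N = 0"
  shows "inj_on (Psi (Suc N)) (bounded_ops (true_fock (Suc N)))"
proof (rule inj_onI)
  let ?H = "true_fock (Suc N)"
  fix A B assume A: "A \<in> bounded_ops ?H" and B: "B \<in> bounded_ops ?H" and eq: "Psi (Suc N) A = Psi (Suc N) B"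
  have ber: "berezin N A = berezin N B"
    using eq ae_class_eq_berezin[OF A berezin_measurable[OF B] berezin_continuous[OF B]] by (simp add: Psi_eq_berezin[OF B])
  \<comment> \<open>The difference A - B is written as a combination of a two-member family, so that
    the lemmas on linear combinations apply.\<close>
  define T where "T i = (if i = (0::nat) then A else B)" for i
  define D where "D = (\<lambda>f\<in>?H. \<lambda>w. \<Sum>i<2. (- 1) ^ i * T i f w)"
  have "\<exists>C. op_bound C (T i)" for i using bounded_ops_op_bound A B by (metis T_def)
  then obtain C where C: "\<And>i. op_bound (C i) (T i)" by metis
  have TB: "T i \<in> bounded_ops ?H" for i using A B by (simp add: T_def)
  have D: "D \<in> bounded_ops ?H"
    using lincomb_op_bound[of "{..<2}" C T "\<lambda>i. (- 1) ^ i", OF C] unfolding D_def op_bound_def by blast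
  have two: "{..<2} = {0, 1 :: nat}" by auto
  have ipD: "ip (D f) g = ip (A f) g - ip (B f) g" if "f \<in> ?H" "g \<in> ?H" for f g
    unfolding D_def ip_lincomb_op[OF TB that] by (simp add: two T_def)
  have "berezin N D z = 0" for z
    using fun_cong[OF ber, of z] by (simp add: berezin_def ipD nkernel_true_fock)
  then have DK: "D \<in> berezin_kernel N" using D by (simp add: berezin_kernel_def)
  \<comment> \<open>With N = 0 the sum over j < N is empty.\<close>
  have "ip (D (ebas N n)) (ebas N m) = 0" for m n
    using berezin_kernel_diagonal[OF DK, of "\<lambda>_. 1" "int m - int n"] assms by auto
  then have D0: "D f = (\<lambda>z. 0)" if "f \<in> ?H" for f by (rule op_eq_zero[OF D _ that])
  have "A f = B f" for f
  proof (cases "f \<in> ?H")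
    case True
    have "A f w = B f w" for w
      using fun_cong[OF D0[OF True], of w] True by (simp add: D_def two T_def)
    then show ?thesis by (rule ext)
  next
    case False
    then show ?thesis using bounded_opsD(4)[OF A] bounded_opsD(4)[OF B] by simp
  qed
  then show "A = B" by (rule ext)
qed

text \<open>A Weyl operator at a zero of the Laguerre polynomial is a nonzero isometry with the same
  image as the zero operator.\<close>

lemma Psi_not_inj:
  assumes "0 < N"
  shows "\<not> inj_on (Psi (Suc N)) (bounded_ops (true_fock (Suc N)))"
proof
  let ?H = "true_fock (Suc N)"
  assume inj: "inj_on (Psi (Suc N)) (bounded_ops ?H)"
  obtain r where r: "0 < r (0::nat)" "laguerre N 0 ((r 0)\<^sup>2) = 0"
    using exists_radii assms by blast
  define \<xi> where "\<xi> = complex_of_real (r 0)"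
  have "\<xi> \<in> Sigma_set (Suc N)" using r by (simp add: Sigma_set_def \<xi>_def)
  note W = weyl_in_berezin_kernel[OF this]
  have Z: "(\<lambda>f\<in>?H. \<lambda>w. 0) \<in> berezin_kernel N"
  proof -
    \<comment> \<open>The zero operator arises as an empty linear combination.\<close>
    have "(\<lambda>f\<in>?H. \<lambda>w. \<Sum>i\<in>{}. (0::complex) * (0::complex)) \<in> bounded_ops ?H"
      using lincomb_op_bound[of "{}" "\<lambda>_. 0" "\<lambda>_. restrict (weyl \<xi>) ?H" "\<lambda>_. 0"] by (simp add: op_bound_def)
    then show ?thesis by (simp add: berezin_kernel_def berezin_def nkernel_true_fock)
  qed
  have "restrict (weyl \<xi>) ?H = (\<lambda>f\<in>?H. \<lambda>w. 0)"
    using W Z inj unfolding Psi_kernel[symmetric] by (auto dest: inj_onD)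
  then have "weyl \<xi> (ebas N 0) = (\<lambda>w. 0)"
    using ebas_true_fock[of N 0] by (metis restrict_apply')
  then have "nrm (ebas N 0) = 0" using nrm_weyl[OF ebas_L2, of \<xi> N 0] by simp
  then show False by (simp add: nrm_basis)
qed

end

theorem theorem3p5:
  fixes k :: nat
  assumes "k \<ge> 1"
  shows "Psi k \<in> bounded_ops (true_fock k) \<rightarrow> Linfty \<and>
    (inj_on (Psi k) (bounded_ops (true_fock k)) \<longleftrightarrow> k = 1) \<and>
    (k > 1 \<longrightarrow>
      {A \<in> bounded_ops (true_fock k). Psi k A = ae_class (\<lambda>_. 0)} =
      (weak_star (true_fock k)) closure_of
        (op_span (true_fock k) {restrict (weyl \<xi>) (true_fock k) | \<xi>. \<xi> \<in> Sigma_set k}))"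
proof -
  obtain N where k: "k = Suc N" using assms by (cases k) auto
  show ?thesis
    unfolding k Psi_kernel berezin_kernel_eq_closure[symmetric]
    using Psi_in_Linfty[of _ N] Psi_inj[of N] Psi_not_inj[of N] by auto
qed

end
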